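(* Given a positive NC measure $\mu$, the following are equivalent: (1) $\mu$ is absolutely continuous. (2) The intersection of $\mathscr H^+(H_{\mu+m})$ with the NC Hardy space $H^2(\mathbb B^d_{\mathbb N})$ is dense in $\mathscr H^+(H_{\mu+m})$.
   Context: Fix $d\in\mathbb N$. $\mathbb F^d$ is the free monoid of words in $1,\dots,d$, with unit $\emptyset$. $\mathbb H^2_d=\ell^2(\mathbb F^d)$ has orthonormal basis $\{e_\alpha\}$, and $1:=e_\emptyset$. $L_ke_\alpha=e_{k\alpha}$ are the left free shifts, and $L^\alpha=L_{i_1}\cdots L_{i_n}$ for $\alpha=i_1\cdots i_n$. $\mathcal A_d$ is the norm-closed unital algebra generated by $L_1,\dots,L_d$; $a\in\mathcal A_d$ is identified with $a1\in\mathbb H^2_d$. $\mathscr A_d$ is the norm closure of $\mathcal A_d+\mathcal A_d^*$; it contains $\mathcal A_d^*\mathcal A_d$. A positive NC measure is a positive linear functional on $\mathscr A_d$; NC Lebesgue measure is $m(a)=\langle1,a1\rangle$. Inner products and forms are conjugate-linear in the first argument. $\mu$ is absolutely continuous if the form $q_\mu(a_1,a_2)=\mu(a_1^*a_2)$, with dense domain $\mathcal A_d\subset\mathbb H^2_d$, is closable, i.e. $a_n\to0$ in $\mathbb H^2_d$ and $q_\mu(a_n-a_k,a_n-a_k)\to0$ imply $q_\mu(a_n,a_n)\to0$. NC function spaces. $\mathbb B^d_{\mathbb N}=\bigsqcup_n\mathbb B^d_n$, where $\mathbb B^d_n$ is the set of $d$-tuples $Z$ of complex $n\times n$ matrices with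 $\sum_kZ_kZ_k^*<I_n$. $H^2(\mathbb B^d_{\mathbb N})$ is the Hilbert space of functions $f(Z)=\sum_\alpha\hat f_\alpha Z^\alpha$ on $\mathbb B^d_{\mathbb N}$ with $\sum_\alpha|\hat f_\alpha|^2<\infty$. For a positive NC measure $\lambda$, $\mathscr H^+(H_\lambda)$ (the right free Herglotz space) is the non-commutative reproducing kernel Hilbert space of NC functions on $\mathbb B^d_{\mathbb N}$ with kernel $$K^\lambda(Z,W)[P]=\tfrac12K(Z,W)\big[H_\lambda(Z)P+PH_\lambda(W)^*\big],\qquad K(Z,W)[P]=\sum_\alpha Z^\alpha P(W^\alpha)^*,$$ where $H_\lambda(Z)=\lambda(I)I_n+2\sum_{\alpha\ne\emptyset}Z^\alpha\overline{\lambda(L^\alpha)}$. Equivalently, let $\mathbb H^2_d(\lambda)$ be the Hilbert space completion of $\mathcal A_d$ modulo the left ideal $N_\lambda=\{a:\lambda(a^*a)=0\}$ with respect to $\langle a_1,a_2\rangle_\lambda=\lambda(a_1^*a_2)$; then $\mathscr H^+(H_\lambda)$ is the space of all Cauchy transforms $(\mathcal C_\lambda x)(Z)=\sum_\alpha Z^\alpha\langle L^\alpha+N_\lambda,x\rangle_\lambda$, $x\in\mathbb H^2_d(\lambda)$, with the norm making $\mathcal C_\lambda$ an isometry onto $\mathscr H^+(H_\lambda)$. Intersections are taken as sets of functions on $\mathbb B^d_{\mathbb N}$, and density is in the norm of $\mathscr H^+(H_{\mu+m})$. *)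

theory Defs
  imports
    "HOL-Analysis.Analysis"
    "HOL-Library.Complex_Order"
    "Jordan_Normal_Form.Schur_Decomposition"
begin

hide_const (open) Finite_Cartesian_Product.vec Finite_Cartesian_Product.mat
no_notation Finite_Cartesian_Product.vec_nth (infixl \<open>$\<close> 90)

section \<open>The Hilbert space of square-summable families\<close>

typedef 'a ell2 = "{f :: 'a \<Rightarrow> complex. (\<lambda>i. (cmod (f i))\<^sup>2) summable_on UNIV}"
  morphisms coord Abs_ell2
  by (rule exI[of _ "\<lambda>_. 0"]) simp

setup_lifting type_definition_ell2

lemma coord_summable: "(\<lambda>i. (cmod (coord x i))\<^sup>2) summable_on UNIV"
  using coord[of x] by simp

lemma sq_summable_add:
  fixes f g :: "'a \<Rightarrow> complex"
  assumes f: "(\<lambda>i. (cmod (f i))\<^sup>2) summable_on UNIV"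
    and g: "(\<lambda>i. (cmod (g i))\<^sup>2) summable_on UNIV"
  shows "(\<lambda>i. (cmod (f i + g i))\<^sup>2) summable_on UNIV"
proof -
  have *: "(\<lambda>i. 2 * (cmod (f i))\<^sup>2 + 2 * (cmod (g i))\<^sup>2) summable_on UNIV"
    by (intro summable_on_add summable_on_cmult_right f g)
  have le: "(cmod (f i + g i))\<^sup>2 \<le> 2 * (cmod (f i))\<^sup>2 + 2 * (cmod (g i))\<^sup>2" for i
  proof -
    have "(cmod (f i + g i))\<^sup>2 \<le> (cmod (f i) + cmod (g i))\<^sup>2"
      by (intro power_mono norm_triangle_ineq) simp
    also have "\<dots> \<le> 2 * (cmod (f i))\<^sup>2 + 2 * (cmod (g i))\<^sup>2"
      using sum_squares_bound[of "cmod (f i)" "cmod (g i)"]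
      by (simp add: power2_sum)
    finally show ?thesis .
  qed
  show ?thesis
    by (rule summable_on_comparison_test[OF *]) (use le in auto)
qed

lemma sq_summable_cmult:
  fixes f :: "'a \<Rightarrow> complex"
  assumes f: "(\<lambda>i. (cmod (f i))\<^sup>2) summable_on UNIV"
  shows "(\<lambda>i. (cmod (c * f i))\<^sup>2) summable_on UNIV"
  unfolding norm_mult power_mult_distrib by (intro summable_on_cmult_right f)

lemma sq_summable_product:
  fixes f g :: "'a \<Rightarrow> complex"
  assumes f: "(\<lambda>i. (cmod (f i))\<^sup>2) summable_on UNIV"
    and g: "(\<lambda>i. (cmod (g i))\<^sup>2) summable_on UNIV"
  shows "(\<lambda>i. cnj (f i) * g i) summable_on UNIV"
proof -
  have "(\<lambda>i. norm (cnj (f i) * g i)) summable_on UNIV"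
    by (rule abs_summable_product) (use f g in \<open>simp_all add: norm_mult power2_eq_square\<close>)
  then show ?thesis by (rule abs_summable_summable)
qed

instantiation ell2 :: (type) real_vector
begin

lift_definition zero_ell2 :: "'a ell2" is "\<lambda>_. 0" by simp
lift_definition plus_ell2 :: "'a ell2 \<Rightarrow> 'a ell2 \<Rightarrow> 'a ell2" is "\<lambda>f g i. f i + g i"
  by (rule sq_summable_add)
lift_definition uminus_ell2 :: "'a ell2 \<Rightarrow> 'a ell2" is "\<lambda>f i. - f i" by simp
lift_definition minus_ell2 :: "'a ell2 \<Rightarrow> 'a ell2 \<Rightarrow> 'a ell2" is "\<lambda>f g i. f i - g i"
  subgoal for f g using sq_summable_add[of f "\<lambda>i. - g i"] by simp
  done
lift_definition scaleR_ell2 :: "real \<Rightarrow> 'a ell2 \<Rightarrow> 'a ell2" is "\<lambda>r f i. of_real r * f i"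
  by (rule sq_summable_cmult)

instance
  by standard (transfer; simp add: algebra_simps fun_eq_iff)+

end

lift_definition cscale :: "complex \<Rightarrow> 'a ell2 \<Rightarrow> 'a ell2" is "\<lambda>c f i. c * f i"
  by (rule sq_summable_cmult)

definition cinner :: "'a ell2 \<Rightarrow> 'a ell2 \<Rightarrow> complex" where
  "cinner x y = (\<Sum>\<^sub>\<infinity>i. cnj (coord x i) * coord y i)"

lemma cinner_summable: "(\<lambda>i. cnj (coord x i) * coord y i) summable_on UNIV"
  by (intro sq_summable_product coord_summable)

lemma cinner_add_right: "cinner x (y + z) = cinner x y + cinner x z"
  unfolding cinner_def plus_ell2.rep_eq distrib_left
  by (intro infsum_add cinner_summable)

lemma cinner_commute: "cinner y x = cnj (cinner x y)"
  unfolding cinner_def infsum_cnj[symmetric] by (simp add: mult.commute)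

lemma cinner_cscale_right: "cinner x (cscale c y) = c * cinner x y"
  unfolding cinner_def cscale.rep_eq infsum_cmult_right'[symmetric]
  by (simp add: algebra_simps)

lemma scaleR_cscale: "r *\<^sub>R x = cscale (of_real r) x"
  by transfer simp

lemma cinner_self: "cinner x x = of_real (\<Sum>\<^sub>\<infinity>i. (cmod (coord x i))\<^sup>2)"
proof -
  have "cinner x x = (\<Sum>\<^sub>\<infinity>i. complex_of_real ((cmod (coord x i))\<^sup>2))"
    unfolding cinner_def by (simp only: complex_norm_square mult.commute)
  also have "\<dots> = of_real (\<Sum>\<^sub>\<infinity>i. (cmod (coord x i))\<^sup>2)"
    by (intro infsumI has_sum_bounded_linear[OF bounded_linear_of_real] has_sum_infsum
        coord_summable)
  finally show ?thesis .
qed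

instantiation ell2 :: (type) real_inner
begin

definition "inner x y = Re (cinner x y)" for x y :: "'a ell2"
definition "norm x = sqrt (Re (cinner x x))" for x :: "'a ell2"
definition "dist x y = norm (x - y)" for x y :: "'a ell2"
definition "sgn x = x /\<^sub>R norm x" for x :: "'a ell2"
definition "uniformity = (INF e\<in>{0<..}. principal {(x :: 'a ell2, y). dist x y < e})"
definition "open U = (\<forall>x\<in>U. \<forall>\<^sub>F (x', y) in uniformity. x' = x \<longrightarrow> y \<in> U)" for U :: "'a ell2 set"

instance
proof
  fix x y z :: "'a ell2" and r :: real
  show "dist x y = norm (x - y)" by (rule dist_ell2_def)
  show "sgn x = x /\<^sub>R norm x" by (rule sgn_ell2_def)
  show "uniformity = (INF e\<in>{0<..}. principal {(x :: 'a ell2, y). dist x y < e})"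
    by (rule uniformity_ell2_def)
  show "open U = (\<forall>x\<in>U. \<forall>\<^sub>F (x', y) in uniformity. x' = x \<longrightarrow> y \<in> U)" for U :: "'a ell2 set"
    by (rule open_ell2_def)
  show comm: "inner x y = inner y x" for x y :: "'a ell2"
    unfolding inner_ell2_def by (subst cinner_commute) simp
  have "inner z (x + y) = inner z x + inner z y"
    unfolding inner_ell2_def by (simp add: cinner_add_right)
  then show "inner (x + y) z = inner x z + inner y z" by (simp add: comm)
  have "inner y (r *\<^sub>R x) = r * inner y x"
    unfolding inner_ell2_def by (simp add: scaleR_cscale cinner_cscale_right)
  then show "inner (r *\<^sub>R x) y = r * inner x y" by (simp add: comm)
  show "0 \<le> inner x x"
    unfolding inner_ell2_def cinner_self by (simp add: infsum_nonneg)
  show "inner x x = 0 \<longleftrightarrow> x = 0"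
  proof
    assume "inner x x = 0"
    then have s: "(\<Sum>\<^sub>\<infinity>i. (cmod (coord x i))\<^sup>2) = 0"
      unfolding inner_ell2_def cinner_self by simp
    have "(cmod (coord x i))\<^sup>2 = 0" for i
      by (rule nonneg_infsum_le_0D[where A = UNIV])
        (use s coord_summable[of x] in auto)
    then have "coord x i = 0" for i by simp
    then show "x = 0"
      by (simp add: coord_inject[symmetric] zero_ell2.rep_eq fun_eq_iff)
  qed (simp add: inner_ell2_def cinner_def zero_ell2.rep_eq)
  show "norm x = sqrt (inner x x)"
    unfolding norm_ell2_def inner_ell2_def ..
qed

end

lemma norm_ell2: "norm x = sqrt (\<Sum>\<^sub>\<infinity>i. (cmod (coord x i))\<^sup>2)"
  unfolding norm_ell2_def cinner_self by simp

lemma norm_cscale: "norm (cscale c x) = cmod c * norm x"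
  unfolding norm_ell2 cscale.rep_eq norm_mult power_mult_distrib infsum_cmult_right'
  by (simp add: real_sqrt_mult)

lemma cscale_add_right: "cscale c (x + y) = cscale c x + cscale c y"
  by transfer (simp add: algebra_simps)

lemma cscale_scaleR: "cscale c (r *\<^sub>R x) = r *\<^sub>R cscale c x"
  by transfer (simp add: algebra_simps)

lift_definition ket :: "'a \<Rightarrow> 'a ell2" is "\<lambda>a i. if i = a then 1 else 0"
  subgoal for a
    by (rule finite_nonzero_values_imp_summable_on, rule finite_subset[of _ "{a}"]) auto
  done

text \<open>
  Bounded operators are elements of the library type of bounded real-linear maps; the operators
  in the algebras below are automatically complex-linear, and the complex scalar action on
  operators has to be added.
\<close>

type_synonym 'a op = "'a ell2 \<Rightarrow>\<^sub>L 'a ell2"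

lemma bounded_linear_cscale: "bounded_linear (cscale c)"
  by (rule bounded_linear_intro[where K = "cmod c"])
    (simp_all add: cscale_add_right cscale_scaleR norm_cscale)

definition cscale_op :: "complex \<Rightarrow> 'a op \<Rightarrow> 'a op" where
  "cscale_op c T = Blinfun (cscale c) o\<^sub>L T"

lemma blinfun_apply_cscale_op: "blinfun_apply (cscale_op c T) x = cscale c (blinfun_apply T x)"
  unfolding cscale_op_def by (simp add: bounded_linear_Blinfun_apply bounded_linear_cscale)

definition adj :: "'a op \<Rightarrow> 'a op" where
  "adj T = (THE S. \<forall>x y. cinner x (blinfun_apply S y) = cinner (blinfun_apply T x) y)"

definition positive_op :: "'a op \<Rightarrow> bool" where
  "positive_op T \<longleftrightarrow> (\<forall>x. 0 \<le> cinner x (blinfun_apply T x))"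


section \<open>The free disk algebra and positive NC measures\<close>

text \<open>
  Words over the alphabet \<^typ>\<open>'d\<close> (a finite type with \<open>d\<close> elements) are lists, and
  \<^typ>\<open>'d list ell2\<close> is the free Fock space.
\<close>

abbreviation vacuum :: "'d list ell2" where
  "vacuum \<equiv> ket []"

definition shift_fun :: "'d \<Rightarrow> ('d list \<Rightarrow> complex) \<Rightarrow> 'd list \<Rightarrow> complex" where
  "shift_fun k f \<beta> = (case \<beta> of [] \<Rightarrow> 0 | j # \<gamma> \<Rightarrow> if j = k then f \<gamma> else 0)"

lemma shift_fun_has_sum:
  assumes "((\<lambda>i. (cmod (f i))\<^sup>2) has_sum s) UNIV"
  shows "((\<lambda>i. (cmod (shift_fun k f i))\<^sup>2) has_sum s) UNIV"
proof -
  have "((\<lambda>i. (cmod (shift_fun k f i))\<^sup>2) has_sum s) (range (Cons k))"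
    by (subst has_sum_reindex) (use assms in \<open>simp_all add: o_def shift_fun_def\<close>)
  moreover have "shift_fun k f i = 0" if "i \<notin> range (Cons k)" for i
    using that by (auto simp: shift_fun_def split: list.splits)
  ultimately show ?thesis
    by (subst has_sum_cong_neutral[where T = "range (Cons k)"]) auto
qed

lift_definition shift_vec :: "'d \<Rightarrow> 'd list ell2 \<Rightarrow> 'd list ell2" is shift_fun
  unfolding summable_on_def by (erule exE, rule exI, rule shift_fun_has_sum)

lift_definition left_shift :: "'d \<Rightarrow> 'd list op" is shift_vec
proof (rule bounded_linear_intro[where K = 1])
  fix k :: 'd and x y :: "'d list ell2" and r :: real
  show "shift_vec k (x + y) = shift_vec k x + shift_vec k y"
    by transfer (auto simp: shift_fun_def fun_eq_iff split: list.splits)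
  show "shift_vec k (r *\<^sub>R x) = r *\<^sub>R shift_vec k x"
    by transfer (auto simp: shift_fun_def fun_eq_iff split: list.splits)
  have "(\<Sum>\<^sub>\<infinity>i. (cmod (coord (shift_vec k x) i))\<^sup>2) = (\<Sum>\<^sub>\<infinity>i. (cmod (coord x i))\<^sup>2)"
    unfolding shift_vec.rep_eq
    by (intro infsumI shift_fun_has_sum has_sum_infsum coord_summable)
  then show "norm (shift_vec k x) \<le> norm x * 1"
    unfolding norm_ell2 by simp
qed

lemma left_shift_ket: "blinfun_apply (left_shift k) (ket \<alpha>) = ket (k # \<alpha>)"
  unfolding left_shift.rep_eq
  by transfer (auto simp: shift_fun_def fun_eq_iff split: list.splits)

definition word_op :: "'d list \<Rightarrow> 'd list op" where
  "word_op \<alpha> = foldr (\<lambda>k T. left_shift k o\<^sub>L T) \<alpha> id_blinfun"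

definition unital_subalgebra :: "'a op set \<Rightarrow> bool" where
  "unital_subalgebra S \<longleftrightarrow>
     id_blinfun \<in> S \<and>
     (\<forall>T\<in>S. \<forall>c. cscale_op c T \<in> S) \<and>
     (\<forall>T\<in>S. \<forall>U\<in>S. T + U \<in> S \<and> T o\<^sub>L U \<in> S)"

definition disk_algebra :: "'d list op set" where
  "disk_algebra = (\<lambda>S. closed S \<and> unital_subalgebra S) hull range left_shift"

definition disk_system :: "'d list op set" where
  "disk_system = closure {a + adj b | a b. a \<in> disk_algebra \<and> b \<in> disk_algebra}"

text \<open>
  A functional on the free disk system is a function on all operators of which only the values
  on \<^const>\<open>disk_system\<close> matter.
\<close>

definition positive_nc_measure :: "('d list op \<Rightarrow> complex) \<Rightarrow> bool" where
  "positive_nc_measure \<mu> \<longleftrightarrow>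
     (\<forall>S\<in>disk_system. \<forall>T\<in>disk_system. \<mu> (S + T) = \<mu> S + \<mu> T) \<and>
     (\<forall>T\<in>disk_system. \<forall>c. \<mu> (cscale_op c T) = c * \<mu> T) \<and>
     (\<forall>T\<in>disk_system. positive_op T \<longrightarrow> 0 \<le> \<mu> T)"

definition nc_lebesgue :: "'d list op \<Rightarrow> complex" where
  "nc_lebesgue T = cinner vacuum (blinfun_apply T vacuum)"

definition nc_form :: "('d list op \<Rightarrow> complex) \<Rightarrow> 'd list op \<Rightarrow> 'd list op \<Rightarrow> complex" where
  "nc_form \<mu> a b = \<mu> (adj a o\<^sub>L b)"

text \<open>An operator \<open>a\<close> in the disk algebra is identified with the vector \<open>a 1\<close>.\<close>

definition absolutely_continuous_nc :: "('d list op \<Rightarrow> complex) \<Rightarrow> bool" where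
  "absolutely_continuous_nc \<mu> \<longleftrightarrow>
     (\<forall>a :: nat \<Rightarrow> 'd list op.
        (\<forall>n. a n \<in> disk_algebra) \<longrightarrow>
        (\<lambda>n. blinfun_apply (a n) vacuum) \<longlonglongrightarrow> 0 \<longrightarrow>
        ((\<lambda>(n, k). nc_form \<mu> (a n - a k) (a n - a k)) \<longlongrightarrow> 0)
          (sequentially \<times>\<^sub>F sequentially) \<longrightarrow>
        (\<lambda>n. nc_form \<mu> (a n) (a n)) \<longlonglongrightarrow> 0)"


section \<open>The NC unit ball and NC functions\<close>

type_synonym 'd point = "'d \<Rightarrow> complex mat"
type_synonym 'd nc_fun = "'d point \<Rightarrow> complex mat"

definition pos_def :: "nat \<Rightarrow> complex mat \<Rightarrow> bool" where
  "pos_def n A \<longleftrightarrow> (\<forall>v \<in> carrier_vec n. v \<noteq> 0\<^sub>v n \<longrightarrow> 0 < (A *\<^sub>v v) \<bullet>c v)"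

definition row_gram :: "nat \<Rightarrow> 'd::finite point \<Rightarrow> complex mat" where
  "row_gram n Z = Matrix.mat n n (\<lambda>(i, j). \<Sum>k\<in>UNIV. (Z k * mat_adjoint (Z k)) $$ (i, j))"

definition nc_ball_level :: "nat \<Rightarrow> 'd::finite point set" where
  "nc_ball_level n = {Z. (\<forall>k. Z k \<in> carrier_mat n n) \<and> pos_def n (1\<^sub>m n - row_gram n Z)}"

definition nc_ball :: "'d::finite point set" where
  "nc_ball = (\<Union>n\<in>{1..}. nc_ball_level n)"

definition level :: "'d point \<Rightarrow> nat" where
  "level Z = (THE n. \<forall>k. Z k \<in> carrier_mat n n)"

definition word_mat :: "'d point \<Rightarrow> 'd list \<Rightarrow> complex mat" where
  "word_mat Z \<alpha> = foldr (\<lambda>k A. Z k * A) \<alpha> (1\<^sub>m (level Z))"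

definition direct_sum :: "complex mat \<Rightarrow> complex mat \<Rightarrow> complex mat" where
  "direct_sum A B =
     four_block_mat A (0\<^sub>m (dim_row A) (dim_col B)) (0\<^sub>m (dim_row B) (dim_col A)) B"

text \<open>
  Functions on the NC ball are extensional (\<^const>\<open>undefined\<close> off the ball), so that equality
  of such functions is equality on the ball.
\<close>

definition nc_function :: "'d::finite nc_fun \<Rightarrow> bool" where
  "nc_function f \<longleftrightarrow>
     f \<in> extensional nc_ball \<and>
     (\<forall>Z\<in>nc_ball. f Z \<in> carrier_mat (level Z) (level Z)) \<and>
     (\<forall>Z\<in>nc_ball. \<forall>W\<in>nc_ball. f (\<lambda>k. direct_sum (Z k) (W k)) = direct_sum (f Z) (f W)) \<and>
     (\<forall>Z\<in>nc_ball. \<forall>S \<in> carrier_mat (level Z) (level Z). \<forall>T \<in> carrier_mat (level Z) (level Z).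
        inverts_mat S T \<longrightarrow> inverts_mat T S \<longrightarrow> (\<lambda>k. S * Z k * T) \<in> nc_ball \<longrightarrow>
        f (\<lambda>k. S * Z k * T) = S * f Z * T)"

definition nf_zero :: "'d::finite nc_fun" where
  "nf_zero = (\<lambda>Z\<in>nc_ball. 0\<^sub>m (level Z) (level Z))"

definition nf_add :: "'d::finite nc_fun \<Rightarrow> 'd nc_fun \<Rightarrow> 'd nc_fun" where
  "nf_add f g = (\<lambda>Z\<in>nc_ball. f Z + g Z)"

definition nf_scale :: "complex \<Rightarrow> 'd::finite nc_fun \<Rightarrow> 'd nc_fun" where
  "nf_scale c f = (\<lambda>Z\<in>nc_ball. c \<cdot>\<^sub>m f Z)"

definition nf_diff :: "'d::finite nc_fun \<Rightarrow> 'd nc_fun \<Rightarrow> 'd nc_fun" where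
  "nf_diff f g = nf_add f (nf_scale (-1) g)"

text \<open>
  All infinite sums of matrices below converge absolutely in each entry on the ball: for a strict
  row contraction \<open>Z\<close> of size \<open>n\<close> and norm \<open>r < 1\<close>, the squared Hilbert-Schmidt norms of the
  \<open>Z\<^sup>\<alpha>\<close> with \<open>\<alpha>\<close> of length \<open>l\<close> add up to at most \<open>n r\<^sup>2\<^sup>l\<close>, while the squares of the
  coefficients with \<open>\<alpha>\<close> of length \<open>l\<close> have a sum bounded independently of \<open>l\<close>.
\<close>

definition power_series :: "('d list \<Rightarrow> complex) \<Rightarrow> 'd nc_fun" where
  "power_series c Z =
     Matrix.mat (level Z) (level Z) (\<lambda>(i, j). \<Sum>\<^sub>\<infinity>\<alpha>. c \<alpha> * word_mat Z \<alpha> $$ (i, j))"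

definition nc_hardy :: "'d::finite nc_fun set" where
  "nc_hardy = {restrict (power_series c) nc_ball | c. (\<lambda>\<alpha>. (cmod (c \<alpha>))\<^sup>2) summable_on UNIV}"


section \<open>NC reproducing kernel Hilbert spaces\<close>

type_synonym 'd nc_kernel = "'d point \<Rightarrow> 'd point \<Rightarrow> complex mat \<Rightarrow> complex mat"

definition rank_one :: "complex vec \<Rightarrow> complex vec \<Rightarrow> complex mat" where
  "rank_one u v = Matrix.mat (dim_vec u) (dim_vec v) (\<lambda>(i, j). vec_index u i * cnj (vec_index v j))"

text \<open>
  The kernel function \<open>K\<^bsub>Z,y,v\<^esub>\<close> is determined by
  \<open>K\<^bsub>Z,y,v\<^esub>(W) u = K(W,Z)[u v\<^sup>*] y\<close>, where \<^term>\<open>rank_one u v\<close> is \<open>u v\<^sup>*\<close>; its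
  columns are obtained from the unit vectors \<open>u\<close>.
\<close>

definition kernel_fun :: "'d::finite nc_kernel \<Rightarrow> 'd point \<Rightarrow> complex vec \<Rightarrow> complex vec \<Rightarrow> 'd nc_fun" where
  "kernel_fun K Z y v =
     (\<lambda>W\<in>nc_ball. Matrix.mat (level W) (level W)
        (\<lambda>(i, j). vec_index (K W Z (rank_one (unit_vec (level W) j) v) *\<^sub>v y) i))"

definition ip_norm :: "('f \<Rightarrow> 'f \<Rightarrow> complex) \<Rightarrow> 'f \<Rightarrow> real" where
  "ip_norm ip f = sqrt (Re (ip f f))"

text \<open>
  The predicate \<open>nc_rkhs K H ip\<close> says that the set \<open>H\<close> of NC functions with the inner product
  \<open>ip\<close> (conjugate-linear in the first argument) is the Hilbert space with reproducing kernel
  \<open>K\<close>. It determines \<open>H\<close>, and \<open>ip\<close> on \<open>H\<close>, since the kernel functions span a dense subspace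
  on which \<open>ip\<close> is given by \<open>K\<close>. The term \<open>(f Z *\<^sub>v v) \<bullet>c y\<close> is \<open>y\<^sup>* f(Z) v\<close>.
\<close>

locale nc_rkhs =
  fixes K :: "'d::finite nc_kernel"
    and H :: "'d nc_fun set"
    and ip :: "'d nc_fun \<Rightarrow> 'd nc_fun \<Rightarrow> complex"
  assumes nc_function: "f \<in> H \<Longrightarrow> nc_function f"
    and zero_mem: "nf_zero \<in> H"
    and add_mem: "f \<in> H \<Longrightarrow> g \<in> H \<Longrightarrow> nf_add f g \<in> H"
    and scale_mem: "f \<in> H \<Longrightarrow> nf_scale c f \<in> H"
    and ip_add_right: "f \<in> H \<Longrightarrow> g \<in> H \<Longrightarrow> h \<in> H \<Longrightarrow> ip f (nf_add g h) = ip f g + ip f h"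
    and ip_scale_right: "f \<in> H \<Longrightarrow> g \<in> H \<Longrightarrow> ip f (nf_scale c g) = c * ip f g"
    and ip_commute: "f \<in> H \<Longrightarrow> g \<in> H \<Longrightarrow> ip g f = cnj (ip f g)"
    and ip_nonneg: "f \<in> H \<Longrightarrow> 0 \<le> ip f f"
    and ip_definite: "f \<in> H \<Longrightarrow> ip f f = 0 \<Longrightarrow> f = nf_zero"
    and complete:
      "range X \<subseteq> H \<Longrightarrow>
       ((\<lambda>(n, k). ip_norm ip (nf_diff (X n) (X k))) \<longlongrightarrow> 0) (sequentially \<times>\<^sub>F sequentially) \<Longrightarrow>
       \<exists>f\<in>H. (\<lambda>n. ip_norm ip (nf_diff (X n) f)) \<longlonglongrightarrow> 0"
    and kernel_fun_mem:
      "Z \<in> nc_ball \<Longrightarrow> y \<in> carrier_vec (level Z) \<Longrightarrow> v \<in> carrier_vec (level Z) \<Longrightarrow>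
       kernel_fun K Z y v \<in> H"
    and reproducing:
      "Z \<in> nc_ball \<Longrightarrow> y \<in> carrier_vec (level Z) \<Longrightarrow> v \<in> carrier_vec (level Z) \<Longrightarrow> f \<in> H \<Longrightarrow>
       ip (kernel_fun K Z y v) f = (f Z *\<^sub>v v) \<bullet>c y"

definition dense_in_norm :: "('d::finite nc_fun \<Rightarrow> 'd nc_fun \<Rightarrow> complex) \<Rightarrow> 'd nc_fun set \<Rightarrow> 'd nc_fun set \<Rightarrow> bool" where
  "dense_in_norm ip D H \<longleftrightarrow> D \<subseteq> H \<and> (\<forall>f\<in>H. \<forall>\<epsilon>>0. \<exists>g\<in>D. ip_norm ip (nf_diff f g) < \<epsilon>)"


section \<open>The free Herglotz kernel\<close>

definition szego_kernel :: "'d nc_kernel" where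
  "szego_kernel Z W P =
     Matrix.mat (level Z) (level W)
       (\<lambda>(i, j). \<Sum>\<^sub>\<infinity>\<alpha>. (word_mat Z \<alpha> * P * mat_adjoint (word_mat W \<alpha>)) $$ (i, j))"

definition herglotz_fun :: "('d list op \<Rightarrow> complex) \<Rightarrow> 'd nc_fun" where
  "herglotz_fun \<mu> Z =
     \<mu> id_blinfun \<cdot>\<^sub>m 1\<^sub>m (level Z) +
     2 \<cdot>\<^sub>m power_series (\<lambda>\<alpha>. if \<alpha> = [] then 0 else cnj (\<mu> (word_op \<alpha>))) Z"

definition herglotz_kernel :: "('d list op \<Rightarrow> complex) \<Rightarrow> 'd nc_kernel" where
  "herglotz_kernel \<mu> Z W P =
     (1/2) \<cdot>\<^sub>m szego_kernel Z W (herglotz_fun \<mu> Z * P + P * mat_adjoint (herglotz_fun \<mu> W))"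

end

theory Submission
  imports Defs
begin

text \<open>
  Let \<open>\<nu> = \<mu> + m\<close>. The idea is to compare two Hilbert spaces in which the free polynomials are
  dense: the completion for the form of \<open>\<nu>\<close>, realized as the given reproducing kernel space \<open>H\<close>
  through the Cauchy transform, and the Fock space. Since the form of \<open>\<nu>\<close> dominates that of the
  vacuum state \<open>m\<close>, the inclusion \<open>p \<mapsto> p 1\<close> extends to a contraction \<open>E\<close> from the first to the second. The
  measure \<open>\<mu>\<close> is absolutely continuous exactly if \<open>E\<close> is injective, hence exactly if the range of
  \<open>E\<^sup>*\<close> is dense; and the Cauchy transform of \<open>E\<^sup>* h\<close> has the coefficients
  \<open>\<langle>L\<^sup>\<alpha> 1, h\<rangle> = h\<^sub>\<alpha>\<close>, so that this range is the intersection of \<open>H\<close> with the NC Hardy space.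

  Neither the completion nor the operators \<open>E\<close> and \<open>E\<^sup>*\<close> are constructed; the argument takes place in
  \<open>H\<close>. The starting point is that \<open>H\<close> contains the Cauchy transforms of the words: evaluation at
  the upper right corner of a nilpotent point built from a word \<open>\<alpha>\<close> picks out the coefficient of a
  power series at \<open>\<alpha>\<close>, so a multiple \<open>word_fun \<alpha>\<close> of the kernel function at this point represents
  the coefficient functional. The kernel functions of the Herglotz kernel are computed as power
  series (\<open>kernel_fun_power_series\<close>), which shows that \<open>\<langle>word_fun \<alpha>, word_fun \<beta>\<rangle>\<close> is
  \<open>\<nu> ((L\<^sup>\<alpha>)\<^sup>* L\<^sup>\<beta>)\<close> (\<open>ip_word_fun_word_fun\<close>). By linearity the polynomials with the form of \<open>\<nu>\<close> are
  isometrically represented in \<open>H\<close>; the relation \<open>rep\<close> records this.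

  Every \<open>f\<close> in \<open>H\<close> is the power series of its coefficients (\<open>power_series_expansion\<close>): the kernel
  functions are, and both sides of this equation depend continuously on \<open>f\<close>, because the words of a
  given length are orthogonal in \<open>H\<close> and the words of a strict row contraction decay geometrically
  with the length. In particular the transforms of polynomials are dense in \<open>H\<close>, and
  an \<open>f\<close> in \<open>H\<close> belongs to the Hardy space exactly if its coefficients are square-summable, with
  \<open>\<langle>f\<^sub>p, f\<rangle> = \<langle>p 1, h\<rangle>\<close> if \<open>h\<close> is the vector of these coefficients and \<open>f\<^sub>p\<close> represents the
  polynomial \<open>p\<close> (\<open>ip_rep_coord\<close>). This is the duality between \<open>E\<close> and \<open>E\<^sup>*\<close>.

  If \<open>\<mu>\<close> is absolutely continuous and \<open>x\<close> is orthogonal to the intersection, approximate \<open>x\<close> by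
  transforms of polynomials \<open>p\<^sub>n\<close>. The Riesz theorem turns every \<open>h\<close> into an element of the
  intersection, so \<open>p\<^sub>n 1\<close> tends weakly to zero; it is Cauchy, hence tends to zero in norm, and
  closability gives \<open>x = 0\<close>. Conversely, if the intersection is dense, a sequence that tests
  closability may be replaced by polynomials; their transforms converge to some \<open>x\<close> which is
  orthogonal to the intersection by the duality, so \<open>x = 0\<close>.
\<close>

section \<open>Inner product and adjoints on the space of square-summable families\<close>

lemma coord_simps [simp]:
  "coord (x + y) i = coord x i + coord y i"
  "coord (x - y) i = coord x i - coord y i"
  "coord (- x) i = - coord x i"
  "coord 0 i = 0"
  "coord (cscale c x) i = c * coord x i"
  "coord (ket a) i = (if i = a then 1 else 0)"
  by (simp_all add: plus_ell2.rep_eq minus_ell2.rep_eq uminus_ell2.rep_eq zero_ell2.rep_eq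
      cscale.rep_eq ket.rep_eq)

lemma ell2_eqI: "(\<And>i. coord x i = coord y i) \<Longrightarrow> x = y"
  by (simp add: coord_inject[symmetric] fun_eq_iff)

lemma cinner_add_left: "cinner (x + y) z = cinner x z + cinner y z"
  by (metis cinner_add_right cinner_commute complex_cnj_add)

lemma cinner_cscale_left: "cinner (cscale c x) y = cnj c * cinner x y"
  by (metis cinner_cscale_right cinner_commute complex_cnj_mult)

lemma minus_cscale: "- x = cscale (-1) x"
  by (rule ell2_eqI) simp

lemma cinner_minus_right: "cinner x (- y) = - cinner x y"
  by (simp add: minus_cscale cinner_cscale_right)

lemma cinner_minus_left: "cinner (- x) y = - cinner x y"
  by (simp add: minus_cscale cinner_cscale_left)

lemma cinner_diff_right: "cinner x (y - z) = cinner x y - cinner x z"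
  using cinner_add_right[of x y "- z"] by (simp add: cinner_minus_right)

lemma cinner_diff_left: "cinner (x - y) z = cinner x z - cinner y z"
  using cinner_add_left[of x "- y" z] by (simp add: cinner_minus_left)

lemma cinner_zero [simp]: "cinner x 0 = 0" "cinner 0 x = 0"
  by (simp_all add: cinner_def)

lemma cinner_self_norm: "cinner x x = of_real ((norm x)\<^sup>2)"
  unfolding norm_ell2 cinner_self by (simp add: infsum_nonneg)

lemma norm_cinner_le: "cmod (cinner x y) \<le> norm x * norm y"
proof (cases "cinner x y = 0")
  case False
  define c where "c = cnj (cinner x y) / of_real (cmod (cinner x y))"
  have c: "cmod c = 1"
    using False by (simp add: c_def norm_divide)
  have "cinner x (cscale c y) = of_real (cmod (cinner x y))"
    using False complex_norm_square[of "cinner x y"]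
    by (simp add: c_def cinner_cscale_right field_simps power2_eq_square)
  then have "cmod (cinner x y) = inner x (cscale c y)"
    by (simp add: inner_ell2_def)
  also have "\<dots> \<le> norm x * norm y"
    using norm_cauchy_schwarz[of x "cscale c y"] c by (simp add: norm_cscale)
  finally show ?thesis .
qed simp

lemma bounded_bilinear_cinner: "bounded_bilinear cinner"
proof
  show "\<exists>K. \<forall>a b. norm (cinner a b) \<le> norm a * norm b * K"
    using norm_cinner_le by (intro exI[of _ 1]) auto
qed (simp_all add: cinner_add_left cinner_add_right scaleR_cscale cinner_cscale_left
    cinner_cscale_right scaleR_conv_of_real)

lemmas tendsto_cinner = bounded_bilinear.tendsto[OF bounded_bilinear_cinner]

lemma cinner_ket_left: "cinner (ket a) x = coord x a"
proof -
  have "cinner (ket a) x = (\<Sum>\<^sub>\<infinity>i\<in>{a}. coord x i)"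
    unfolding cinner_def by (rule infsum_cong_neutral) auto
  then show ?thesis by simp
qed

lemma cinner_ext: "(\<And>x. cinner x y = cinner x z) \<Longrightarrow> y = z"
  by (rule ell2_eqI) (metis cinner_ket_left)

lemma cinner_sum_left: "cinner (\<Sum>i\<in>S. f i) x = (\<Sum>i\<in>S. cinner (f i) x)"
  by (induction S rule: infinite_finite_induct) (simp_all add: cinner_add_left)

lemma coord_sum: "coord (\<Sum>i\<in>S. f i) j = (\<Sum>i\<in>S. coord (f i) j)"
  by (induction S rule: infinite_finite_induct) simp_all

definition finite_part :: "'a set \<Rightarrow> 'a ell2 \<Rightarrow> 'a ell2" where
  "finite_part S x = (\<Sum>i\<in>S. cscale (coord x i) (ket i))"

lemma finite_part_tendsto: "((\<lambda>S. finite_part S x) \<longlongrightarrow> x) (finite_subsets_at_top UNIV)"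
proof -
  let ?s = "\<Sum>\<^sub>\<infinity>i. (cmod (coord x i))\<^sup>2"
  have "(norm (x - finite_part S x))\<^sup>2 = ?s - (\<Sum>i\<in>S. (cmod (coord x i))\<^sup>2)"
    if "finite S" for S
  proof -
    have c: "coord (x - finite_part S x) i = (if i \<in> S then 0 else coord x i)" for i
      using that by (simp add: finite_part_def coord_sum if_distrib[of "\<lambda>z. _ * z"] sum.delta cong: if_cong)
    have "(norm (x - finite_part S x))\<^sup>2 = (\<Sum>\<^sub>\<infinity>i. (cmod (coord (x - finite_part S x) i))\<^sup>2)"
      by (simp add: norm_ell2 infsum_nonneg)
    also have "\<dots> = (\<Sum>\<^sub>\<infinity>i\<in>UNIV - S. (cmod (coord x i))\<^sup>2)"
      unfolding c by (rule infsum_cong_neutral) auto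
    also have "\<dots> = ?s - (\<Sum>\<^sub>\<infinity>i\<in>S. (cmod (coord x i))\<^sup>2)"
      by (rule infsum_Diff[OF coord_summable]) (use that in auto)
    finally show ?thesis using that by simp
  qed
  then have ev: "\<forall>\<^sub>F S in finite_subsets_at_top UNIV.
      ?s - (\<Sum>i\<in>S. (cmod (coord x i))\<^sup>2) = (norm (x - finite_part S x))\<^sup>2"
    by (intro eventually_finite_subsets_at_top_weakI) simp
  have "((\<lambda>S. ?s - (\<Sum>i\<in>S. (cmod (coord x i))\<^sup>2)) \<longlongrightarrow> ?s - ?s) (finite_subsets_at_top UNIV)"
    by (intro tendsto_intros infsum_tendsto coord_summable)
  then have "((\<lambda>S. (norm (x - finite_part S x))\<^sup>2) \<longlongrightarrow> 0) (finite_subsets_at_top UNIV)"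
    using tendsto_cong[OF ev] by simp
  then have "((\<lambda>S. sqrt ((norm (x - finite_part S x))\<^sup>2)) \<longlongrightarrow> sqrt 0) (finite_subsets_at_top UNIV)"
    by (intro tendsto_intros)
  then have "((\<lambda>S. finite_part S x - x) \<longlongrightarrow> 0) (finite_subsets_at_top UNIV)"
    by (simp add: tendsto_norm_zero_iff[symmetric, of "\<lambda>S. finite_part S x - x"] norm_minus_commute)
  then show ?thesis
    by (simp add: LIM_zero_iff)
qed

text \<open>The type of operators consists of real-linear maps; complex linearity singles out those that
  have an adjoint for the complex inner product.\<close>

definition complex_linear_op :: "'a op \<Rightarrow> bool" where
  "complex_linear_op T \<longleftrightarrow>
     (\<forall>c x. blinfun_apply T (cscale c x) = cscale c (blinfun_apply T x))"

definition is_adj :: "'a op \<Rightarrow> 'a op \<Rightarrow> bool" where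
  "is_adj T S \<longleftrightarrow> (\<forall>x y. cinner x (blinfun_apply S y) = cinner (blinfun_apply T x) y)"

lemma adj_eqI: "is_adj T S \<Longrightarrow> adj T = S"
  unfolding adj_def is_adj_def
  by (rule the_equality) (auto intro!: blinfun_eqI intro: cinner_ext)

lemma complex_linear_opD:
  "complex_linear_op T \<Longrightarrow> blinfun_apply T (cscale c x) = cscale c (blinfun_apply T x)"
  by (simp add: complex_linear_op_def)

lemma sum_sq_images_le:
  assumes T: "complex_linear_op T" and S: "finite S"
  shows "(\<Sum>i\<in>S. (cmod (cinner (blinfun_apply T (ket i)) y))\<^sup>2) \<le> (norm T * norm y)\<^sup>2"
proof -
  define c where "c i = cinner (blinfun_apply T (ket i)) y" for i
  define v where "v = (\<Sum>i\<in>S. cscale (c i) (ket i))"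
  define s where "s = (\<Sum>i\<in>S. (cmod (c i))\<^sup>2)"
  have s0: "0 \<le> s" by (simp add: s_def sum_nonneg)
  have Tv: "cinner (blinfun_apply T v) y = of_real s"
    unfolding v_def s_def
    by (simp add: blinfun.sum_right complex_linear_opD[OF T] cinner_sum_left cinner_cscale_left
        c_def[symmetric] complex_norm_square mult.commute del: of_real_power)
  have cv: "coord v i = (if i \<in> S then c i else 0)" for i
    using S by (simp add: v_def coord_sum if_distrib[of "\<lambda>z. _ * z"] sum.delta cong: if_cong)
  have "(norm v)\<^sup>2 = (\<Sum>\<^sub>\<infinity>i. (cmod (coord v i))\<^sup>2)"
    by (simp add: norm_ell2 infsum_nonneg)
  also have "\<dots> = (\<Sum>\<^sub>\<infinity>i\<in>S. (cmod (c i))\<^sup>2)"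
    unfolding cv by (rule infsum_cong_neutral) auto
  also have "\<dots> = s" using S by (simp add: s_def)
  finally have nv: "norm v = sqrt s" by (metis norm_ge_zero real_sqrt_unique)
  have "s = cmod (cinner (blinfun_apply T v) y)" using Tv s0 by simp
  also have "\<dots> \<le> norm (blinfun_apply T v) * norm y" by (rule norm_cinner_le)
  also have "\<dots> \<le> norm T * norm v * norm y"
    by (intro mult_right_mono norm_blinfun) simp
  finally have "sqrt s * sqrt s \<le> sqrt s * (norm T * norm y)"
    using s0 by (simp add: nv algebra_simps)
  then have "sqrt s \<le> norm T * norm y"
    using s0 by (cases "s = 0") (simp_all del: real_sqrt_mult_self)
  then have "(sqrt s)\<^sup>2 \<le> (norm T * norm y)\<^sup>2" by (rule power_mono) (simp add: s0)
  then show ?thesis using s0 by (simp add: s_def c_def)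
qed

text \<open>The adjoint is written down in coordinates; the estimate above is what makes the
  resulting family square-summable, and a density argument transfers the adjoint relation
  from basis vectors to all vectors.\<close>

lemma ex_is_adj:
  assumes T: "complex_linear_op T"
  shows "\<exists>S. is_adj T S"
proof -
  have sq: "(\<lambda>i. (cmod (cinner (blinfun_apply T (ket i)) y))\<^sup>2) summable_on UNIV" for y
    by (rule nonneg_bdd_above_summable_on)
      (use sum_sq_images_le[OF T] in \<open>auto intro!: bdd_aboveI\<close>)
  define A where "A y = Abs_ell2 (\<lambda>i. cinner (blinfun_apply T (ket i)) y)" for y
  have cA: "coord (A y) i = cinner (blinfun_apply T (ket i)) y" for y i
    unfolding A_def using sq[of y] by (simp add: Abs_ell2_inverse)
  have adj: "cinner x (A y) = cinner (blinfun_apply T x) y" for x y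
  proof -
    let ?F = "finite_subsets_at_top UNIV"
    have eq: "cinner (finite_part S x) (A y) = cinner (blinfun_apply T (finite_part S x)) y" for S
      by (simp add: finite_part_def cinner_sum_left blinfun.sum_right complex_linear_opD[OF T]
          cinner_cscale_left cinner_ket_left cA)
    have "((\<lambda>S. cinner (finite_part S x) (A y)) \<longlongrightarrow> cinner x (A y)) ?F"
      by (intro tendsto_cinner finite_part_tendsto tendsto_const)
    moreover have "((\<lambda>S. cinner (blinfun_apply T (finite_part S x)) y)
        \<longlongrightarrow> cinner (blinfun_apply T x) y) ?F"
      by (intro tendsto_cinner tendsto_const blinfun.tendsto finite_part_tendsto)
    ultimately show ?thesis
      unfolding eq by (rule tendsto_unique[OF finite_subsets_at_top_neq_bot])
  qed
  have "bounded_linear A"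
  proof (rule bounded_linear_intro[where K = "norm T"])
    show "A (x + y) = A x + A y" for x y
      by (rule cinner_ext) (simp add: adj cinner_add_right)
    show "A (r *\<^sub>R x) = r *\<^sub>R A x" for r x
      by (rule cinner_ext) (simp add: adj scaleR_cscale cinner_cscale_right)
    show "norm (A y) \<le> norm y * norm T" for y
    proof -
      have "(norm (A y))\<^sup>2 = cmod (cinner (blinfun_apply T (A y)) y)"
        by (simp add: adj[symmetric] cinner_self_norm del: of_real_power)
      also have "\<dots> \<le> norm (blinfun_apply T (A y)) * norm y" by (rule norm_cinner_le)
      also have "\<dots> \<le> norm T * norm (A y) * norm y"
        by (intro mult_right_mono norm_blinfun) simp
      finally show ?thesis by (cases "norm (A y) = 0") (auto simp: power2_eq_square mult.commute)
    qed
  qed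
  then have "is_adj T (Blinfun A)"
    by (simp add: is_adj_def bounded_linear_Blinfun_apply adj)
  then show ?thesis ..
qed

lemma cinner_adj:
  "complex_linear_op T \<Longrightarrow> cinner x (blinfun_apply (adj T) y) = cinner (blinfun_apply T x) y"
  using ex_is_adj[of T] adj_eqI[of T] unfolding is_adj_def[of T] by blast

lemma complex_linear_op_adj: "complex_linear_op T \<Longrightarrow> complex_linear_op (adj T)"
  unfolding complex_linear_op_def[of "adj T"]
  by (auto intro!: cinner_ext simp: cinner_adj cinner_cscale_right)

lemma cscale_zero [simp]: "cscale c 0 = 0"
  by (rule ell2_eqI) simp

lemma cscale_cscale: "cscale c (cscale d x) = cscale (c * d) x"
  by (rule ell2_eqI) simp

lemma cscale_diff: "cscale c (x - y) = cscale c x - cscale c y"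
  by (rule ell2_eqI) (simp add: algebra_simps)

lemma complex_linear_op_simps [intro]:
  "complex_linear_op S \<Longrightarrow> complex_linear_op T \<Longrightarrow> complex_linear_op (S + T)"
  "complex_linear_op S \<Longrightarrow> complex_linear_op T \<Longrightarrow> complex_linear_op (S - T)"
  "complex_linear_op S \<Longrightarrow> complex_linear_op T \<Longrightarrow> complex_linear_op (S o\<^sub>L T)"
  "complex_linear_op T \<Longrightarrow> complex_linear_op (cscale_op c T)"
  "complex_linear_op id_blinfun"
  "complex_linear_op 0"
  by (auto simp: complex_linear_op_def blinfun.add_left blinfun.diff_left cscale_add_right
      blinfun_apply_cscale_op cscale_cscale cscale_diff mult.commute)

lemma adj_algebra:
  assumes "complex_linear_op S" "complex_linear_op T"
  shows adj_add: "adj (S + T) = adj S + adj T"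
    and adj_diff: "adj (S - T) = adj S - adj T"
    and adj_compose: "adj (S o\<^sub>L T) = adj T o\<^sub>L adj S"
  by (rule adj_eqI; use assms in \<open>simp add: is_adj_def blinfun.add_left blinfun.diff_left cinner_add_right
      cinner_add_left cinner_diff_right cinner_diff_left cinner_adj\<close>)+

lemma adj_cscale_op: "complex_linear_op T \<Longrightarrow> adj (cscale_op c T) = cscale_op (cnj c) (adj T)"
  by (rule adj_eqI) (simp add: is_adj_def blinfun_apply_cscale_op cinner_cscale_right
      cinner_cscale_left cinner_adj)

lemma adj_id [simp]: "adj id_blinfun = id_blinfun"
  by (rule adj_eqI) (simp add: is_adj_def)

lemma adj_zero [simp]: "adj 0 = 0"
  by (rule adj_eqI) (simp add: is_adj_def)

lemma norm_adj_le:
  assumes T: "complex_linear_op T"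
  shows "norm (adj T) \<le> norm T"
proof (rule norm_blinfun_bound)
  fix y
  have "(norm (blinfun_apply (adj T) y))\<^sup>2
      = cmod (cinner (blinfun_apply T (blinfun_apply (adj T) y)) y)"
    by (simp add: cinner_adj[OF T, symmetric] cinner_self_norm del: of_real_power)
  also have "\<dots> \<le> norm (blinfun_apply T (blinfun_apply (adj T) y)) * norm y"
    by (rule norm_cinner_le)
  also have "\<dots> \<le> norm T * norm (blinfun_apply (adj T) y) * norm y"
    by (intro mult_right_mono norm_blinfun) simp
  finally show "norm (blinfun_apply (adj T) y) \<le> norm T * norm y"
    by (cases "norm (blinfun_apply (adj T) y) = 0") (auto simp: power2_eq_square)
qed simp

lemma closed_complex_linear: "closed {T. complex_linear_op T}"
proof -
  have "closed {T :: 'a op. blinfun_apply T (cscale c x) = cscale c (blinfun_apply T x)}" for c x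
    by (intro closed_Collect_eq continuous_intros
        bounded_linear.continuous_on[OF bounded_linear_cscale])
  moreover have "{T :: 'a op. complex_linear_op T}
      = (\<Inter>c x. {T. blinfun_apply T (cscale c x) = cscale c (blinfun_apply T x)})"
    by (auto simp: complex_linear_op_def)
  ultimately show ?thesis by (auto intro: closed_INT)
qed

lemma tendsto_adj:
  assumes "\<And>n. complex_linear_op (T n)" "complex_linear_op S" "T \<longlonglongrightarrow> S"
  shows "(\<lambda>n. adj (T n)) \<longlonglongrightarrow> adj S"
proof -
  have "(\<lambda>n. norm (T n - S)) \<longlonglongrightarrow> 0"
    using assms(3) by (simp add: LIM_zero tendsto_norm_zero)
  moreover have "norm (adj (T n) - adj S) \<le> norm (T n - S)" for n
    using norm_adj_le[of "T n - S"] assms(1,2) by (simp add: adj_diff complex_linear_op_simps)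
  then have "\<forall>\<^sub>F n in sequentially. norm (adj (T n) - adj S) \<le> norm (T n - S)"
    by simp
  ultimately have "(\<lambda>n. adj (T n) - adj S) \<longlonglongrightarrow> 0"
    by (rule Lim_null_comparison[rotated])
  then show ?thesis by (simp add: LIM_zero_iff)
qed

section \<open>Words, the free disk algebra and the free disk system\<close>

lemma word_op_simps [simp]:
  "word_op [] = id_blinfun" "word_op (k # \<alpha>) = left_shift k o\<^sub>L word_op \<alpha>"
  by (simp_all add: word_op_def)

lemma word_op_append: "word_op (\<alpha> @ \<beta>) = word_op \<alpha> o\<^sub>L word_op \<beta>"
  by (induction \<alpha>) (auto intro: blinfun_eqI)

lemma word_op_ket: "blinfun_apply (word_op \<alpha>) (ket \<beta>) = ket (\<alpha> @ \<beta>)"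
  by (induction \<alpha>) (simp_all add: left_shift_ket)

lemma complex_linear_left_shift: "complex_linear_op (left_shift k)"
  unfolding complex_linear_op_def
  by (auto intro!: ell2_eqI simp: left_shift.rep_eq shift_vec.rep_eq shift_fun_def split: list.splits)

lemma complex_linear_word_op [simp]: "complex_linear_op (word_op \<alpha>)"
  by (induction \<alpha>) (auto intro: complex_linear_left_shift)

lemma coord_left_shift: "coord (blinfun_apply (left_shift k) x) \<beta> = shift_fun k (coord x) \<beta>"
  by (simp add: left_shift.rep_eq shift_vec.rep_eq)

lemma cinner_left_shift:
  "cinner (blinfun_apply (left_shift j) x) (blinfun_apply (left_shift k) y)
     = (if j = k then cinner x y else 0)"
proof (cases "j = k")
  case True
  have "cinner (blinfun_apply (left_shift j) x) (blinfun_apply (left_shift k) y)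
      = (\<Sum>\<^sub>\<infinity>i\<in>range (Cons k). cnj (shift_fun k (coord x) i) * shift_fun k (coord y) i)"
    unfolding cinner_def coord_left_shift True
    by (rule infsum_cong_neutral) (auto simp: shift_fun_def split: list.splits)
  also have "\<dots> = cinner x y"
    by (subst infsum_reindex) (simp_all add: o_def shift_fun_def cinner_def)
  finally show ?thesis using True by simp
next
  case False
  then show ?thesis
    unfolding cinner_def coord_left_shift
    by (auto intro!: infsum_0 simp: shift_fun_def split: list.splits)
qed

lemma adj_left_shift: "adj (left_shift j) o\<^sub>L left_shift k = (if j = k then id_blinfun else 0)"
  by (rule blinfun_eqI, rule cinner_ext)
    (simp add: cinner_adj complex_linear_left_shift cinner_left_shift)

lemma adj_word_op_Cons: "adj (word_op (j # \<alpha>)) o\<^sub>L word_op (k # \<beta>)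
    = (if j = k then adj (word_op \<alpha>) o\<^sub>L word_op \<beta> else 0)"
proof -
  have "adj (word_op (j # \<alpha>)) o\<^sub>L word_op (k # \<beta>)
      = adj (word_op \<alpha>) o\<^sub>L (adj (left_shift j) o\<^sub>L left_shift k) o\<^sub>L word_op \<beta>"
    by (simp add: adj_compose complex_linear_left_shift blinfun_eqI)
  then show ?thesis unfolding adj_left_shift by (simp add: blinfun_eqI)
qed

lemma adj_word_op_prefix:
  "adj (word_op \<alpha>) o\<^sub>L word_op (\<alpha> @ \<delta>) = word_op \<delta>"
  "adj (word_op (\<alpha> @ \<delta>)) o\<^sub>L word_op \<alpha> = adj (word_op \<delta>)"
proof -
  show "adj (word_op \<alpha>) o\<^sub>L word_op (\<alpha> @ \<delta>) = word_op \<delta>"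
    by (induction \<alpha>) (simp_all only: append_Cons append_Nil adj_word_op_Cons word_op_simps(1)
        adj_id refl if_True, simp add: blinfun_eqI)
  show "adj (word_op (\<alpha> @ \<delta>)) o\<^sub>L word_op \<alpha> = adj (word_op \<delta>)"
    by (induction \<alpha>) (simp_all only: append_Cons append_Nil adj_word_op_Cons word_op_simps(1)
        adj_id refl if_True, simp add: blinfun_eqI)
qed

text \<open>Words act as isometries, and the ranges of two words are orthogonal unless one word is a prefix
  of the other: the common prefix cancels, and distinct next letters give zero.\<close>

lemma adj_word_op_cases:
  obtains (left) \<delta> where "\<beta> = \<alpha> @ \<delta>" "adj (word_op \<alpha>) o\<^sub>L word_op \<beta> = word_op \<delta>"
  | (right) \<delta> where "\<alpha> = \<beta> @ \<delta>" "adj (word_op \<alpha>) o\<^sub>L word_op \<beta> = adj (word_op \<delta>)"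
  | (incomparable) "\<nexists>\<delta>. \<beta> = \<alpha> @ \<delta>" "\<nexists>\<delta>. \<alpha> = \<beta> @ \<delta>" "adj (word_op \<alpha>) o\<^sub>L word_op \<beta> = 0"
proof -
  have "adj (word_op \<alpha>) o\<^sub>L word_op \<beta> = 0" if "\<nexists>\<delta>. \<beta> = \<alpha> @ \<delta>" "\<nexists>\<delta>. \<alpha> = \<beta> @ \<delta>"
    using that
  proof (induction \<alpha> arbitrary: \<beta>)
    case (Cons j \<alpha> \<beta>')
    then obtain k \<beta> where "\<beta>' = k # \<beta>" by (cases \<beta>') auto
    then show ?case using Cons by (auto simp only: adj_word_op_Cons split: if_splits) auto
  qed simp
  then show ?thesis using that adj_word_op_prefix by blast
qed

inductive_set nc_polynomials :: "'d list op set" where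
  word: "word_op \<alpha> \<in> nc_polynomials"
| add: "p \<in> nc_polynomials \<Longrightarrow> q \<in> nc_polynomials \<Longrightarrow> p + q \<in> nc_polynomials"
| scale: "p \<in> nc_polynomials \<Longrightarrow> cscale_op c p \<in> nc_polynomials"

lemma cscale_op_add: "cscale_op c (S + T) = cscale_op c S + cscale_op c T"
  by (rule blinfun_eqI) (simp add: blinfun_apply_cscale_op blinfun.add_left cscale_add_right)

lemma cscale_op_compose:
  "cscale_op c (S o\<^sub>L T) = cscale_op c S o\<^sub>L T"
  "complex_linear_op S \<Longrightarrow> S o\<^sub>L cscale_op c T = cscale_op c (S o\<^sub>L T)"
  by (auto intro!: blinfun_eqI simp: blinfun_apply_cscale_op complex_linear_opD)

lemma minus_cscale_op: "- T = cscale_op (-1) T"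
  by (rule blinfun_eqI) (simp add: blinfun_apply_cscale_op blinfun.minus_left minus_cscale)

lemma cscale_op_cscale_op [simp]: "cscale_op c (cscale_op d T) = cscale_op (c * d) T"
  by (rule blinfun_eqI) (simp add: blinfun_apply_cscale_op cscale_cscale)

lemma cscale_op_one [simp]: "cscale_op 1 T = T"
  by (rule blinfun_eqI, rule ell2_eqI) (simp add: blinfun_apply_cscale_op)

lemma cscale_op_zero [simp]: "cscale_op 0 T = 0"
  by (rule blinfun_eqI, rule ell2_eqI) (simp add: blinfun_apply_cscale_op)

lemma bounded_linear_cscale_op: "bounded_linear (cscale_op c)"
  unfolding cscale_op_def
  by (rule bounded_bilinear.bounded_linear_right[OF bounded_bilinear_blinfun_compose])

lemma nc_polynomials_linear: "p \<in> nc_polynomials \<Longrightarrow> complex_linear_op p"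
  by (induction rule: nc_polynomials.induct) auto

lemma compose_add_op:
  fixes S T U :: "'a op"
  shows "(S + T) o\<^sub>L U = (S o\<^sub>L U) + (T o\<^sub>L U)"
    and "U o\<^sub>L (S + T) = (U o\<^sub>L S) + (U o\<^sub>L T)"
  by (auto intro!: blinfun_eqI simp: blinfun.add_left blinfun.add_right)

lemma nc_polynomials_compose:
  assumes "p \<in> nc_polynomials" "q \<in> nc_polynomials"
  shows "p o\<^sub>L q \<in> nc_polynomials"
  using assms
proof (induction arbitrary: q)
  case (word \<alpha>)
  show ?case using word
  proof induction
    case (word \<beta>)
    then show ?case by (simp add: word_op_append[symmetric] nc_polynomials.word)
  qed (auto simp: compose_add_op cscale_op_compose(2) intro: nc_polynomials.add nc_polynomials.scale)
next
  case (add p p')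
  then show ?case by (auto simp: compose_add_op intro: nc_polynomials.add)
next
  case (scale p c)
  then show ?case by (auto simp: cscale_op_compose(1)[symmetric] intro: nc_polynomials.scale)
qed

lemma disk_algebra_closed_algebra:
  "closed (disk_algebra :: 'd list op set)" "unital_subalgebra (disk_algebra :: 'd list op set)"
proof -
  let ?P = "\<lambda>S :: 'd list op set. closed S \<and> unital_subalgebra S"
  have "?P disk_algebra"
    unfolding disk_algebra_def
    by (rule hull_in[where S = ?P]) (auto simp: unital_subalgebra_def intro!: closed_Inter)
  then show "closed (disk_algebra :: 'd list op set)"
    "unital_subalgebra (disk_algebra :: 'd list op set)" by blast+
qed

lemma disk_algebra_intros:
  fixes S T :: "'d list op"
  shows "left_shift k \<in> disk_algebra"
    and "id_blinfun \<in> (disk_algebra :: 'd list op set)"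
    and "S \<in> disk_algebra \<Longrightarrow> T \<in> disk_algebra \<Longrightarrow> S + T \<in> disk_algebra"
    and "S \<in> disk_algebra \<Longrightarrow> T \<in> disk_algebra \<Longrightarrow> S o\<^sub>L T \<in> disk_algebra"
    and "T \<in> disk_algebra \<Longrightarrow> cscale_op c T \<in> disk_algebra"
proof -
  have "unital_subalgebra (disk_algebra :: 'd list op set)"
    by (rule disk_algebra_closed_algebra)
  then show "id_blinfun \<in> (disk_algebra :: 'd list op set)"
    and "S \<in> disk_algebra \<Longrightarrow> T \<in> disk_algebra \<Longrightarrow> S + T \<in> disk_algebra"
    and "S \<in> disk_algebra \<Longrightarrow> T \<in> disk_algebra \<Longrightarrow> S o\<^sub>L T \<in> disk_algebra"
    and "T \<in> disk_algebra \<Longrightarrow> cscale_op c T \<in> disk_algebra"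
    by (simp_all add: unital_subalgebra_def)
  show "left_shift k \<in> disk_algebra"
    unfolding disk_algebra_def by (rule hull_inc) simp
qed

lemma word_op_disk_algebra: "word_op \<alpha> \<in> disk_algebra"
  by (induction \<alpha>) (auto intro: disk_algebra_intros)

lemma nc_polynomials_disk_algebra: "p \<in> nc_polynomials \<Longrightarrow> p \<in> disk_algebra"
  by (induction rule: nc_polynomials.induct) (auto intro: disk_algebra_intros word_op_disk_algebra)

lemma disk_algebra_diff: "S \<in> disk_algebra \<Longrightarrow> T \<in> disk_algebra \<Longrightarrow> S - T \<in> disk_algebra"
  using disk_algebra_intros(3)[OF _ disk_algebra_intros(5)[of T "-1"], of S]
  by (simp add: minus_cscale_op[symmetric])

lemma closure_sequence:
  fixes x :: "'a::metric_space"
  assumes "x \<in> closure A"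
  obtains p where "\<And>n. p n \<in> A" "p \<longlonglongrightarrow> x"
  using assms unfolding closure_sequential by blast

lemma closure_sequenceI:
  fixes x :: "'a::metric_space"
  shows "(\<And>n. p n \<in> A) \<Longrightarrow> p \<longlonglongrightarrow> x \<Longrightarrow> x \<in> closure A"
  unfolding closure_sequential by blast

text \<open>The closure of the polynomials is itself a closed unital algebra, since sums and products of
  norm limits are limits of sums and products.\<close>

lemma disk_algebra_subset_closure: "(disk_algebra :: 'd list op set) \<subseteq> closure nc_polynomials"
  unfolding disk_algebra_def
proof (rule hull_minimal)
  let ?P = "closure (nc_polynomials :: 'd list op set)"
  have "left_shift k = word_op [k]" for k by (simp add: blinfun_eqI)
  then have "left_shift k \<in> ?P" for k
    using subsetD[OF closure_subset nc_polynomials.word[of "[k]"]] by metis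
  then show "range left_shift \<subseteq> ?P" by blast
  have "id_blinfun \<in> ?P"
    using subsetD[OF closure_subset nc_polynomials.word[of "[]"]] by simp
  moreover have "cscale_op c T \<in> ?P" if T: "T \<in> ?P" for c T
  proof (rule closure_sequence[OF T])
    fix p assume "\<And>n. p n \<in> (nc_polynomials :: 'd list op set)" "p \<longlonglongrightarrow> T"
    then show ?thesis
      by (intro closure_sequenceI[of "\<lambda>n. cscale_op c (p n)"] nc_polynomials.scale
          bounded_linear.tendsto[OF bounded_linear_cscale_op])
  qed
  moreover have "S + T \<in> ?P \<and> (S o\<^sub>L T) \<in> ?P" if S: "S \<in> ?P" and T: "T \<in> ?P" for S T
  proof (rule closure_sequence[OF S], rule closure_sequence[OF T])
    fix p q assume p: "\<And>n. p n \<in> (nc_polynomials :: 'd list op set)" "p \<longlonglongrightarrow> S"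
      and q: "\<And>n. q n \<in> (nc_polynomials :: 'd list op set)" "q \<longlonglongrightarrow> T"
    have "S + T \<in> ?P"
      by (intro closure_sequenceI[of "\<lambda>n. p n + q n"] tendsto_add nc_polynomials.add p q)
    moreover have "(S o\<^sub>L T) \<in> ?P"
      by (intro closure_sequenceI[of "\<lambda>n. p n o\<^sub>L q n"] nc_polynomials_compose p q
          bounded_bilinear.tendsto[OF bounded_bilinear_blinfun_compose])
    ultimately show ?thesis ..
  qed
  ultimately show "closed ?P \<and> unital_subalgebra ?P"
    unfolding unital_subalgebra_def by simp
qed

lemma disk_algebra_approx:
  assumes "a \<in> disk_algebra"
  obtains p where "\<And>n. p n \<in> nc_polynomials" "p \<longlonglongrightarrow> a"
  using closure_sequence[OF subsetD[OF disk_algebra_subset_closure assms]] by blast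

lemma disk_algebra_linear:
  assumes "a \<in> disk_algebra"
  shows "complex_linear_op a"
proof (rule disk_algebra_approx[OF assms])
  fix p assume "\<And>n. p n \<in> nc_polynomials" "p \<longlonglongrightarrow> a"
  then show ?thesis
    using closed_sequentially[OF closed_complex_linear, of p a] nc_polynomials_linear by auto
qed

lemma disk_system_closed: "closed disk_system"
  by (simp add: disk_system_def)

lemma disk_system_sum: "a \<in> disk_algebra \<Longrightarrow> b \<in> disk_algebra \<Longrightarrow> a + adj b \<in> disk_system"
  unfolding disk_system_def by (rule subsetD[OF closure_subset]) blast

lemma disk_system_sequence:
  assumes "S \<in> disk_system"
  obtains a b where "\<And>n. a n \<in> disk_algebra" "\<And>n. b n \<in> disk_algebra"
    "(\<lambda>n. a n + adj (b n)) \<longlonglongrightarrow> S"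
proof -
  obtain p where p: "\<And>n. p n \<in> {a + adj b | a b. a \<in> disk_algebra \<and> b \<in> disk_algebra}" "p \<longlonglongrightarrow> S"
    using closure_sequence assms[unfolded disk_system_def] by blast
  then have "\<forall>n. \<exists>ab. p n = fst ab + adj (snd ab) \<and> fst ab \<in> disk_algebra \<and> snd ab \<in> disk_algebra"
    by fastforce
  then obtain ab where ab: "\<And>n. p n = fst (ab n) + adj (snd (ab n))"
      "\<And>n. fst (ab n) \<in> disk_algebra" "\<And>n. snd (ab n) \<in> disk_algebra"
    by metis
  show ?thesis
    by (rule that[of "\<lambda>n. fst (ab n)" "\<lambda>n. snd (ab n)"]) (use ab p(2) in \<open>simp_all flip: ab(1)\<close>)
qed

lemma disk_system_add:
  assumes "S \<in> disk_system" "T \<in> disk_system"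
  shows "S + T \<in> disk_system"
proof (rule disk_system_sequence[OF assms(1)], rule disk_system_sequence[OF assms(2)])
  fix a b c d
  assume ab: "\<And>n. a n \<in> disk_algebra" "\<And>n. b n \<in> disk_algebra" "(\<lambda>n. a n + adj (b n)) \<longlonglongrightarrow> S"
    and cd: "\<And>n. c n \<in> disk_algebra" "\<And>n. d n \<in> disk_algebra" "(\<lambda>n. c n + adj (d n)) \<longlonglongrightarrow> T"
  have eq: "(a n + adj (b n)) + (c n + adj (d n)) = (a n + c n) + adj (b n + d n)" for n
    using ab cd by (simp add: adj_add disk_algebra_linear)
  have "(a n + adj (b n)) + (c n + adj (d n)) \<in> disk_system" for n
    unfolding eq by (intro disk_system_sum disk_algebra_intros(3) ab cd)
  then show ?thesis
    by (rule closed_sequentially[OF disk_system_closed _ tendsto_add[OF ab(3) cd(3)]])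
qed

lemma disk_system_cscale:
  assumes "S \<in> disk_system"
  shows "cscale_op c S \<in> disk_system"
proof (rule disk_system_sequence[OF assms])
  fix a b
  assume ab: "\<And>n. a n \<in> disk_algebra" "\<And>n. b n \<in> disk_algebra" "(\<lambda>n. a n + adj (b n)) \<longlonglongrightarrow> S"
  have eq: "cscale_op c (a n + adj (b n)) = cscale_op c (a n) + adj (cscale_op (cnj c) (b n))" for n
    using ab by (simp add: adj_cscale_op disk_algebra_linear cscale_op_add)
  have "cscale_op c (a n + adj (b n)) \<in> disk_system" for n
    unfolding eq by (intro disk_system_sum disk_algebra_intros(5) ab)
  then show ?thesis
    by (rule closed_sequentially[OF disk_system_closed _
          bounded_linear.tendsto[OF bounded_linear_cscale_op ab(3)]])
qed

lemma zero_disk_algebra: "0 \<in> disk_algebra"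
  using disk_algebra_intros(5)[OF disk_algebra_intros(2), of 0] by simp

lemma disk_algebra_disk_system: "a \<in> disk_algebra \<Longrightarrow> a \<in> disk_system"
  using disk_system_sum[OF _ zero_disk_algebra, of a] by simp

lemma adj_disk_system: "a \<in> disk_algebra \<Longrightarrow> adj a \<in> disk_system"
  using disk_system_sum[OF zero_disk_algebra, of a] by simp

lemma zero_disk_system: "0 \<in> disk_system"
  using disk_algebra_disk_system zero_disk_algebra .

text \<open>For two words the product is a word, the adjoint of a word, or zero. The general case follows
  by sesquilinearity for polynomials and then by continuity of the adjoint and of composition.\<close>

lemma adj_compose_disk_system:
  assumes a: "a \<in> disk_algebra" and b: "b \<in> disk_algebra"
  shows "adj a o\<^sub>L b \<in> disk_system"
proof -
  have word: "adj (word_op \<alpha>) o\<^sub>L word_op \<beta> \<in> disk_system" for \<alpha> \<beta> :: "'a list"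
    by (cases rule: adj_word_op_cases[of \<beta> \<alpha>])
      (simp_all only: adj_disk_system disk_algebra_disk_system word_op_disk_algebra zero_disk_system)
  have word_poly: "adj (word_op \<alpha>) o\<^sub>L q \<in> disk_system" if "q \<in> nc_polynomials" for \<alpha> and q :: "'a list op"
    using that by induction (auto simp: word compose_add_op cscale_op_compose(2)
        complex_linear_op_adj disk_system_add disk_system_cscale)
  have poly: "adj p o\<^sub>L q \<in> disk_system" if "p \<in> nc_polynomials" "q \<in> nc_polynomials" for p q :: "'a list op"
    using that by induction (auto simp: word_poly adj_add adj_cscale_op nc_polynomials_linear
        compose_add_op cscale_op_compose(1)[symmetric] disk_system_add disk_system_cscale)
  obtain p where p: "\<And>n. p n \<in> nc_polynomials" "p \<longlonglongrightarrow> a" using disk_algebra_approx[OF a] by blast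
  obtain q where q: "\<And>n. q n \<in> nc_polynomials" "q \<longlonglongrightarrow> b" using disk_algebra_approx[OF b] by blast
  have "(\<lambda>n. adj (p n) o\<^sub>L q n) \<longlonglongrightarrow> (adj a o\<^sub>L b)"
    by (intro bounded_bilinear.tendsto[OF bounded_bilinear_blinfun_compose] tendsto_adj)
      (use p q a in \<open>auto simp: nc_polynomials_linear disk_algebra_linear\<close>)
  then show ?thesis
    by (rule closed_sequentially[OF disk_system_closed _, rotated]) (intro poly p q)
qed

section \<open>Positive functionals on the free disk system\<close>

lemma positive_op_adj_compose: "complex_linear_op a \<Longrightarrow> positive_op (adj a o\<^sub>L a)"
  by (simp add: positive_op_def cinner_adj cinner_self_norm less_eq_complex_def del: of_real_power)

context
  fixes \<mu> :: "'d list op \<Rightarrow> complex"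
  assumes \<mu>: "positive_nc_measure \<mu>"
begin

lemma measure_add: "S \<in> disk_system \<Longrightarrow> T \<in> disk_system \<Longrightarrow> \<mu> (S + T) = \<mu> S + \<mu> T"
  using \<mu> by (simp add: positive_nc_measure_def)

lemma measure_cscale: "T \<in> disk_system \<Longrightarrow> \<mu> (cscale_op c T) = c * \<mu> T"
  using \<mu> by (simp add: positive_nc_measure_def)

lemma measure_nonneg: "T \<in> disk_system \<Longrightarrow> positive_op T \<Longrightarrow> 0 \<le> \<mu> T"
  using \<mu> by (simp add: positive_nc_measure_def)

lemma measure_zero: "\<mu> 0 = 0"
  using measure_cscale[OF zero_disk_system, of 0] by simp

lemma measure_form_nonneg: "a \<in> disk_algebra \<Longrightarrow> 0 \<le> \<mu> (adj a o\<^sub>L a)"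
  by (intro measure_nonneg adj_compose_disk_system positive_op_adj_compose disk_algebra_linear)

lemma measure_id_nonneg: "0 \<le> \<mu> id_blinfun"
proof -
  have "id_blinfun o\<^sub>L id_blinfun = (id_blinfun :: 'd list op)" by (rule blinfun_eqI) simp
  then show ?thesis using measure_form_nonneg[OF disk_algebra_intros(2)] by simp
qed

text \<open>The operator \<open>\<parallel>a\<parallel>\<^sup>2 - a\<^sup>* a\<close> is positive and belongs to the disk system.\<close>

lemma measure_form_le:
  assumes a: "a \<in> disk_algebra"
  shows "\<mu> (adj a o\<^sub>L a) \<le> of_real ((norm a)\<^sup>2) * \<mu> id_blinfun"
proof -
  let ?T = "cscale_op (of_real ((norm a)\<^sup>2)) id_blinfun + cscale_op (-1) (adj a o\<^sub>L a)"
  note lin = disk_algebra_linear[OF a]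
  have DS: "adj a o\<^sub>L a \<in> disk_system" "id_blinfun \<in> (disk_system :: 'd list op set)"
    using a by (auto intro: adj_compose_disk_system disk_algebra_disk_system disk_algebra_intros)
  have "positive_op ?T"
    unfolding positive_op_def
  proof
    fix x
    have "cinner x (blinfun_apply ?T x)
        = of_real ((norm a)\<^sup>2 * (norm x)\<^sup>2 - (norm (blinfun_apply a x))\<^sup>2)"
      by (simp add: blinfun.add_left blinfun_apply_cscale_op cinner_add_right cinner_cscale_right
          cinner_adj[OF lin] cinner_self_norm)
    moreover have "(norm (blinfun_apply a x))\<^sup>2 \<le> (norm a * norm x)\<^sup>2"
      by (intro power_mono norm_blinfun) simp
    ultimately show "0 \<le> cinner x (blinfun_apply ?T x)"
      by (simp add: power_mult_distrib less_eq_complex_def del: of_real_power)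
  qed
  then have "0 \<le> \<mu> ?T"
    by (intro measure_nonneg disk_system_add disk_system_cscale DS)
  then show ?thesis
    by (simp add: measure_add measure_cscale DS disk_system_cscale)
qed

text \<open>A positive functional is hermitian: the self-adjoint operators \<open>2 \<parallel>a\<parallel> + a + a\<^sup>*\<close> and
  \<open>2 \<parallel>a\<parallel> + \<i> a + (\<i> a)\<^sup>*\<close> are positive, so the functional takes real values on them.\<close>

lemma measure_adj:
  assumes a: "a \<in> disk_algebra"
  shows "\<mu> (adj a) = cnj (\<mu> a)"
proof -
  have im: "Im (\<mu> b + \<mu> (adj b)) = 0" if b: "b \<in> disk_algebra" for b
  proof -
    let ?T = "cscale_op (of_real (2 * norm b)) id_blinfun + (b + adj b)"
    note lin = disk_algebra_linear[OF b]
    have DS: "b \<in> disk_system" "adj b \<in> disk_system" "id_blinfun \<in> (disk_system :: 'd list op set)"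
      using b by (auto intro: adj_disk_system disk_algebra_disk_system disk_algebra_intros)
    have "positive_op ?T"
      unfolding positive_op_def
    proof
      fix x
      let ?z = "cinner x (blinfun_apply b x)"
      have "cinner (blinfun_apply b x) x = cnj ?z" by (rule cinner_commute)
      then have eq: "cinner x (blinfun_apply ?T x) = of_real (2 * norm b * (norm x)\<^sup>2 + 2 * Re ?z)"
        by (simp add: blinfun.add_left blinfun_apply_cscale_op cinner_add_right cinner_cscale_right
            cinner_adj[OF lin] cinner_self_norm complex_add_cnj)
      have "cmod ?z \<le> norm x * norm (blinfun_apply b x)" by (rule norm_cinner_le)
      also have "\<dots> \<le> norm x * (norm b * norm x)"
        by (intro mult_left_mono norm_blinfun) simp
      finally have "- Re ?z \<le> norm b * (norm x)\<^sup>2"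
        using abs_Re_le_cmod[of ?z] by (simp add: power2_eq_square algebra_simps)
      then show "0 \<le> cinner x (blinfun_apply ?T x)"
        unfolding eq by (simp add: less_eq_complex_def)
    qed
    then have "0 \<le> \<mu> ?T"
      by (intro measure_nonneg disk_system_add disk_system_cscale DS)
    then show ?thesis
      using measure_id_nonneg
      by (simp add: measure_add measure_cscale DS disk_system_cscale disk_system_add less_eq_complex_def)
  qed
  have "Im (\<mu> (cscale_op \<i> a) + \<mu> (adj (cscale_op \<i> a))) = 0"
    by (intro im disk_algebra_intros a)
  then have "Re (\<mu> a) = Re (\<mu> (adj a))"
    by (simp add: adj_cscale_op disk_algebra_linear a measure_cscale adj_disk_system disk_algebra_disk_system)
  moreover have "Im (\<mu> a + \<mu> (adj a)) = 0" by (rule im[OF a])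
  ultimately show ?thesis by (simp add: complex_eq_iff)
qed

lemma measure_form_add_right:
  assumes "a \<in> disk_algebra" "b \<in> disk_algebra" "c \<in> disk_algebra"
  shows "\<mu> (adj a o\<^sub>L (b + c)) = \<mu> (adj a o\<^sub>L b) + \<mu> (adj a o\<^sub>L c)"
  using assms by (simp add: compose_add_op measure_add adj_compose_disk_system)

lemma measure_form_add_left:
  assumes "a \<in> disk_algebra" "b \<in> disk_algebra" "c \<in> disk_algebra"
  shows "\<mu> (adj (a + b) o\<^sub>L c) = \<mu> (adj a o\<^sub>L c) + \<mu> (adj b o\<^sub>L c)"
  using assms by (simp add: compose_add_op adj_add disk_algebra_linear measure_add adj_compose_disk_system)

lemma measure_form_cscale_right:
  assumes "a \<in> disk_algebra" "b \<in> disk_algebra"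
  shows "\<mu> (adj a o\<^sub>L cscale_op c b) = c * \<mu> (adj a o\<^sub>L b)"
  using assms by (simp add: cscale_op_compose(2) complex_linear_op_adj disk_algebra_linear
      measure_cscale adj_compose_disk_system)

lemma measure_form_cscale_left:
  assumes "a \<in> disk_algebra" "b \<in> disk_algebra"
  shows "\<mu> (adj (cscale_op c a) o\<^sub>L b) = cnj c * \<mu> (adj a o\<^sub>L b)"
  using assms by (simp add: cscale_op_compose(1)[symmetric] adj_cscale_op disk_algebra_linear
      measure_cscale adj_compose_disk_system)

text \<open>A parallelogram estimate, which is enough of a triangle inequality for passing to limits.\<close>

lemma Re_measure_form_add_le:
  assumes a: "a \<in> disk_algebra" and b: "b \<in> disk_algebra"
  shows "Re (\<mu> (adj (a + b) o\<^sub>L (a + b)))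
    \<le> 2 * Re (\<mu> (adj a o\<^sub>L a)) + 2 * Re (\<mu> (adj b o\<^sub>L b))"
proof -
  let ?b = "cscale_op (-1) b"
  note mem = a b disk_algebra_intros(3)[OF a b] disk_algebra_intros(5)[OF b, of "-1"]
  have "0 \<le> Re (\<mu> (adj (a + ?b) o\<^sub>L (a + ?b)))"
    using measure_form_nonneg[OF disk_algebra_intros(3)[OF a mem(4)]]
    by (simp add: less_eq_complex_def)
  also have "\<dots> = 2 * Re (\<mu> (adj a o\<^sub>L a)) + 2 * Re (\<mu> (adj b o\<^sub>L b))
      - Re (\<mu> (adj (a + b) o\<^sub>L (a + b)))"
    using mem by (simp add: measure_form_add_left measure_form_add_right measure_form_cscale_left
        measure_form_cscale_right disk_algebra_intros(3))
  finally show ?thesis by simp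
qed

end

lemma nc_lebesgue_form:
  "a \<in> disk_algebra \<Longrightarrow>
   nc_lebesgue (adj a o\<^sub>L b) = cinner (blinfun_apply a vacuum) (blinfun_apply b vacuum)"
  by (simp add: nc_lebesgue_def cinner_adj disk_algebra_linear)

lemma positive_nc_measure_add_lebesgue:
  assumes "positive_nc_measure \<mu>"
  shows "positive_nc_measure (\<lambda>T. \<mu> T + nc_lebesgue T)"
  using assms unfolding positive_nc_measure_def
  by (auto simp: nc_lebesgue_def blinfun.add_left cinner_add_right blinfun_apply_cscale_op
      cinner_cscale_right algebra_simps positive_op_def intro!: add_nonneg_nonneg)

section \<open>Hilbert space arguments in a reproducing kernel space\<close>

lemma entry_eq_cscalar_prod:
  fixes A :: "complex mat"
  assumes "A \<in> carrier_mat n m" "i < n" "j < m"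
  shows "(A *\<^sub>v unit_vec m j) \<bullet>c unit_vec n i = A $$ (i, j)"
proof -
  have "conjugate (unit_vec n i) = (unit_vec n i :: complex vec)"
    by (rule eq_vecI) (auto simp: unit_vec_def)
  moreover have "A *\<^sub>v unit_vec m j = col A j"
    using assms by (intro eq_vecI) (auto simp: scalar_prod_right_unit)
  ultimately show ?thesis using assms by (simp add: scalar_prod_right_unit)
qed

lemma tendsto_prod_sequentiallyI:
  fixes u :: "nat \<Rightarrow> nat \<Rightarrow> 'a::real_normed_vector"
  assumes "\<And>e. e > 0 \<Longrightarrow> \<exists>N. \<forall>n\<ge>N. \<forall>k\<ge>N. norm (u n k) < e"
  shows "((\<lambda>(n, k). u n k) \<longlongrightarrow> 0) (sequentially \<times>\<^sub>F sequentially)"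
proof (rule tendstoI)
  fix e :: real assume "e > 0"
  then obtain N where "\<forall>n\<ge>N. \<forall>k\<ge>N. norm (u n k) < e" using assms by blast
  then show "\<forall>\<^sub>F x in sequentially \<times>\<^sub>F sequentially. dist (case x of (n, k) \<Rightarrow> u n k) 0 < e"
    unfolding eventually_prod_sequentially by (intro exI[of _ N]) auto
qed

lemma tendsto_prod_sequentiallyD:
  fixes u :: "nat \<Rightarrow> nat \<Rightarrow> 'a::real_normed_vector"
  assumes "((\<lambda>(n, k). u n k) \<longlongrightarrow> 0) (sequentially \<times>\<^sub>F sequentially)" "e > 0"
  obtains N where "\<And>n k. n \<ge> N \<Longrightarrow> k \<ge> N \<Longrightarrow> norm (u n k) < e"
proof -
  have "\<forall>\<^sub>F x in sequentially \<times>\<^sub>F sequentially. dist (case x of (n, k) \<Rightarrow> u n k) 0 < e"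
    using assms by (rule tendstoD)
  then show ?thesis
    unfolding eventually_prod_sequentially using that by auto
qed

context nc_rkhs
begin

lemma carrier: "f \<in> H \<Longrightarrow> Z \<in> nc_ball \<Longrightarrow> f Z \<in> carrier_mat (level Z) (level Z)"
  using nc_function unfolding nc_function_def by blast

lemma diff_mem: "f \<in> H \<Longrightarrow> g \<in> H \<Longrightarrow> nf_diff f g \<in> H"
  by (simp add: nf_diff_def add_mem scale_mem)

lemma ip_add_left: "f \<in> H \<Longrightarrow> g \<in> H \<Longrightarrow> h \<in> H \<Longrightarrow> ip (nf_add f g) h = ip f h + ip g h"
  by (metis add_mem complex_cnj_add ip_add_right ip_commute)

lemma ip_scale_left: "f \<in> H \<Longrightarrow> g \<in> H \<Longrightarrow> ip (nf_scale c f) g = cnj c * ip f g"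
  by (metis scale_mem complex_cnj_mult ip_scale_right ip_commute)

lemma ip_diff_right: "f \<in> H \<Longrightarrow> g \<in> H \<Longrightarrow> h \<in> H \<Longrightarrow> ip f (nf_diff g h) = ip f g - ip f h"
  by (simp add: nf_diff_def ip_add_right ip_scale_right scale_mem)

lemma ip_diff_left: "f \<in> H \<Longrightarrow> g \<in> H \<Longrightarrow> h \<in> H \<Longrightarrow> ip (nf_diff f g) h = ip f h - ip g h"
  by (simp add: nf_diff_def ip_add_left ip_scale_left scale_mem)

lemmas ip_simps = ip_add_left ip_add_right ip_scale_left ip_scale_right ip_diff_left ip_diff_right
  add_mem scale_mem diff_mem

lemma nf_scale_zero: "f \<in> H \<Longrightarrow> nf_scale 0 f = nf_zero"
  unfolding nf_scale_def nf_zero_def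
  by (intro restrict_ext eq_matI) (use carrier_matD[OF carrier[of f]] in simp_all)

lemma ip_zero_right: "f \<in> H \<Longrightarrow> ip f nf_zero = 0"
  using nf_scale_zero[OF zero_mem] ip_scale_right[OF _ zero_mem, of f 0] by simp

lemma ip_zero_left: "f \<in> H \<Longrightarrow> ip nf_zero f = 0"
  using ip_zero_right ip_commute[OF _ zero_mem] by simp

abbreviation nrm where "nrm \<equiv> ip_norm ip"

lemma ip_self: "f \<in> H \<Longrightarrow> ip f f = of_real ((nrm f)\<^sup>2)"
  using ip_nonneg[of f] by (simp add: ip_norm_def less_eq_complex_def complex_eq_iff)

lemma nrm_sq: "f \<in> H \<Longrightarrow> (nrm f)\<^sup>2 = Re (ip f f)"
  by (simp add: ip_self)

lemma nrm_nonneg [simp]: "f \<in> H \<Longrightarrow> 0 \<le> nrm f"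
  using ip_nonneg[of f] by (simp add: ip_norm_def less_eq_complex_def)

lemma nrm_eq_0: "f \<in> H \<Longrightarrow> nrm f = 0 \<Longrightarrow> f = nf_zero"
  using ip_definite ip_self by simp

text \<open>Cauchy-Schwarz, from \<open>ip h h \<ge> 0\<close> for the combination \<open>h = \<parallel>g\<parallel>\<^sup>2 f - \<langle>g, f\<rangle> g\<close>, which is orthogonal
  to \<open>g\<close>.\<close>

lemma norm_ip_le:
  assumes f: "f \<in> H" and g: "g \<in> H"
  shows "cmod (ip f g) \<le> nrm f * nrm g"
proof (cases "nrm g = 0")
  case True
  then have "g = nf_zero" using g nrm_eq_0 by simp
  then show ?thesis using f ip_zero_right True by simp
next
  case False
  let ?G = "(nrm g)\<^sup>2"
  define h where "h = nf_diff (nf_scale (of_real ?G) f) (nf_scale (ip g f) g)"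
  have h: "h \<in> H" using f g by (simp add: h_def ip_simps)
  have "ip h h = of_real (?G * (?G * (nrm f)\<^sup>2 - (cmod (ip f g))\<^sup>2))"
    using f g ip_commute[OF f g] unfolding h_def
    by (simp add: ip_simps ip_self[OF f] ip_self[OF g] algebra_simps power2_eq_square)
      (simp add: complex_norm_square[unfolded power2_eq_square, symmetric] algebra_simps flip: of_real_mult)
  moreover have "0 \<le> Re (ip h h)" using h nrm_sq[OF h] by (metis zero_le_power2)
  ultimately have "0 \<le> ?G * (?G * (nrm f)\<^sup>2 - (cmod (ip f g))\<^sup>2)" by simp
  then have "(cmod (ip f g))\<^sup>2 \<le> (nrm f * nrm g)\<^sup>2"
    using False g by (simp add: zero_le_mult_iff power_mult_distrib mult.commute)
  then show ?thesis by (rule power2_le_imp_le) (use f g in simp)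
qed

lemma nrm_parallelogram:
  assumes "f \<in> H" "g \<in> H"
  shows "(nrm (nf_diff f g))\<^sup>2 + (nrm (nf_add f g))\<^sup>2 = 2 * (nrm f)\<^sup>2 + 2 * (nrm g)\<^sup>2"
  using assms by (simp add: nrm_sq ip_simps)

lemma nrm_diff_commute: "f \<in> H \<Longrightarrow> g \<in> H \<Longrightarrow> nrm (nf_diff f g) = nrm (nf_diff g f)"
  by (simp add: ip_norm_def ip_simps)

lemma tendsto_ip:
  assumes X: "\<And>n. X n \<in> H" and f: "f \<in> H" and g: "g \<in> H"
    and lim: "(\<lambda>n. nrm (nf_diff (X n) f)) \<longlonglongrightarrow> 0"
  shows "(\<lambda>n. ip (X n) g) \<longlonglongrightarrow> ip f g" and "(\<lambda>n. ip g (X n)) \<longlonglongrightarrow> ip g f"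
proof -
  have "(\<lambda>n. nrm (nf_diff (X n) f) * nrm g) \<longlonglongrightarrow> 0"
    using tendsto_mult_right[OF lim, of "nrm g"] by simp
  moreover have "\<forall>\<^sub>F n in sequentially. norm (ip (X n) g - ip f g) \<le> nrm (nf_diff (X n) f) * nrm g"
    using norm_ip_le[OF diff_mem[OF X f] g] X f g by (simp add: ip_simps)
  ultimately have "(\<lambda>n. ip (X n) g - ip f g) \<longlonglongrightarrow> 0"
    by (rule Lim_null_comparison[rotated])
  then show 1: "(\<lambda>n. ip (X n) g) \<longlonglongrightarrow> ip f g" by (simp add: LIM_zero_iff)
  have "(\<lambda>n. cnj (ip (X n) g)) \<longlonglongrightarrow> cnj (ip f g)" by (intro tendsto_intros 1)
  then show "(\<lambda>n. ip g (X n)) \<longlonglongrightarrow> ip g f"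
    using ip_commute[OF f g] ip_commute[OF X g] by simp
qed

lemma tendsto_nrm_sq:
  assumes X: "\<And>n. X n \<in> H" and f: "f \<in> H"
    and lim: "(\<lambda>n. nrm (nf_diff (X n) f)) \<longlonglongrightarrow> 0"
  shows "(\<lambda>n. (nrm (X n))\<^sup>2) \<longlonglongrightarrow> (nrm f)\<^sup>2"
proof -
  have eq: "(nrm (X n))\<^sup>2 = (nrm (nf_diff (X n) f))\<^sup>2 + 2 * Re (ip f (X n)) - (nrm f)\<^sup>2" for n
    using X[of n] f ip_commute[OF f X[of n]] by (simp add: nrm_sq ip_simps)
  have "(\<lambda>n. (nrm (nf_diff (X n) f))\<^sup>2 + 2 * Re (ip f (X n)) - (nrm f)\<^sup>2)
      \<longlonglongrightarrow> 0\<^sup>2 + 2 * Re (ip f f) - (nrm f)\<^sup>2"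
    by (intro tendsto_intros lim tendsto_ip X f)
  then show ?thesis unfolding eq using f by (simp add: nrm_sq)
qed

lemma complete_eps:
  assumes X: "\<And>n. X n \<in> H"
    and cauchy: "\<And>e. e > 0 \<Longrightarrow> \<exists>N. \<forall>n\<ge>N. \<forall>k\<ge>N. (nrm (nf_diff (X n) (X k)))\<^sup>2 < e"
  obtains f where "f \<in> H" "(\<lambda>n. nrm (nf_diff (X n) f)) \<longlonglongrightarrow> 0"
proof -
  have "((\<lambda>(n, k). nrm (nf_diff (X n) (X k))) \<longlongrightarrow> 0) (sequentially \<times>\<^sub>F sequentially)"
  proof (rule tendsto_prod_sequentiallyI)
    fix e :: real assume e: "e > 0"
    then obtain N where "\<forall>n\<ge>N. \<forall>k\<ge>N. (nrm (nf_diff (X n) (X k)))\<^sup>2 < e\<^sup>2"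
      using cauchy[of "e\<^sup>2"] by auto
    then show "\<exists>N. \<forall>n\<ge>N. \<forall>k\<ge>N. norm (nrm (nf_diff (X n) (X k))) < e"
      using e X by (metis abs_of_nonneg real_norm_def diff_mem nrm_nonneg power2_less_imp_less less_imp_le)
  qed
  then show ?thesis using complete[of X] X that by blast
qed

lemma cauchy_if_convergent:
  assumes X: "\<And>n. X n \<in> H" and f: "f \<in> H"
    and lim: "(\<lambda>n. nrm (nf_diff (X n) f)) \<longlonglongrightarrow> 0" and e: "e > 0"
  shows "\<exists>N. \<forall>n\<ge>N. \<forall>k\<ge>N. (nrm (nf_diff (X n) (X k)))\<^sup>2 < e"
proof -
  have le: "(nrm (nf_diff (X n) (X k)))\<^sup>2
      \<le> 2 * (nrm (nf_diff (X n) f))\<^sup>2 + 2 * (nrm (nf_diff (X k) f))\<^sup>2" for n k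
  proof -
    have "(nrm (nf_diff (X n) (X k)))\<^sup>2 = (nrm (nf_diff (nf_diff (X n) f) (nf_diff (X k) f)))\<^sup>2"
      using X[of n] X[of k] f by (simp add: nrm_sq ip_simps)
    also have "\<dots> \<le> 2 * (nrm (nf_diff (X n) f))\<^sup>2 + 2 * (nrm (nf_diff (X k) f))\<^sup>2"
      using nrm_parallelogram[OF diff_mem[OF X f] diff_mem[OF X f], of n k]
        zero_le_power2[of "nrm (nf_add (nf_diff (X n) f) (nf_diff (X k) f))"] by linarith
    finally show ?thesis .
  qed
  have "(\<lambda>n. 4 * (nrm (nf_diff (X n) f))\<^sup>2) \<longlonglongrightarrow> 4 * 0\<^sup>2"
    by (intro tendsto_intros lim)
  then have "\<forall>\<^sub>F n in sequentially. 4 * (nrm (nf_diff (X n) f))\<^sup>2 < e"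
    using order_tendstoD(2)[of _ "4 * 0\<^sup>2" sequentially e] e by simp
  then obtain N where N: "\<And>n. n \<ge> N \<Longrightarrow> 4 * (nrm (nf_diff (X n) f))\<^sup>2 < e"
    unfolding eventually_sequentially by blast
  show ?thesis
  proof (intro exI[of _ N] allI impI)
    fix n k assume "N \<le> n" "N \<le> k"
    then show "(nrm (nf_diff (X n) (X k)))\<^sup>2 < e"
      using le[of n k] N[of n] N[of k] by linarith
  qed
qed

definition is_subspace :: "'d nc_fun set \<Rightarrow> bool" where
  "is_subspace D \<longleftrightarrow> D \<subseteq> H \<and> nf_zero \<in> D \<and> (\<forall>f\<in>D. \<forall>g\<in>D. nf_add f g \<in> D) \<and>
     (\<forall>f\<in>D. \<forall>c. nf_scale c f \<in> D)"

text \<open>The Riesz representation theorem for subspaces: the representing vector is the limit of a sequence minimizing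
  \<open>\<parallel>g\<parallel>\<^sup>2 - 2 Re \<phi>(g)\<close>. Applied to \<open>\<phi>(g) = \<langle>g, f\<rangle>\<close> it yields the
  orthogonal projection of \<open>f\<close> onto the closure of the subspace.\<close>

lemma riesz_subspace:
  assumes D: "is_subspace D"
    and add: "\<And>f g. f \<in> D \<Longrightarrow> g \<in> D \<Longrightarrow> \<phi> (nf_add f g) = \<phi> f + \<phi> g"
    and scale: "\<And>f c. f \<in> D \<Longrightarrow> \<phi> (nf_scale c f) = cnj c * \<phi> f"
    and bound: "\<And>f. f \<in> D \<Longrightarrow> cmod (\<phi> f) \<le> M * nrm f"
  obtains f X where "f \<in> H" "\<And>n. X n \<in> D" "(\<lambda>n. nrm (nf_diff (X n) f)) \<longlonglongrightarrow> 0"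
    "\<And>g. g \<in> D \<Longrightarrow> ip g f = \<phi> g"
proof -
  have DH: "\<And>g. g \<in> D \<Longrightarrow> g \<in> H" using D by (auto simp: is_subspace_def)
  have D_add: "\<And>f g. f \<in> D \<Longrightarrow> g \<in> D \<Longrightarrow> nf_add f g \<in> D"
    and D_scale: "\<And>f c. f \<in> D \<Longrightarrow> nf_scale c f \<in> D" and D0: "nf_zero \<in> D"
    using D by (auto simp: is_subspace_def)
  define Q where "Q g = (nrm g)\<^sup>2 - 2 * Re (\<phi> g)" for g
  define I where "I = Inf (Q ` D)"
  have Q_ge: "- (M\<^sup>2) \<le> Q g" if "g \<in> D" for g
  proof -
    have "Re (\<phi> g) \<le> M * nrm g" using bound[OF that] complex_Re_le_cmod order_trans by blast
    then have "(nrm g - M)\<^sup>2 - M\<^sup>2 \<le> Q g" by (simp add: Q_def power2_diff mult.commute)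
    then show ?thesis using zero_le_power2[of "nrm g - M"] by linarith
  qed
  then have bdd: "bdd_below (Q ` D)" by (auto intro!: bdd_belowI)
  have I_le: "I \<le> Q g" if "g \<in> D" for g
    unfolding I_def using that by (intro cInf_lower bdd) auto
  define r where "r n = 1 / real (Suc n)" for n
  have r_pos: "0 < r n" for n by (simp add: r_def)
  have r_mono: "r n \<le> r N" if "N \<le> n" for n N using that by (simp add: r_def frac_le)
  have "\<exists>g\<in>D. Q g < I + r n" for n
    using cInf_lessD[of "Q ` D" "I + r n"] D0 r_pos[of n] unfolding I_def by auto
  then obtain X where X: "\<And>n. X n \<in> D" "\<And>n. Q (X n) < I + r n" by metis
  note XH = DH[OF X(1)]
  \<comment> \<open>The parallelogram law makes a minimizing sequence Cauchy.\<close>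
  have half: "(nrm (nf_diff f g))\<^sup>2 \<le> 2 * (Q f - I) + 2 * (Q g - I)" if f: "f \<in> D" and g: "g \<in> D" for f g
  proof -
    let ?m = "nf_scale (1/2) (nf_add f g)"
    have "(nrm ?m)\<^sup>2 = (nrm (nf_add f g))\<^sup>2 / 4"
      using f g DH by (simp add: nrm_sq ip_simps) (simp add: field_simps)
    moreover have "Re (\<phi> ?m) = (Re (\<phi> f) + Re (\<phi> g)) / 2"
      using f g D_add by (simp add: scale add)
    ultimately have "4 * Q ?m = (nrm (nf_add f g))\<^sup>2 - 4 * Re (\<phi> f) - 4 * Re (\<phi> g)"
      by (simp add: Q_def)
    moreover have "I \<le> Q ?m" using f g by (intro I_le D_scale D_add)
    ultimately show ?thesis
      using nrm_parallelogram[OF DH[OF f] DH[OF g]] by (simp add: Q_def)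
  qed
  obtain f where f: "f \<in> H" and lim: "(\<lambda>n. nrm (nf_diff (X n) f)) \<longlonglongrightarrow> 0"
  proof (rule complete_eps[OF XH])
    fix e :: real assume "e > 0"
    then obtain N where "r N < e / 4"
      using nat_approx_posE[of "e/4"] unfolding r_def by auto
    then have N: "4 * r N < e" by simp
    show "\<exists>N. \<forall>n\<ge>N. \<forall>k\<ge>N. (nrm (nf_diff (X n) (X k)))\<^sup>2 < e"
    proof (intro exI[of _ N] allI impI)
      fix n k assume nk: "N \<le> n" "N \<le> k"
      have "r n \<le> r N" "r k \<le> r N" using nk r_mono by auto
      then have "4 * (Q (X n) - I) < e" "4 * (Q (X k) - I) < e"
        using X(2)[of n] X(2)[of k] N by (smt (verit))+
      then show "(nrm (nf_diff (X n) (X k)))\<^sup>2 < e"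
        using half[OF X(1) X(1), of n k]
        by linarith
    qed
  qed (rule that)
  have rep: "ip g f = \<phi> g" if g: "g \<in> D" for g
  proof -
    define E where "E n = ip g (X n) - \<phi> g" for n
    define s where "s = 1 / ((nrm g)\<^sup>2 + 1)"
    have s: "0 < s" "s * (nrm g)\<^sup>2 \<le> 1"
      by (simp_all add: s_def add_nonneg_pos divide_simps)
    have E_le: "s * (cmod (E n))\<^sup>2 \<le> r n" for n
    proof -
      \<comment> \<open>Minimality is tested in the direction of steepest descent; \<open>s\<close> is small enough for the quadratic term.\<close>
      define c where "c = - (of_real s * E n)"
      let ?g = "nf_add (X n) (nf_scale c g)"
      have com: "ip (X n) g = cnj (ip g (X n))" using ip_commute DH[OF g] XH by blast
      have "(nrm ?g)\<^sup>2 = Re (ip ?g ?g)" using DH[OF g] XH by (intro nrm_sq add_mem scale_mem)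
      also have "\<dots> = (nrm (X n))\<^sup>2 + 2 * Re (cnj c * ip g (X n)) + (cmod c)\<^sup>2 * (nrm g)\<^sup>2"
        using DH[OF g] XH[of n]
        by (simp add: ip_simps ip_self[OF DH[OF g]] ip_self[OF XH] com)
            (simp add: cmod_power2, simp add: power2_eq_square algebra_simps)
      finally have "Q ?g = Q (X n) + 2 * Re (cnj c * E n) + (cmod c)\<^sup>2 * (nrm g)\<^sup>2"
        using g X(1) D_scale unfolding Q_def by (simp add: add scale E_def algebra_simps)
      moreover have "Re (cnj c * E n) = - s * (cmod (E n))\<^sup>2"
        unfolding c_def cmod_power2 by (simp add: power2_eq_square algebra_simps)
      moreover have "(cmod c)\<^sup>2 = s\<^sup>2 * (cmod (E n))\<^sup>2"
        by (simp add: c_def norm_mult power_mult_distrib)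
      ultimately have "Q ?g = Q (X n) - 2 * s * (cmod (E n))\<^sup>2 + s\<^sup>2 * (cmod (E n))\<^sup>2 * (nrm g)\<^sup>2"
        by simp
      moreover have "I \<le> Q ?g" using g X(1) by (intro I_le D_scale D_add)
      moreover have "s\<^sup>2 * (cmod (E n))\<^sup>2 * (nrm g)\<^sup>2 \<le> s * (cmod (E n))\<^sup>2"
        using mult_left_mono[OF s(2), of "s * (cmod (E n))\<^sup>2"] s(1)
        by (simp add: power2_eq_square algebra_simps)
      ultimately show ?thesis using X(2)[of n] by linarith
    qed
    have "(\<lambda>n. E n) \<longlonglongrightarrow> ip g f - \<phi> g"
      unfolding E_def by (intro tendsto_intros tendsto_ip XH f lim DH g)
    then have "(\<lambda>n. s * (cmod (E n))\<^sup>2) \<longlonglongrightarrow> s * (cmod (ip g f - \<phi> g))\<^sup>2"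
      by (intro tendsto_intros)
    moreover have "r \<longlonglongrightarrow> 0"
      unfolding r_def using LIMSEQ_inverse_real_of_nat by (simp add: inverse_eq_divide)
    ultimately have "s * (cmod (ip g f - \<phi> g))\<^sup>2 \<le> 0"
      by (rule LIMSEQ_le) (use E_le in blast)
    then show ?thesis using s(1) by (simp add: mult_le_0_iff)
  qed
  show ?thesis using that[OF f X(1) lim rep] .
qed

lemma nf_diff_eq_zeroD:
  assumes "f \<in> H" "g \<in> H" "nf_diff f g = nf_zero"
  shows "f = g"
proof (rule extensionalityI)
  show "f \<in> extensional nc_ball" "g \<in> extensional nc_ball"
    using assms nc_function unfolding nc_function_def by blast+
  fix Z :: "'d point" assume Z: "Z \<in> nc_ball"
  have fg: "f Z \<in> carrier_mat (level Z) (level Z)" "g Z \<in> carrier_mat (level Z) (level Z)"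
    using assms carrier Z by auto
  have "f Z + -1 \<cdot>\<^sub>m g Z = 0\<^sub>m (level Z) (level Z)"
    using fun_cong[OF assms(3), of Z] Z
    by (simp add: nf_diff_def nf_add_def nf_scale_def nf_zero_def)
  then have "(f Z + -1 \<cdot>\<^sub>m g Z) $$ (i, j) = 0" if "i < level Z" "j < level Z" for i j
    using that by simp
  then show "f Z = g Z"
    using fg by (intro eq_matI) auto
qed

text \<open>The difference of \<open>f\<close> and its projection onto the closure of the subspace is orthogonal to the
  subspace, hence zero.\<close>

lemma dense_if_orthogonal_trivial:
  assumes D: "is_subspace D"
    and triv: "\<And>f. f \<in> H \<Longrightarrow> (\<And>g. g \<in> D \<Longrightarrow> ip g f = 0) \<Longrightarrow> f = nf_zero"
    and f: "f \<in> H"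
  obtains X where "\<And>n. X n \<in> D" "(\<lambda>n. nrm (nf_diff (X n) f)) \<longlonglongrightarrow> 0"
proof -
  have DH: "\<And>g. g \<in> D \<Longrightarrow> g \<in> H" using D by (auto simp: is_subspace_def)
  obtain f' X where f': "f' \<in> H" "\<And>n. X n \<in> D" "(\<lambda>n. nrm (nf_diff (X n) f')) \<longlonglongrightarrow> 0"
    and eq: "\<And>g. g \<in> D \<Longrightarrow> ip g f' = ip g f"
    using riesz_subspace[OF D, of "\<lambda>g. ip g f" "nrm f"] f DH norm_ip_le
    by (auto simp: ip_simps mult.commute)
  have "nf_diff f' f = nf_zero"
    using f f'(1) DH eq by (intro triv) (simp_all add: ip_simps)
  then have "f' = f" using f f'(1) nf_diff_eq_zeroD by blast
  then show ?thesis using that f' by blast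
qed

lemma eq_zero_if_orthogonal_kernels:
  assumes f: "f \<in> H"
    and orth: "\<And>Z y v. Z \<in> nc_ball \<Longrightarrow> y \<in> carrier_vec (level Z) \<Longrightarrow> v \<in> carrier_vec (level Z) \<Longrightarrow>
      ip (kernel_fun K Z y v) f = 0"
  shows "f = nf_zero"
proof (rule extensionalityI)
  show "f \<in> extensional nc_ball" "nf_zero \<in> extensional nc_ball"
    using f nc_function unfolding nc_function_def nf_zero_def by auto
  fix Z :: "'d point" assume Z: "Z \<in> nc_ball"
  have fZ: "f Z \<in> carrier_mat (level Z) (level Z)" using f carrier Z by auto
  have "f Z $$ (i, j) = 0" if ij: "i < level Z" "j < level Z" for i j
  proof -
    have "(f Z *\<^sub>v unit_vec (level Z) j) \<bullet>c unit_vec (level Z) i = 0"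
      using orth[OF Z] reproducing[OF Z _ _ f] by simp
    then show ?thesis using entry_eq_cscalar_prod[OF fZ ij] by simp
  qed
  then show "f Z = nf_zero Z"
    using fZ Z by (intro eq_matI) (auto simp: nf_zero_def)
qed

end

section \<open>Families of coefficients graded by word length\<close>

definition words :: "nat \<Rightarrow> 'd::finite list set" where
  "words n = {\<alpha>. length \<alpha> = n}"

lemma finite_words [simp]: "finite (words n :: 'd::finite list set)"
  using finite_lists_length_eq[of "UNIV :: 'd set" n] by (simp add: words_def)

lemma sum_words_Suc: "(\<Sum>\<alpha>\<in>words (Suc n). f \<alpha>) = (\<Sum>\<beta>\<in>words n. \<Sum>k\<in>UNIV. f (\<beta> @ [k]))"
proof -
  have "(\<Sum>\<alpha>\<in>words (Suc n). f \<alpha>) = (\<Sum>(\<beta>, k)\<in>words n \<times> UNIV. f (\<beta> @ [k]))"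
    by (rule sum.reindex_bij_witness[where i = "\<lambda>(\<beta>, k). \<beta> @ [k]" and j = "\<lambda>\<alpha>. (butlast \<alpha>, last \<alpha>)"])
      (auto simp: words_def length_Suc_conv_rev)
  then show ?thesis by (simp add: sum.cartesian_product)
qed

text \<open>Square sums over the words of one length are the natural measure of size here: a
  square-summable family has bounded square sums, but so do the coefficients of a Herglotz
  function, which are not square-summable over all words in general; and the words of a point of
  the ball have geometrically decaying ones.\<close>

definition level_sq :: "('d::finite list \<Rightarrow> complex) \<Rightarrow> nat \<Rightarrow> real" where
  "level_sq a n = (\<Sum>\<alpha>\<in>words n. (cmod (a \<alpha>))\<^sup>2)"

definition level_bounded :: "('d::finite list \<Rightarrow> complex) \<Rightarrow> bool" where
  "level_bounded a \<longleftrightarrow> (\<exists>C. \<forall>n. level_sq a n \<le> C)"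

definition geometric :: "('d::finite list \<Rightarrow> complex) \<Rightarrow> bool" where
  "geometric a \<longleftrightarrow> (\<exists>B r. 0 \<le> B \<and> 0 \<le> r \<and> r < 1 \<and> (\<forall>n. level_sq a n \<le> B * r ^ n))"

lemma level_sq_nonneg [simp]: "0 \<le> level_sq a n"
  by (simp add: level_sq_def sum_nonneg)

lemma geometric_level_bounded:
  assumes "geometric a"
  shows "level_bounded a"
proof -
  obtain B r where Br: "0 \<le> B" "0 \<le> r" "r < 1" "\<And>n. level_sq a n \<le> B * r ^ n"
    using assms unfolding geometric_def by blast
  have "level_sq a n \<le> B" for n
  proof -
    have "B * r ^ n \<le> B * 1" using Br by (intro mult_left_mono power_le_one) auto
    then show ?thesis using Br(4)[of n] by simp
  qed
  then show ?thesis unfolding level_bounded_def by blast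
qed

lemma level_sq_add_le: "level_sq (\<lambda>\<alpha>. a \<alpha> + b \<alpha>) n \<le> 2 * level_sq a n + 2 * level_sq b n"
proof -
  have "(cmod (a \<alpha> + b \<alpha>))\<^sup>2 \<le> 2 * (cmod (a \<alpha>))\<^sup>2 + 2 * (cmod (b \<alpha>))\<^sup>2" for \<alpha>
  proof -
    have "(cmod (a \<alpha> + b \<alpha>))\<^sup>2 \<le> (cmod (a \<alpha>) + cmod (b \<alpha>))\<^sup>2"
      by (intro power_mono norm_triangle_ineq) simp
    also have "\<dots> \<le> 2 * (cmod (a \<alpha>))\<^sup>2 + 2 * (cmod (b \<alpha>))\<^sup>2"
      using sum_squares_bound[of "cmod (a \<alpha>)" "cmod (b \<alpha>)"] by (simp add: power2_sum)
    finally show ?thesis .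
  qed
  then have "level_sq (\<lambda>\<alpha>. a \<alpha> + b \<alpha>) n
      \<le> (\<Sum>\<alpha>\<in>words n. 2 * (cmod (a \<alpha>))\<^sup>2 + 2 * (cmod (b \<alpha>))\<^sup>2)"
    unfolding level_sq_def by (intro sum_mono)
  then show ?thesis by (simp add: level_sq_def sum.distrib sum_distrib_left)
qed

lemma geometric_add:
  assumes "geometric a" "geometric b"
  shows "geometric (\<lambda>\<alpha>. a \<alpha> + b \<alpha>)"
proof -
  obtain A r where a: "0 \<le> A" "0 \<le> r" "r < 1" "\<And>n. level_sq a n \<le> A * r ^ n"
    using assms(1) unfolding geometric_def by blast
  obtain B s where b: "0 \<le> B" "0 \<le> s" "s < 1" "\<And>n. level_sq b n \<le> B * s ^ n"
    using assms(2) unfolding geometric_def by blast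
  have "level_sq (\<lambda>\<alpha>. a \<alpha> + b \<alpha>) n \<le> (2 * A + 2 * B) * (max r s) ^ n" for n
  proof -
    have "A * r ^ n \<le> A * max r s ^ n" "B * s ^ n \<le> B * max r s ^ n"
      using a b by (auto intro!: mult_left_mono power_mono)
    then have "level_sq a n \<le> A * max r s ^ n" "level_sq b n \<le> B * max r s ^ n"
      using a(4)[of n] b(4)[of n] by linarith+
    then show ?thesis using level_sq_add_le[of a b n] by (simp add: distrib_right)
  qed
  then show ?thesis
    unfolding geometric_def using a b
    by (intro exI[of _ "2 * A + 2 * B"] exI[of _ "max r s"]) auto
qed

lemma geometric_cmult:
  assumes "geometric a"
  shows "geometric (\<lambda>\<alpha>. c * a \<alpha>)" and "geometric (\<lambda>\<alpha>. a \<alpha> * c)"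
proof -
  obtain A r where a: "0 \<le> A" "0 \<le> r" "r < 1" "\<And>n. level_sq a n \<le> A * r ^ n"
    using assms(1) unfolding geometric_def by blast
  have "level_sq (\<lambda>\<alpha>. c * a \<alpha>) n = (cmod c)\<^sup>2 * level_sq a n" for n
    by (simp add: level_sq_def norm_mult power_mult_distrib sum_distrib_left)
  also have "(cmod c)\<^sup>2 * level_sq a n \<le> ((cmod c)\<^sup>2 * A) * r ^ n" for n
    using a(4)[of n] by (simp add: mult.assoc mult_left_mono)
  finally show "geometric (\<lambda>\<alpha>. c * a \<alpha>)"
    unfolding geometric_def using a
    by (intro exI[of _ "(cmod c)\<^sup>2 * A"] exI[of _ r]) auto
  then show "geometric (\<lambda>\<alpha>. a \<alpha> * c)" by (simp add: mult.commute)
qed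

lemma geometric_cnj: "geometric a \<Longrightarrow> geometric (\<lambda>\<alpha>. cnj (a \<alpha>))"
  by (simp add: geometric_def level_sq_def)

lemma geometric_zero: "geometric (\<lambda>\<alpha>. 0)"
  unfolding geometric_def by (intro exI[of _ 0]) (simp add: level_sq_def)

lemma geometric_sum: "(\<And>i. i \<in> I \<Longrightarrow> geometric (a i)) \<Longrightarrow> geometric (\<lambda>\<alpha>. \<Sum>i\<in>I. a i \<alpha>)"
  by (induction I rule: infinite_finite_induct) (simp_all add: geometric_zero geometric_add)

lemma level_pairing_le:
  "(\<Sum>\<alpha>\<in>words n. cmod (c \<alpha> * a \<alpha>)) \<le> sqrt (level_sq c n) * sqrt (level_sq a n)"
proof -
  have "(\<Sum>\<alpha>\<in>words n. cmod (c \<alpha>) * cmod (a \<alpha>))\<^sup>2 \<le> level_sq c n * level_sq a n"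
    unfolding level_sq_def by (rule Cauchy_Schwarz_ineq_sum)
  then have "(\<Sum>\<alpha>\<in>words n. cmod (c \<alpha>) * cmod (a \<alpha>)) \<le> sqrt (level_sq c n * level_sq a n)"
    by (rule real_le_rsqrt)
  then show ?thesis by (simp add: norm_mult real_sqrt_mult)
qed

text \<open>The basic convergence estimate. By Cauchy-Schwarz on each level, the \<open>n\<close>-th level of the
  pairing is bounded by the \<open>n\<close>-th term of a geometric series, with a constant that is
  linear in the size of the level-bounded family; the latter is what makes the sum of a power
  series at a point a bounded functional of its coefficients.\<close>

lemma pairing_summable:
  assumes "geometric a"
  obtains M where "0 \<le> M"
    "\<And>c C. (\<And>n. level_sq c n \<le> C\<^sup>2) \<Longrightarrow> 0 \<le> C \<Longrightarrow>
       (\<lambda>\<alpha>. cmod (c \<alpha> * a \<alpha>)) summable_on UNIV \<and> cmod (\<Sum>\<^sub>\<infinity>\<alpha>. c \<alpha> * a \<alpha>) \<le> M * C"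
proof -
  obtain B r where Br: "0 \<le> B" "0 \<le> r" "r < 1" "\<And>n. level_sq a n \<le> B * r ^ n"
    using assms unfolding geometric_def by blast
  define M where "M = sqrt B / (1 - sqrt r)"
  have r1: "0 \<le> sqrt r" "sqrt r < 1" using Br by (auto simp: real_sqrt_lt_1_iff)
  have M: "0 \<le> M" using Br r1 by (simp add: M_def)
  show ?thesis
  proof (rule that[OF M])
    fix c :: "'a list \<Rightarrow> complex" and C
    assume c: "\<And>n. level_sq c n \<le> C\<^sup>2" and C: "0 \<le> C"
    have fin: "(\<Sum>\<alpha>\<in>F. cmod (c \<alpha> * a \<alpha>)) \<le> M * C" if F: "finite F" for F
    proof -
      obtain N where N: "\<And>\<alpha>. \<alpha> \<in> F \<Longrightarrow> length \<alpha> < N"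
        using finite_nat_set_iff_bounded[of "length ` F"] finite_imageI[OF F] by blast
      have "(\<Sum>\<alpha>\<in>F. cmod (c \<alpha> * a \<alpha>)) \<le> (\<Sum>\<alpha>\<in>(\<Union>n<N. words n). cmod (c \<alpha> * a \<alpha>))"
      proof (rule sum_mono2)
        show "F \<subseteq> (\<Union>n<N. words n)" using N by (auto simp: words_def)
      qed simp_all
      also have "\<dots> = (\<Sum>n<N. \<Sum>\<alpha>\<in>words n. cmod (c \<alpha> * a \<alpha>))"
        by (rule sum.UNION_disjoint) (simp_all, auto simp: words_def)
      also have "\<dots> \<le> (\<Sum>n<N. C * sqrt B * sqrt r ^ n)"
      proof (rule sum_mono)
        fix n
        have "sqrt (level_sq c n) \<le> C" using c[of n] C by (simp add: real_le_lsqrt)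
        moreover have "sqrt (level_sq a n) \<le> sqrt B * sqrt r ^ n"
          using real_sqrt_le_mono[OF Br(4)[of n]] by (simp add: real_sqrt_mult real_sqrt_power)
        ultimately have "sqrt (level_sq c n) * sqrt (level_sq a n) \<le> C * (sqrt B * sqrt r ^ n)"
          using C by (intro mult_mono) auto
        then show "(\<Sum>\<alpha>\<in>words n. cmod (c \<alpha> * a \<alpha>)) \<le> C * sqrt B * sqrt r ^ n"
          using level_pairing_le[of c a n] by simp
      qed
      also have "\<dots> = C * sqrt B * (\<Sum>n<N. sqrt r ^ n)" by (simp add: sum_distrib_left)
      also have "\<dots> \<le> C * sqrt B * (1 / (1 - sqrt r))"
      proof (rule mult_left_mono)
        have "(\<Sum>n<N. sqrt r ^ n) \<le> (\<Sum>n. sqrt r ^ n)"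
          using r1 by (intro sum_le_suminf summable_geometric) auto
        then show "(\<Sum>n<N. sqrt r ^ n) \<le> 1 / (1 - sqrt r)"
          using r1 by (simp add: suminf_geometric)
      qed (use C Br in simp)
      finally show ?thesis by (simp add: M_def mult.commute)
    qed
    have sm: "(\<lambda>\<alpha>. cmod (c \<alpha> * a \<alpha>)) summable_on UNIV"
      by (rule nonneg_bdd_above_summable_on) (use fin in \<open>auto intro!: bdd_aboveI\<close>)
    moreover have "cmod (\<Sum>\<^sub>\<infinity>\<alpha>. c \<alpha> * a \<alpha>) \<le> M * C"
      using norm_infsum_bound[OF sm] infsum_le_finite_sums[OF sm, of "M * C", OF fin] by simp
    ultimately show "(\<lambda>\<alpha>. cmod (c \<alpha> * a \<alpha>)) summable_on UNIV \<and> cmod (\<Sum>\<^sub>\<infinity>\<alpha>. c \<alpha> * a \<alpha>) \<le> M * C" ..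
  qed
qed

lemma level_bounded_sq:
  assumes "level_bounded c"
  obtains C where "0 \<le> C" "\<And>n. level_sq c n \<le> C\<^sup>2"
proof -
  obtain D where D: "\<And>n. level_sq c n \<le> D" using assms unfolding level_bounded_def by blast
  then have "0 \<le> D" using level_sq_nonneg order_trans by blast
  then show ?thesis using that[of "sqrt D"] D by simp
qed

lemma pairing_abs_summable:
  assumes "level_bounded c" "geometric a"
  shows "(\<lambda>\<alpha>. cmod (c \<alpha> * a \<alpha>)) summable_on UNIV"
proof (rule level_bounded_sq[OF assms(1)], rule pairing_summable[OF assms(2)])
  fix C M
  assume C: "0 \<le> C" "\<And>n. level_sq c n \<le> C\<^sup>2"
    and H: "\<And>c C. (\<And>n. level_sq c n \<le> C\<^sup>2) \<Longrightarrow> 0 \<le> C \<Longrightarrow>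
       (\<lambda>\<alpha>. cmod (c \<alpha> * a \<alpha>)) summable_on UNIV \<and> cmod (\<Sum>\<^sub>\<infinity>\<alpha>. c \<alpha> * a \<alpha>) \<le> M * C"
  show ?thesis by (rule conjunct1[OF H[OF C(2,1)]])
qed

lemma pairing_summable_on:
  assumes "level_bounded c" "geometric a"
  shows "(\<lambda>\<alpha>. c \<alpha> * a \<alpha>) summable_on UNIV"
  by (rule abs_summable_summable[OF pairing_abs_summable[OF assms]])

text \<open>Multiplication of power series: the pairs of words are sorted by their concatenation, and
  a word of length \<open>n\<close> has \<open>n + 1\<close> factorizations.\<close>

lemma infsum_times_words:
  fixes f g :: "'d list \<Rightarrow> complex"
  assumes f: "(\<lambda>\<alpha>. cmod (f \<alpha>)) summable_on UNIV" and g: "(\<lambda>\<alpha>. cmod (g \<alpha>)) summable_on UNIV"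
  shows "((\<lambda>\<gamma>. \<Sum>s\<le>length \<gamma>. f (take s \<gamma>) * g (drop s \<gamma>)) has_sum
    infsum f UNIV * infsum g UNIV) UNIV"
proof -
  have abs: "(\<lambda>p. cmod (f (fst p) * g (snd p))) summable_on (UNIV \<times> UNIV)"
  proof (rule iffD2[OF Infinite_Sum.abs_summable_on_Sigma_iff], intro conjI ballI)
    show "(\<lambda>\<beta>. cmod (f (fst (\<alpha>, \<beta>)) * g (snd (\<alpha>, \<beta>)))) summable_on UNIV" for \<alpha>
      unfolding norm_mult fst_conv snd_conv by (intro summable_on_cmult_right g)
    have "(\<lambda>\<alpha>. cmod (f \<alpha>) * (\<Sum>\<^sub>\<infinity>\<beta>. cmod (g \<beta>))) summable_on UNIV"
      by (intro summable_on_cmult_left f)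
    then show "(\<lambda>\<alpha>. norm (\<Sum>\<^sub>\<infinity>\<beta>. cmod (f (fst (\<alpha>, \<beta>)) * g (snd (\<alpha>, \<beta>))))) summable_on UNIV"
      unfolding norm_mult fst_conv snd_conv infsum_cmult_right' by (simp add: abs_mult infsum_nonneg)
  qed
  let ?h = "\<lambda>p. f (fst p) * g (snd p)"
  let ?k = "\<lambda>q. f (take (snd q) (fst q)) * g (drop (snd q) (fst q))"
  let ?S = "Sigma UNIV (\<lambda>\<gamma> :: 'd list. {..length \<gamma>})"
  have bij: "bij_betw (\<lambda>q. (take (snd q) (fst q), drop (snd q) (fst q))) ?S UNIV"
    by (rule bij_betwI[where g = "\<lambda>p. (fst p @ snd p, length (fst p))"]) auto
  have h: "?h summable_on UNIV" using abs_summable_summable[OF abs] by simp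
  have k: "?k summable_on ?S"
    using summable_on_reindex_bij_betw[OF bij, of ?h] h by simp
  have "infsum f UNIV * infsum g UNIV = (\<Sum>\<^sub>\<infinity>\<alpha>. f \<alpha> * infsum g UNIV)"
    by (rule infsum_cmult_left'[symmetric])
  also have "\<dots> = (\<Sum>\<^sub>\<infinity>\<alpha>. \<Sum>\<^sub>\<infinity>\<beta>. ?h (\<alpha>, \<beta>))"
    unfolding fst_conv snd_conv by (rule infsum_cong, rule infsum_cmult_right'[symmetric])
  also have "\<dots> = infsum ?h (UNIV \<times> UNIV)"
    by (rule infsum_Sigma_banach) (simp add: h)
  also have "\<dots> = infsum ?k ?S"
    using infsum_reindex_bij_betw[OF bij, of ?h] by simp
  also have "\<dots> = (\<Sum>\<^sub>\<infinity>\<gamma>. \<Sum>\<^sub>\<infinity>s\<in>{..length \<gamma>}. ?k (\<gamma>, s))"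
    by (rule infsum_Sigma_banach[symmetric]) (rule k)
  also have "\<dots> = (\<Sum>\<^sub>\<infinity>\<gamma>. \<Sum>s\<le>length \<gamma>. f (take s \<gamma>) * g (drop s \<gamma>))"
    unfolding fst_conv snd_conv by (intro infsum_cong infsum_finite) simp
  finally have eq: "infsum f UNIV * infsum g UNIV = \<dots>" .
  have "(\<lambda>\<gamma>. \<Sum>\<^sub>\<infinity>s\<in>{..length \<gamma>}. ?k (\<gamma>, s)) summable_on UNIV"
    by (rule summable_on_Sigma_banach[of "\<lambda>\<gamma> s. ?k (\<gamma>, s)"]) (use k in \<open>simp add: case_prod_unfold\<close>)
  then have "(\<lambda>\<gamma>. \<Sum>s\<le>length \<gamma>. f (take s \<gamma>) * g (drop s \<gamma>)) summable_on UNIV"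
    by simp
  then show ?thesis unfolding eq by (rule has_sum_infsum)
qed

section \<open>Points of the NC ball\<close>

lemma level_eq:
  fixes Z :: "'d::finite point"
  assumes "\<And>k. Z k \<in> carrier_mat n n"
  shows "level Z = n"
  unfolding level_def
proof (rule the_equality)
  fix m assume "\<forall>k. Z k \<in> carrier_mat m m"
  then have "Z undefined \<in> carrier_mat m m" by blast
  then show "m = n" using assms[of undefined] by auto
qed (use assms in blast)

lemma nc_ballE:
  fixes Z :: "'d::finite point"
  assumes "Z \<in> nc_ball"
  obtains "level Z \<ge> 1" "\<And>k. Z k \<in> carrier_mat (level Z) (level Z)"
    "pos_def (level Z) (1\<^sub>m (level Z) - row_gram (level Z) Z)"
proof -
  obtain n where n: "n \<ge> 1" "\<And>k. Z k \<in> carrier_mat n n" "pos_def n (1\<^sub>m n - row_gram n Z)"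
    using assms unfolding nc_ball_def nc_ball_level_def by auto
  have "level Z = n" by (rule level_eq[OF n(2)])
  then show ?thesis using that n by simp
qed

text \<open>The row vector \<open>u Z\<^sub>k\<close>. Rows are used because appending a letter on the right of a word then acts
  on each row of the matrix of the word separately.\<close>

definition row_action :: "nat \<Rightarrow> 'd point \<Rightarrow> (nat \<Rightarrow> complex) \<Rightarrow> 'd \<Rightarrow> nat \<Rightarrow> complex" where
  "row_action n Z u k l = (\<Sum>i<n. u i * Z k $$ (i, l))"

lemma sum_rotate: "(\<Sum>i\<in>A. \<Sum>j\<in>B. \<Sum>k\<in>C. f i j k) = (\<Sum>k\<in>C. \<Sum>i\<in>A. \<Sum>j\<in>B. f i j k)"
proof -
  have "(\<Sum>i\<in>A. \<Sum>j\<in>B. \<Sum>k\<in>C. f i j k) = (\<Sum>i\<in>A. \<Sum>k\<in>C. \<Sum>j\<in>B. f i j k)"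
    by (intro sum.cong refl sum.swap)
  also have "\<dots> = (\<Sum>k\<in>C. \<Sum>i\<in>A. \<Sum>j\<in>B. f i j k)" by (rule sum.swap)
  finally show ?thesis .
qed

text \<open>The quadratic form of \<open>1 - \<Sum>\<^sub>k Z\<^sub>k Z\<^sub>k\<^sup>*\<close> compares the norm of the row \<open>v\<^sup>*\<close> with the norms of the rows
  \<open>v\<^sup>* Z\<^sub>k\<close>, as \<open>\<langle>v, Z\<^sub>k Z\<^sub>k\<^sup>* v\<rangle> = \<parallel>v\<^sup>* Z\<^sub>k\<parallel>\<^sup>2\<close>.\<close>

lemma gram_form:
  fixes Z :: "'d::finite point"
  assumes Z: "\<And>k. Z k \<in> carrier_mat n n" and v: "v \<in> carrier_vec n"
  shows "((1\<^sub>m n - row_gram n Z) *\<^sub>v v) \<bullet>c v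
    = of_real ((\<Sum>i<n. (cmod (v $ i))\<^sup>2)
        - (\<Sum>k\<in>UNIV. \<Sum>l<n. (cmod (row_action n Z (\<lambda>i. cnj (v $ i)) k l))\<^sup>2))"
proof -
  have adj: "mat_adjoint (Z k) $$ (l, j) = cnj (Z k $$ (j, l))" if "l < n" "j < n" for k l j
    using that Z[of k] carrier_matD[OF Z[of k]] by (simp add: mat_adjoint_def mat_of_rows_def)
  have dim: "dim_col (mat_adjoint (Z k)) = n" "dim_row (mat_adjoint (Z k)) = n" for k
    using carrier_matD[OF Z[of k]] by (simp_all add: mat_adjoint_def)
  have prod: "(Z k * mat_adjoint (Z k)) $$ (i, j) = (\<Sum>l<n. Z k $$ (i, l) * cnj (Z k $$ (j, l)))"
    if "i < n" "j < n" for i j k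
    using that carrier_matD[OF Z[of k]] dim[of k] adj[of _ j k]
    by (simp add: scalar_prod_def atLeast0LessThan)
  have G: "row_gram n Z $$ (i, j) = (\<Sum>k\<in>UNIV. \<Sum>l<n. Z k $$ (i, l) * cnj (Z k $$ (j, l)))"
    if "i < n" "j < n" for i j
    using that by (simp add: row_gram_def prod)
  have "((1\<^sub>m n - row_gram n Z) *\<^sub>v v) \<bullet>c v
      = (\<Sum>i<n. (\<Sum>j<n. ((if i = j then 1 else 0) - row_gram n Z $$ (i, j)) * v $ j) * cnj (v $ i))"
    using v by (simp add: scalar_prod_def row_gram_def atLeast0LessThan)
  also have "\<dots> = (\<Sum>i<n. v $ i * cnj (v $ i)) - (\<Sum>i<n. \<Sum>j<n. row_gram n Z $$ (i, j) * v $ j * cnj (v $ i))"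
    by (simp add: left_diff_distrib sum_subtractf sum_distrib_right if_distrib[of "\<lambda>x. x * _"]
        sum.delta cong: if_cong)
  also have "(\<Sum>i<n. \<Sum>j<n. row_gram n Z $$ (i, j) * v $ j * cnj (v $ i))
      = (\<Sum>i<n. \<Sum>j<n. \<Sum>k\<in>UNIV. \<Sum>l<n. Z k $$ (i, l) * cnj (Z k $$ (j, l)) * v $ j * cnj (v $ i))"
    by (intro sum.cong refl) (simp add: G sum_distrib_right)
  also have "\<dots> = (\<Sum>k\<in>UNIV. \<Sum>l<n. \<Sum>i<n. \<Sum>j<n. Z k $$ (i, l) * cnj (Z k $$ (j, l)) * v $ j * cnj (v $ i))"
    by (rule trans[OF sum_rotate]) (intro sum.cong refl sum_rotate)
  also have "\<dots> = (\<Sum>k\<in>UNIV. \<Sum>l<n. of_real ((cmod (row_action n Z (\<lambda>i. cnj (v $ i)) k l))\<^sup>2))"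
  proof (intro sum.cong refl)
    fix k l
    show "(\<Sum>i<n. \<Sum>j<n. Z k $$ (i, l) * cnj (Z k $$ (j, l)) * v $ j * cnj (v $ i))
        = of_real ((cmod (row_action n Z (\<lambda>i. cnj (v $ i)) k l))\<^sup>2)"
      unfolding complex_norm_square row_action_def cnj_sum sum_product
      by (intro sum.cong refl) (simp add: algebra_simps)
  qed
  finally show ?thesis
    by (simp add: complex_norm_square[symmetric] del: of_real_power)
qed

lemma row_action_less:
  fixes Z :: "'d::finite point"
  assumes Z: "Z \<in> nc_ball" and u: "(\<Sum>i<level Z. (cmod (u i))\<^sup>2) = 1"
  shows "(\<Sum>k\<in>UNIV. \<Sum>l<level Z. (cmod (row_action (level Z) Z u k l))\<^sup>2) < 1"
proof (rule nc_ballE[OF Z])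
  let ?n = "level Z"
  assume Zc: "\<And>k. Z k \<in> carrier_mat ?n ?n" and pd: "pos_def ?n (1\<^sub>m ?n - row_gram ?n Z)"
  let ?v = "Matrix.vec ?n (\<lambda>i. cnj (u i))"
  have v: "?v \<in> carrier_vec ?n" by simp
  have row: "row_action ?n Z (\<lambda>i. cnj (?v $ i)) k l = row_action ?n Z u k l" for k l
    unfolding row_action_def by (intro sum.cong refl) simp
  have one: "(\<Sum>i<?n. (cmod (?v $ i))\<^sup>2) = 1" using u by simp
  have "?v \<noteq> 0\<^sub>v ?n"
  proof
    assume eq: "?v = 0\<^sub>v ?n"
    have "(\<Sum>i<?n. (cmod (?v $ i))\<^sup>2) = 0" unfolding eq by simp
    then show False using one by simp
  qed
  then have "0 < ((1\<^sub>m ?n - row_gram ?n Z) *\<^sub>v ?v) \<bullet>c ?v"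
    using pd v unfolding pos_def_def by blast
  then show ?thesis
    unfolding gram_form[OF Zc v] row one by (simp add: less_complex_def)
qed

text \<open>A strict row contraction of finite size has norm strictly below one, since its row norm is
  attained on the compact unit sphere.\<close>

lemma row_contraction:
  fixes Z :: "'d::finite point"
  assumes Z: "Z \<in> nc_ball"
  obtains r where "0 \<le> r" "r < 1"
    "\<And>u. (\<Sum>k\<in>UNIV. \<Sum>l<level Z. (cmod (row_action (level Z) Z u k l))\<^sup>2)
      \<le> r * (\<Sum>i<level Z. (cmod (u i))\<^sup>2)"
proof -
  let ?n = "level Z"
  define N where "N u = (\<Sum>i<?n. (cmod (u i))\<^sup>2)" for u :: "nat \<Rightarrow> complex"
  define P where "P u = (\<Sum>k\<in>UNIV. \<Sum>l<?n. (cmod (row_action ?n Z u k l))\<^sup>2)" for u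
  let ?Q = "PiE UNIV (\<lambda>i. if i < ?n then cball 0 1 else {0}) :: (nat \<Rightarrow> complex) set"
  define S where "S = ?Q \<inter> {u. N u = 1}"
  have n: "?n \<ge> 1" using nc_ballE[OF Z] by blast
  have coord: "continuous_on A (\<lambda>u. u i)" for A :: "(nat \<Rightarrow> complex) set" and i
    by (rule continuous_on_subset[OF continuous_on_product_coordinates]) simp
  have contN: "continuous_on A N" for A
    unfolding N_def by (intro continuous_intros coord)
  have contP: "continuous_on A P" for A
    unfolding P_def row_action_def by (intro continuous_intros coord)
  have "compactin (product_topology (\<lambda>i. euclidean) UNIV) ?Q"
    unfolding compactin_PiE by (simp add: compactin_euclidean_iff)
  then have "compact ?Q"
    by (simp add: euclidean_product_topology compactin_euclidean_iff)
  moreover have "closed {u. N u = 1}"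
    by (intro closed_Collect_eq contN continuous_intros)
  ultimately have comp: "compact S" unfolding S_def by (rule compact_Int_closed)
  have N1: "N (\<lambda>i. if i = 0 then 1 else 0) = 1"
    using n by (simp add: N_def if_distrib[of cmod] if_distrib[of "\<lambda>x. x\<^sup>2"] sum.delta cong: if_cong)
  have "(\<lambda>i. if i = 0 then 1 else 0) \<in> S"
    using n N1 unfolding S_def by (auto simp: PiE_def)
  then have ne: "S \<noteq> {}" by blast
  obtain u0 where u0: "u0 \<in> S" "\<And>u. u \<in> S \<Longrightarrow> P u \<le> P u0"
    using continuous_attains_sup[OF comp ne contP] by blast
  define r where "r = P u0"
  have r0: "0 \<le> r" by (simp add: r_def P_def sum_nonneg)
  have r1: "r < 1"
    using u0(1) row_action_less[OF Z, of u0] by (simp add: r_def P_def S_def N_def)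
  have "P u \<le> r * N u" for u
  proof (cases "N u = 0")
    case True
    then have "u i = 0" if "i < ?n" for i
      using that unfolding N_def by (simp add: sum_nonneg_eq_0_iff)
    then have "P u = 0" by (simp add: P_def row_action_def)
    then show ?thesis using True by simp
  next
    case False
    have N0: "0 < N u" using False by (simp add: N_def sum_nonneg less_le)
    \<comment> \<open>Rescale to the unit sphere.\<close>
    define t where "t = complex_of_real (1 / sqrt (N u))"
    have t2: "(cmod t)\<^sup>2 = 1 / N u" using N0 by (simp add: t_def norm_divide power_divide)
    let ?u = "\<lambda>i. if i < ?n then t * u i else 0"
    have Nu: "N ?u = 1"
      using N0 by (simp add: N_def norm_mult power_mult_distrib t2 sum_divide_distrib[symmetric])
    have "row_action ?n Z ?u k l = t * row_action ?n Z u k l" for k l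
      unfolding row_action_def sum_distrib_left by (intro sum.cong refl) simp
    then have Pu: "P ?u = P u / N u"
      by (simp add: P_def norm_mult power_mult_distrib t2 sum_divide_distrib[symmetric])
    have "(cmod (?u i))\<^sup>2 \<le> N ?u" if "i < ?n" for i
      unfolding N_def by (rule member_le_sum) (use that in auto)
    then have "cmod (?u i) \<le> 1" if "i < ?n" for i
      using that power2_le_imp_le[of "cmod (?u i)" 1] unfolding Nu by simp
    then have "?u \<in> S" using Nu unfolding S_def by (auto simp: PiE_def)
    then have "P ?u \<le> r" using u0(2) by (simp add: r_def)
    then show ?thesis using N0 by (simp add: Pu divide_le_eq)
  qed
  then show ?thesis using that[OF r0 r1] by (simp add: P_def N_def)
qed

lemma word_mat_simps [simp]:
  "word_mat Z [] = 1\<^sub>m (level Z)" "word_mat Z (k # \<alpha>) = Z k * word_mat Z \<alpha>"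
  by (simp_all add: word_mat_def)

lemma word_mat_carrier:
  assumes "\<And>k. Z k \<in> carrier_mat (level Z) (level Z)"
  shows "word_mat Z \<alpha> \<in> carrier_mat (level Z) (level Z)"
  by (induction \<alpha>) (auto intro: mult_carrier_mat assms)

lemma word_mat_append:
  assumes "\<And>k. Z k \<in> carrier_mat (level Z) (level Z)"
  shows "word_mat Z (\<alpha> @ \<beta>) = word_mat Z \<alpha> * word_mat Z \<beta>"
proof (induction \<alpha>)
  case Nil
  show ?case using word_mat_carrier[of Z \<beta>] assms by simp
next
  case (Cons k \<alpha>)
  then show ?case
    using assoc_mult_mat[OF assms[of k] word_mat_carrier word_mat_carrier, of \<alpha> \<beta>] assms by simp
qed

abbreviation word_entry :: "'d point \<Rightarrow> nat \<Rightarrow> nat \<Rightarrow> 'd list \<Rightarrow> complex" where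
  "word_entry Z i j \<alpha> \<equiv> word_mat Z \<alpha> $$ (i, j)"

lemma mult_entry:
  assumes "A \<in> carrier_mat n m" "B \<in> carrier_mat m p" "i < n" "j < p"
  shows "(A * B) $$ (i, j) = (\<Sum>k<m. A $$ (i, k) * B $$ (k, j))"
  using assms by (simp add: scalar_prod_def atLeast0LessThan)

lemma word_entry_append:
  assumes "\<And>k. Z k \<in> carrier_mat (level Z) (level Z)" "i < level Z" "j < level Z"
  shows "word_entry Z i j (\<alpha> @ \<beta>) = (\<Sum>l<level Z. word_entry Z i l \<alpha> * word_entry Z l j \<beta>)"
  unfolding word_mat_append[OF assms(1)]
  by (rule mult_entry[OF word_mat_carrier[OF assms(1)] word_mat_carrier[OF assms(1)] assms(2,3)])

text \<open>With \<open>r\<close> from the contraction property, the sum of the squared norms of the \<open>i\<close>-th rows of all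
  words of length \<open>n\<close> is at most \<open>r\<^sup>n\<close>, by induction on the last letter.\<close>

lemma word_entry_geometric:
  fixes Z :: "'d::finite point"
  assumes Z: "Z \<in> nc_ball" and ij: "i < level Z" "j < level Z"
  shows "geometric (word_entry Z i j)"
proof -
  obtain r where r: "0 \<le> r" "r < 1"
    "\<And>u. (\<Sum>k\<in>UNIV. \<Sum>l<level Z. (cmod (row_action (level Z) Z u k l))\<^sup>2)
      \<le> r * (\<Sum>i<level Z. (cmod (u i))\<^sup>2)"
    using row_contraction[OF Z] by blast
  have Zc: "\<And>k. Z k \<in> carrier_mat (level Z) (level Z)" using nc_ballE[OF Z] by blast
  have one: "word_mat Z [k] = Z k" for k using right_mult_one_mat[OF Zc] by simp
  have row: "(\<Sum>\<alpha>\<in>words n. \<Sum>l<level Z. (cmod (word_entry Z i l \<alpha>))\<^sup>2) \<le> r ^ n" for n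
  proof (induction n)
    case 0
    have "words 0 = {[] :: 'd list}" by (auto simp: words_def)
    then show ?case using ij
      by (simp add: if_distrib[of cmod] if_distrib[of "\<lambda>x. x\<^sup>2"] sum.delta cong: if_cong)
  next
    case (Suc n)
    have "(\<Sum>\<alpha>\<in>words (Suc n). \<Sum>l<level Z. (cmod (word_entry Z i l \<alpha>))\<^sup>2)
        = (\<Sum>\<alpha>\<in>words n. \<Sum>k\<in>UNIV. \<Sum>l<level Z. (cmod (row_action (level Z) Z (\<lambda>p. word_entry Z i p \<alpha>) k l))\<^sup>2)"
      unfolding sum_words_Suc row_action_def
      by (intro sum.cong refl) (simp add: word_entry_append[OF Zc ij(1)] one del: word_mat_simps)
    also have "\<dots> \<le> (\<Sum>\<alpha>\<in>words n. r * (\<Sum>l<level Z. (cmod (word_entry Z i l \<alpha>))\<^sup>2))"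
      by (intro sum_mono r(3))
    also have "\<dots> \<le> r * r ^ n"
      using Suc r(1) by (simp add: sum_distrib_left[symmetric] mult_left_mono)
    finally show ?case by simp
  qed
  have "level_sq (word_entry Z i j) n \<le> 1 * r ^ n" for n
  proof -
    have "level_sq (word_entry Z i j) n \<le> (\<Sum>\<alpha>\<in>words n. \<Sum>l<level Z. (cmod (word_entry Z i l \<alpha>))\<^sup>2)"
      unfolding level_sq_def by (intro sum_mono member_le_sum) (use ij in auto)
    then show ?thesis using row[of n] by simp
  qed
  then show ?thesis unfolding geometric_def using r by (intro exI[of _ 1] exI[of _ r]) auto
qed

section \<open>Power series on the NC ball\<close>

lemma has_sum_finite_sum:
  fixes f :: "'i \<Rightarrow> 'a \<Rightarrow> complex"
  assumes "\<And>i. i \<in> I \<Longrightarrow> (f i has_sum s i) A"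
  shows "((\<lambda>x. \<Sum>i\<in>I. f i x) has_sum (\<Sum>i\<in>I. s i)) A"
  using assms by (induction I rule: infinite_finite_induct) (simp_all add: has_sum_add)

lemma power_series_carrier [simp]: "power_series c Z \<in> carrier_mat (level Z) (level Z)"
  by (simp add: power_series_def)

lemma power_series_has_sum:
  assumes "Z \<in> nc_ball" "level_bounded c" "i < level Z" "j < level Z"
  shows "((\<lambda>\<alpha>. c \<alpha> * word_entry Z i j \<alpha>) has_sum power_series c Z $$ (i, j)) UNIV"
  using assms by (simp add: power_series_def pairing_summable_on word_entry_geometric)

lemma power_series_entryI:
  "i < level Z \<Longrightarrow> j < level Z \<Longrightarrow> ((\<lambda>\<alpha>. c \<alpha> * word_entry Z i j \<alpha>) has_sum s) UNIV \<Longrightarrow>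
   power_series c Z $$ (i, j) = s"
  by (simp add: power_series_def infsumI)

lemma power_series_linear:
  assumes Z: "Z \<in> nc_ball" and c: "level_bounded c" and d: "level_bounded d"
  shows "power_series (\<lambda>\<alpha>. c \<alpha> + d \<alpha>) Z = power_series c Z + power_series d Z"
    and "power_series (\<lambda>\<alpha>. s * c \<alpha>) Z = s \<cdot>\<^sub>m power_series c Z"
proof -
  show "power_series (\<lambda>\<alpha>. c \<alpha> + d \<alpha>) Z = power_series c Z + power_series d Z"
  proof (rule eq_matI)
    fix i j assume "i < dim_row (power_series c Z + power_series d Z)"
      "j < dim_col (power_series c Z + power_series d Z)"
    then have ij: "i < level Z" "j < level Z" by (simp_all add: power_series_def)
    have "((\<lambda>\<alpha>. (c \<alpha> + d \<alpha>) * word_entry Z i j \<alpha>) has_sum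
        power_series c Z $$ (i, j) + power_series d Z $$ (i, j)) UNIV"
      unfolding distrib_right using ij by (intro has_sum_add power_series_has_sum Z c d)
    then show "power_series (\<lambda>\<alpha>. c \<alpha> + d \<alpha>) Z $$ (i, j) = (power_series c Z + power_series d Z) $$ (i, j)"
      using ij carrier_matD[OF power_series_carrier[of d Z]]
      by (simp add: power_series_entryI[OF ij])
  qed (simp_all add: power_series_def)
  show "power_series (\<lambda>\<alpha>. s * c \<alpha>) Z = s \<cdot>\<^sub>m power_series c Z"
  proof (rule eq_matI)
    fix i j assume "i < dim_row (s \<cdot>\<^sub>m power_series c Z)" "j < dim_col (s \<cdot>\<^sub>m power_series c Z)"
    then show "power_series (\<lambda>\<alpha>. s * c \<alpha>) Z $$ (i, j) = (s \<cdot>\<^sub>m power_series c Z) $$ (i, j)"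
      by (simp add: power_series_def mult.assoc infsum_cmult_right')
  qed (simp_all add: power_series_def)
qed

section \<open>Nilpotent points and coefficient extraction\<close>

text \<open>A weighted shift along the letters of \<open>\<alpha>\<close>: the upper right corner of \<open>Z\<^sup>\<beta>\<close> vanishes
  unless \<open>\<beta> = \<alpha>\<close>, so values at this point recover the coefficient at \<open>\<alpha>\<close>. The weight \<open>1/2\<close> only
  serves to make it a strict row contraction.\<close>

definition nil_point :: "'d list \<Rightarrow> 'd point" where
  "nil_point \<alpha> = (\<lambda>k. Matrix.mat (Suc (length \<alpha>)) (Suc (length \<alpha>))
     (\<lambda>(i, j). if j = Suc i \<and> i < length \<alpha> \<and> \<alpha> ! i = k then 1/2 else 0))"

lemma nil_point_carrier: "nil_point \<alpha> k \<in> carrier_mat (Suc (length \<alpha>)) (Suc (length \<alpha>))"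
  by (simp add: nil_point_def)

lemma level_nil_point [simp]: "level (nil_point \<alpha> :: 'd::finite point) = Suc (length \<alpha>)"
  by (rule level_eq) (rule nil_point_carrier)

lemma nil_point_in_ball: "nil_point (\<alpha> :: 'd::finite list) \<in> nc_ball"
proof -
  let ?n = "Suc (length \<alpha>)"
  have "pos_def ?n (1\<^sub>m ?n - row_gram ?n (nil_point \<alpha>))"
    unfolding pos_def_def
  proof (intro ballI impI)
    fix v :: "complex vec" assume v: "v \<in> carrier_vec ?n" and v0: "v \<noteq> 0\<^sub>v ?n"
    let ?u = "\<lambda>i. cnj (v $ i)"
    have act: "row_action ?n (nil_point \<alpha>) ?u k l
        = (if 0 < l \<and> \<alpha> ! (l - 1) = k then ?u (l - 1) / 2 else 0)" if "l < ?n" for k l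
    proof -
      have "row_action ?n (nil_point \<alpha>) ?u k l
          = (\<Sum>i<?n. if i = l - 1 then (if 0 < l \<and> \<alpha> ! (l - 1) = k then ?u (l - 1) / 2 else 0) else 0)"
        unfolding row_action_def using that by (intro sum.cong refl) (auto simp: nil_point_def)
      then show ?thesis using that by (simp add: sum.delta del: sum.lessThan_Suc) auto
    qed
    have "(\<Sum>k\<in>UNIV. \<Sum>l<?n. (cmod (row_action ?n (nil_point \<alpha>) ?u k l))\<^sup>2)
        = (\<Sum>k\<in>UNIV. \<Sum>l<?n. if \<alpha> ! (l - 1) = k then (if 0 < l then (cmod (v $ (l - 1)))\<^sup>2 / 4 else 0) else 0)"
      by (intro sum.cong refl) (simp add: act norm_divide power_divide)
    also have "\<dots> = (\<Sum>l<?n. if 0 < l then (cmod (v $ (l - 1)))\<^sup>2 / 4 else 0)"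
      by (subst sum.swap) (simp add: sum.delta del: sum.lessThan_Suc)
    also have "\<dots> = (\<Sum>l<length \<alpha>. (cmod (v $ l))\<^sup>2 / 4)"
      by (subst sum.lessThan_Suc_shift) simp
    also have "\<dots> \<le> (\<Sum>l<?n. (cmod (v $ l))\<^sup>2 / 4)"
      by (rule sum_mono2) auto
    finally have le: "(\<Sum>k\<in>UNIV. \<Sum>l<?n. (cmod (row_action ?n (nil_point \<alpha>) ?u k l))\<^sup>2)
        \<le> (\<Sum>l<?n. (cmod (v $ l))\<^sup>2) / 4"
      by (simp add: sum_divide_distrib del: sum.lessThan_Suc)
    obtain i where i: "i < ?n" "v $ i \<noteq> 0"
      using v v0 by (metis carrier_vecD eq_vecI index_zero_vec)
    have "(cmod (v $ i))\<^sup>2 \<le> (\<Sum>l<?n. (cmod (v $ l))\<^sup>2)"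
      by (rule member_le_sum) (use i in auto)
    moreover have "0 < (cmod (v $ i))\<^sup>2" using i by simp
    ultimately have "0 < (\<Sum>l<?n. (cmod (v $ l))\<^sup>2)" by linarith
    then show "0 < ((1\<^sub>m ?n - row_gram ?n (nil_point \<alpha>)) *\<^sub>v v) \<bullet>c v"
      unfolding gram_form[OF nil_point_carrier v] using le by (simp add: less_complex_def del: sum.lessThan_Suc)
  qed
  then show ?thesis
    unfolding nc_ball_def nc_ball_level_def using nil_point_carrier[of \<alpha>]
    by (intro UN_I[of ?n]) auto
qed

lemma nil_point_entry:
  fixes \<alpha> :: "'d::finite list"
  assumes "i \<le> length \<alpha>" "j \<le> length \<alpha>"
  shows "word_entry (nil_point \<alpha>) i j \<beta>
    = (if j = i + length \<beta> \<and> take (length \<beta>) (drop i \<alpha>) = \<beta> then (1/2) ^ length \<beta> else 0)"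
  using assms
proof (induction \<beta> arbitrary: i)
  case Nil
  then show ?case by auto
next
  case (Cons k \<beta>)
  let ?n = "Suc (length \<alpha>)"
  have c: "\<And>k. nil_point \<alpha> k \<in> carrier_mat (level (nil_point \<alpha>)) (level (nil_point \<alpha>))"
    by (simp add: nil_point_carrier)
  have "word_entry (nil_point \<alpha>) i j (k # \<beta>)
      = (\<Sum>l<?n. nil_point \<alpha> k $$ (i, l) * word_entry (nil_point \<alpha>) l j \<beta>)"
    unfolding word_mat_simps
    by (rule mult_entry[OF nil_point_carrier]) (use word_mat_carrier[OF c, of \<beta>] Cons.prems in auto)
  also have "\<dots> = (\<Sum>l<?n. if l = Suc i then (if i < length \<alpha> \<and> \<alpha> ! i = k
      then word_entry (nil_point \<alpha>) (Suc i) j \<beta> / 2 else 0) else 0)"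
    using Cons.prems by (intro sum.cong refl) (auto simp: nil_point_def)
  also have "\<dots> = (if i < length \<alpha> \<and> \<alpha> ! i = k then word_entry (nil_point \<alpha>) (Suc i) j \<beta> / 2 else 0)"
    by (simp add: sum.delta)
  finally have step: "word_entry (nil_point \<alpha>) i j (k # \<beta>) = \<dots>" .
  show ?case
  proof (cases "i < length \<alpha>")
    case True
    then have "drop i \<alpha> = \<alpha> ! i # drop (Suc i) \<alpha>" by (simp add: Cons_nth_drop_Suc)
    then show ?thesis unfolding step using True Cons.IH[of "Suc i"] Cons.prems by auto
  next
    case False
    then show ?thesis unfolding step using Cons.prems by auto
  qed
qed

lemma nil_point_corner:
  fixes \<alpha> :: "'d::finite list"
  shows "word_entry (nil_point \<alpha>) 0 (length \<alpha>) \<beta> = (if \<beta> = \<alpha> then (1/2) ^ length \<alpha> else 0)"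
  by (auto simp: nil_point_entry)

definition word_coeff :: "'d::finite nc_fun \<Rightarrow> 'd list \<Rightarrow> complex" where
  "word_coeff f \<alpha> = 2 ^ length \<alpha> * f (nil_point \<alpha>) $$ (0, length \<alpha>)"

lemma power_series_nil_point:
  fixes \<alpha> :: "'d::finite list"
  shows "power_series c (nil_point \<alpha>) $$ (0, length \<alpha>) = c \<alpha> * (1/2) ^ length \<alpha>"
  by (rule power_series_entryI) (auto intro!: has_sum_finite_neutralI[where B = "{\<alpha>}"] simp: nil_point_corner split: if_splits)

lemma word_coeff_power_series: "word_coeff (restrict (power_series c) nc_ball) = c"
  by (rule ext) (simp add: word_coeff_def nil_point_in_ball power_series_nil_point power_one_over)

section \<open>The Herglotz kernel functions as power series\<close>

text \<open>The Taylor coefficients of the Herglotz function; the constant term is not doubled.\<close>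

definition herglotz_coeff :: "('d list op \<Rightarrow> complex) \<Rightarrow> 'd list \<Rightarrow> complex" where
  "herglotz_coeff \<nu> \<alpha> = (if \<alpha> = [] then \<nu> id_blinfun else 2 * cnj (\<nu> (word_op \<alpha>)))"

lemma herglotz_fun_carrier [simp]: "herglotz_fun \<nu> Z \<in> carrier_mat (level Z) (level Z)"
  by (simp add: herglotz_fun_def)

lemma herglotz_fun_power_series:
  fixes Z :: "'d::finite point"
  assumes Z: "Z \<in> nc_ball" and lb: "level_bounded (herglotz_coeff \<nu>)"
  shows "herglotz_fun \<nu> Z = power_series (herglotz_coeff \<nu>) Z"
proof (rule eq_matI)
  let ?g = "\<lambda>\<alpha>. if \<alpha> = [] then 0 else cnj (\<nu> (word_op \<alpha>))"
  let ?e = "\<lambda>\<alpha> :: 'd list. if \<alpha> = [] then \<nu> id_blinfun else 0"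
  have "level_sq ?g n \<le> level_sq (herglotz_coeff \<nu>) n" for n
    unfolding level_sq_def
    by (intro sum_mono power_mono) (auto simp: herglotz_coeff_def norm_mult)
  then have g: "level_bounded ?g"
    using lb unfolding level_bounded_def by (meson order_trans)
  fix i j assume "i < dim_row (power_series (herglotz_coeff \<nu>) Z)"
    "j < dim_col (power_series (herglotz_coeff \<nu>) Z)"
  then have ij: "i < level Z" "j < level Z" by (simp_all add: power_series_def)
  have "((\<lambda>\<alpha>. ?e \<alpha> * word_entry Z i j \<alpha>) has_sum \<nu> id_blinfun * (1\<^sub>m (level Z) $$ (i, j))) UNIV"
    by (rule has_sum_finite_neutralI[where B = "{[]}"]) auto
  moreover have "((\<lambda>\<alpha>. 2 * (?g \<alpha> * word_entry Z i j \<alpha>)) has_sum 2 * power_series ?g Z $$ (i, j)) UNIV"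
    by (intro has_sum_cmult_right power_series_has_sum Z g ij)
  ultimately have "((\<lambda>\<alpha>. ?e \<alpha> * word_entry Z i j \<alpha> + 2 * (?g \<alpha> * word_entry Z i j \<alpha>)) has_sum
      \<nu> id_blinfun * (1\<^sub>m (level Z) $$ (i, j)) + 2 * power_series ?g Z $$ (i, j)) UNIV"
    by (rule has_sum_add)
  also have "(\<lambda>\<alpha>. ?e \<alpha> * word_entry Z i j \<alpha> + 2 * (?g \<alpha> * word_entry Z i j \<alpha>))
      = (\<lambda>\<alpha>. herglotz_coeff \<nu> \<alpha> * word_entry Z i j \<alpha>)"
    by (auto simp: herglotz_coeff_def)
  finally show "herglotz_fun \<nu> Z $$ (i, j) = power_series (herglotz_coeff \<nu>) Z $$ (i, j)"
    using ij carrier_matD[OF power_series_carrier[of ?g Z]]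
    by (simp add: herglotz_fun_def power_series_entryI[OF ij])
qed (simp_all add: power_series_def herglotz_fun_def)

text \<open>The number \<open>(W\<^sup>\<alpha> x)\<^sup>* y\<close>, which arises when the Szego kernel is applied to a matrix with right factor
  \<open>x\<^sup>*\<close> and then to the vector \<open>y\<close>.\<close>

definition pairing :: "'d point \<Rightarrow> complex vec \<Rightarrow> complex vec \<Rightarrow> 'd list \<Rightarrow> complex" where
  "pairing W y x \<alpha> = (\<Sum>j<level W. \<Sum>l<level W. cnj (word_entry W j l \<alpha> * x $ l) * y $ j)"

lemma pairing_geometric:
  fixes W :: "'d::finite point"
  shows "W \<in> nc_ball \<Longrightarrow> geometric (pairing W y x)"
  unfolding pairing_def
  by (intro geometric_sum geometric_cmult geometric_cnj word_entry_geometric) auto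

lemma mat_adjoint_entry:
  fixes A :: "complex mat"
  assumes "A \<in> carrier_mat n m" "i < m" "j < n"
  shows "mat_adjoint A $$ (i, j) = cnj (A $$ (j, i))"
  using assms by (simp add: mat_adjoint_def mat_of_rows_def)

lemma mat_adjoint_carrier:
  fixes A :: "complex mat"
  shows "A \<in> carrier_mat n m \<Longrightarrow> mat_adjoint A \<in> carrier_mat m n"
  by (auto simp: mat_adjoint_def)

text \<open>The Szego kernel, applied to a matrix of rank at most two and evaluated on a vector: the
  sum over words of the matrix products is regrouped entry by entry, which is justified since
  each entry is a product of two square-summable families.\<close>

lemma szego_kernel_rank_two:
  fixes Z W :: "'d::finite point"
  assumes Z: "Z \<in> nc_ball" and W: "W \<in> nc_ball"
    and Q: "Q \<in> carrier_mat (level Z) (level W)"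
    and Qe: "\<And>k l. k < level Z \<Longrightarrow> l < level W \<Longrightarrow> Q $$ (k, l) = p k * cnj (x $ l) + p' k * cnj (x' $ l)"
    and y: "y \<in> carrier_vec (level W)" and i: "i < level Z"
  shows "(szego_kernel Z W Q *\<^sub>v y) $ i
    = (\<Sum>k<level Z. p k * (\<Sum>\<^sub>\<infinity>\<alpha>. pairing W y x \<alpha> * word_entry Z i k \<alpha>))
    + (\<Sum>k<level Z. p' k * (\<Sum>\<^sub>\<infinity>\<alpha>. pairing W y x' \<alpha> * word_entry Z i k \<alpha>))"
proof -
  let ?n = "level Z" and ?m = "level W"
  have Zc: "\<And>\<alpha>. word_mat Z \<alpha> \<in> carrier_mat ?n ?n"
    using nc_ballE[OF Z] word_mat_carrier by metis
  have Wc: "\<And>\<alpha>. word_mat W \<alpha> \<in> carrier_mat ?m ?m"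
    using nc_ballE[OF W] word_mat_carrier by metis
  define s where "s j l k \<alpha> = word_entry Z i k \<alpha> * cnj (word_entry W j l \<alpha>)" for j l k \<alpha>
  have sm: "s j l k summable_on UNIV" if "j < ?m" "l < ?m" "k < ?n" for j l k
    unfolding s_def using that i
    by (intro pairing_summable_on geometric_level_bounded geometric_cnj word_entry_geometric Z W)
  have entry: "(word_mat Z \<alpha> * Q * mat_adjoint (word_mat W \<alpha>)) $$ (i, j)
      = (\<Sum>l<?m. \<Sum>k<?n. Q $$ (k, l) * s j l k \<alpha>)" if j: "j < ?m" for j \<alpha>
  proof -
    have "(word_mat Z \<alpha> * Q * mat_adjoint (word_mat W \<alpha>)) $$ (i, j)
        = (\<Sum>l<?m. (word_mat Z \<alpha> * Q) $$ (i, l) * mat_adjoint (word_mat W \<alpha>) $$ (l, j))"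
      using Zc Wc Q i j by (intro mult_entry mult_carrier_mat mat_adjoint_carrier)
    also have "\<dots> = (\<Sum>l<?m. \<Sum>k<?n. Q $$ (k, l) * s j l k \<alpha>)"
    proof (intro sum.cong refl)
      fix l assume "l \<in> {..<?m}"
      then have l: "l < ?m" by simp
      show "(word_mat Z \<alpha> * Q) $$ (i, l) * mat_adjoint (word_mat W \<alpha>) $$ (l, j)
          = (\<Sum>k<?n. Q $$ (k, l) * s j l k \<alpha>)"
        unfolding mult_entry[OF Zc Q i l] mat_adjoint_entry[OF Wc l j] sum_distrib_right s_def
        by (intro sum.cong refl) simp
    qed
    finally show ?thesis .
  qed
  have inner: "(\<Sum>\<^sub>\<infinity>\<alpha>. (word_mat Z \<alpha> * Q * mat_adjoint (word_mat W \<alpha>)) $$ (i, j))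
      = (\<Sum>l<?m. \<Sum>k<?n. Q $$ (k, l) * infsum (s j l k) UNIV)" if j: "j < ?m" for j
  proof -
    have "((\<lambda>\<alpha>. \<Sum>l<?m. \<Sum>k<?n. Q $$ (k, l) * s j l k \<alpha>) has_sum
        (\<Sum>l<?m. \<Sum>k<?n. Q $$ (k, l) * infsum (s j l k) UNIV)) UNIV"
      using j by (intro has_sum_finite_sum has_sum_cmult_right has_sum_infsum sm) auto
    then show ?thesis unfolding entry[OF j] by (rule infsumI)
  qed
  have part: "(\<Sum>j<?m. \<Sum>l<?m. \<Sum>k<?n. p k * (cnj (x $ l) * y $ j * infsum (s j l k) UNIV))
      = (\<Sum>k<?n. p k * (\<Sum>\<^sub>\<infinity>\<alpha>. pairing W y x \<alpha> * word_entry Z i k \<alpha>))" for p x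
  proof -
    have inf: "(\<Sum>\<^sub>\<infinity>\<alpha>. pairing W y x \<alpha> * word_entry Z i k \<alpha>)
        = (\<Sum>j<?m. \<Sum>l<?m. cnj (x $ l) * y $ j * infsum (s j l k) UNIV)" if k: "k < ?n" for k
    proof -
      have "((\<lambda>\<alpha>. \<Sum>j<?m. \<Sum>l<?m. cnj (x $ l) * y $ j * s j l k \<alpha>) has_sum
          (\<Sum>j<?m. \<Sum>l<?m. cnj (x $ l) * y $ j * infsum (s j l k) UNIV)) UNIV"
        using k by (intro has_sum_finite_sum has_sum_cmult_right has_sum_infsum sm) auto
      also have "(\<lambda>\<alpha>. \<Sum>j<?m. \<Sum>l<?m. cnj (x $ l) * y $ j * s j l k \<alpha>)
          = (\<lambda>\<alpha>. pairing W y x \<alpha> * word_entry Z i k \<alpha>)"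
        unfolding pairing_def s_def sum_distrib_right
          by (intro ext sum.cong refl) (simp add: algebra_simps)
      finally show ?thesis by (rule infsumI)
    qed
    have "(\<Sum>j<?m. \<Sum>l<?m. \<Sum>k<?n. p k * (cnj (x $ l) * y $ j * infsum (s j l k) UNIV))
        = (\<Sum>k<?n. p k * (\<Sum>j<?m. \<Sum>l<?m. cnj (x $ l) * y $ j * infsum (s j l k) UNIV))"
      unfolding sum_distrib_left by (rule sum_rotate)
    also have "\<dots> = (\<Sum>k<?n. p k * (\<Sum>\<^sub>\<infinity>\<alpha>. pairing W y x \<alpha> * word_entry Z i k \<alpha>))"
      by (intro sum.cong refl) (simp add: inf)
    finally show ?thesis .
  qed
  have "(szego_kernel Z W Q *\<^sub>v y) $ i
      = (\<Sum>j<?m. (\<Sum>\<^sub>\<infinity>\<alpha>. (word_mat Z \<alpha> * Q * mat_adjoint (word_mat W \<alpha>)) $$ (i, j)) * y $ j)"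
    using i y by (simp add: szego_kernel_def scalar_prod_def atLeast0LessThan)
  also have "\<dots> = (\<Sum>j<?m. \<Sum>l<?m. \<Sum>k<?n. p k * (cnj (x $ l) * y $ j * infsum (s j l k) UNIV)
      + p' k * (cnj (x' $ l) * y $ j * infsum (s j l k) UNIV))"
  proof (intro sum.cong refl)
    fix j assume "j \<in> {..<?m}"
    then have j: "j < ?m" by simp
    show "(\<Sum>\<^sub>\<infinity>\<alpha>. (word_mat Z \<alpha> * Q * mat_adjoint (word_mat W \<alpha>)) $$ (i, j)) * y $ j
        = (\<Sum>l<?m. \<Sum>k<?n. p k * (cnj (x $ l) * y $ j * infsum (s j l k) UNIV)
      + p' k * (cnj (x' $ l) * y $ j * infsum (s j l k) UNIV))"
      unfolding inner[OF j] sum_distrib_right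
      by (intro sum.cong refl) (simp add: Qe algebra_simps)
  qed
  finally show ?thesis by (simp add: sum.distrib part)
qed

text \<open>The kernel is the average of two terms, with the Herglotz function at the variable point and at
  the base point. The first term is a product of two power series, hence the convolution over the
  factorizations of the word; the second only changes the vector in the pairing.\<close>

definition kernel_coeff ::
    "('d list op \<Rightarrow> complex) \<Rightarrow> 'd point \<Rightarrow> complex vec \<Rightarrow> complex vec \<Rightarrow> 'd list \<Rightarrow> complex" where
  "kernel_coeff \<nu> W y v \<gamma> =
     ((\<Sum>s\<le>length \<gamma>. pairing W y v (take s \<gamma>) * herglotz_coeff \<nu> (drop s \<gamma>))
       + pairing W y (herglotz_fun \<nu> W *\<^sub>v v) \<gamma>) / 2"

lemma kernel_fun_power_series:
  fixes W :: "'d::finite point"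
  assumes W: "W \<in> nc_ball" and lb: "level_bounded (herglotz_coeff \<nu>)"
    and y: "y \<in> carrier_vec (level W)" and v: "v \<in> carrier_vec (level W)"
  shows "kernel_fun (herglotz_kernel \<nu>) W y v
    = restrict (power_series (kernel_coeff \<nu> W y v)) nc_ball"
  unfolding kernel_fun_def
proof (rule restrict_ext, rule eq_matI)
  fix Z :: "'d point" and i j
  assume Z: "Z \<in> nc_ball" and "i < dim_row (power_series (kernel_coeff \<nu> W y v) Z)"
    "j < dim_col (power_series (kernel_coeff \<nu> W y v) Z)"
  then have ij: "i < level Z" "j < level Z" by (simp_all add: power_series_def)
  let ?n = "level Z" and ?m = "level W" and ?HZ = "herglotz_fun \<nu> Z" and ?HW = "herglotz_fun \<nu> W"
  let ?P = "rank_one (unit_vec ?n j) v"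
  let ?Q = "?HZ * ?P + ?P * mat_adjoint ?HW"
  let ?h = "herglotz_coeff \<nu>"
  have P: "?P \<in> carrier_mat ?n ?m" using v by (simp add: rank_one_def)
  have Pe: "?P $$ (k, l) = (if k = j then cnj (v $ l) else 0)" if "k < ?n" "l < ?m" for k l
    using that v ij by (simp add: rank_one_def)
  have Q: "?Q \<in> carrier_mat ?n ?m"
    using P by (intro add_carrier_mat mult_carrier_mat[of _ _ ?m] mat_adjoint_carrier herglotz_fun_carrier)
  have Qe: "?Q $$ (k, l) = ?HZ $$ (k, j) * cnj (v $ l) + (if k = j then 1 else 0) * cnj ((?HW *\<^sub>v v) $ l)"
    if k: "k < ?n" and l: "l < ?m" for k l
  proof -
    have "(?HZ * ?P) $$ (k, l) = (\<Sum>q<?n. if q = j then ?HZ $$ (k, j) * cnj (v $ l) else 0)"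
      unfolding mult_entry[OF herglotz_fun_carrier P k l] using l by (intro sum.cong refl) (simp add: Pe)
    also have "\<dots> = ?HZ $$ (k, j) * cnj (v $ l)" using ij by (simp add: sum.delta)
    finally have 1: "(?HZ * ?P) $$ (k, l) = ?HZ $$ (k, j) * cnj (v $ l)" .
    have "(?P * mat_adjoint ?HW) $$ (k, l)
        = (\<Sum>q<?m. (if k = j then 1 else 0) * cnj (?HW $$ (l, q) * v $ q))"
      unfolding mult_entry[OF P mat_adjoint_carrier[OF herglotz_fun_carrier] k l] using k l
      by (intro sum.cong refl) (simp add: Pe mat_adjoint_entry[OF herglotz_fun_carrier])
    also have "\<dots> = (if k = j then 1 else 0) * cnj ((?HW *\<^sub>v v) $ l)"
      using l v carrier_matD[OF herglotz_fun_carrier[of \<nu> W]]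
      by (simp add: scalar_prod_def atLeast0LessThan sum_distrib_left)
    finally have 2: "(?P * mat_adjoint ?HW) $$ (k, l) = (if k = j then 1 else 0) * cnj ((?HW *\<^sub>v v) $ l)" .
    have "?Q $$ (k, l) = (?HZ * ?P) $$ (k, l) + (?P * mat_adjoint ?HW) $$ (k, l)"
      using P k l carrier_matD[OF mat_adjoint_carrier[OF herglotz_fun_carrier[of \<nu> W]]]
        carrier_matD[OF P] by simp
    then show ?thesis unfolding 1 2 .
  qed
  have first: "((\<lambda>\<gamma>. (\<Sum>s\<le>length \<gamma>. pairing W y v (take s \<gamma>) * ?h (drop s \<gamma>)) * word_entry Z i j \<gamma>)
      has_sum (\<Sum>k<?n. ?HZ $$ (k, j) * (\<Sum>\<^sub>\<infinity>\<alpha>. pairing W y v \<alpha> * word_entry Z i k \<alpha>))) UNIV"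
  proof -
    let ?f = "\<lambda>k \<alpha>. pairing W y v \<alpha> * word_entry Z i k \<alpha>" and ?g = "\<lambda>k \<alpha>. ?h \<alpha> * word_entry Z k j \<alpha>"
    have "((\<lambda>\<gamma>. \<Sum>k<?n. \<Sum>s\<le>length \<gamma>. ?f k (take s \<gamma>) * ?g k (drop s \<gamma>)) has_sum
        (\<Sum>k<?n. infsum (?f k) UNIV * infsum (?g k) UNIV)) UNIV"
      using ij by (intro has_sum_finite_sum infsum_times_words pairing_abs_summable word_entry_geometric
          geometric_level_bounded pairing_geometric Z W lb) auto
    also have "(\<Sum>k<?n. infsum (?f k) UNIV * infsum (?g k) UNIV)
        = (\<Sum>k<?n. ?HZ $$ (k, j) * infsum (?f k) UNIV)"
      unfolding herglotz_fun_power_series[OF Z lb]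
      by (intro sum.cong refl) (use ij in \<open>simp add: power_series_def\<close>)
    also have "(\<lambda>\<gamma>. \<Sum>k<?n. \<Sum>s\<le>length \<gamma>. ?f k (take s \<gamma>) * ?g k (drop s \<gamma>))
        = (\<lambda>\<gamma>. (\<Sum>s\<le>length \<gamma>. pairing W y v (take s \<gamma>) * ?h (drop s \<gamma>)) * word_entry Z i j \<gamma>)"
    proof
      fix \<gamma>
      have Zc: "\<And>k. Z k \<in> carrier_mat ?n ?n" using nc_ballE[OF Z] by blast
      have we: "word_entry Z i j \<gamma> = (\<Sum>k<?n. word_entry Z i k (take s \<gamma>) * word_entry Z k j (drop s \<gamma>))" for s
        using word_entry_append[OF Zc ij, of "take s \<gamma>" "drop s \<gamma>"] by simp
      have "(pairing W y v (take s \<gamma>) * ?h (drop s \<gamma>)) * word_entry Z i j \<gamma>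
          = (\<Sum>k<?n. ?f k (take s \<gamma>) * ?g k (drop s \<gamma>))" for s
        unfolding we[of s] sum_distrib_left by (intro sum.cong refl) (simp only: mult_ac)
      then have "(\<Sum>s\<le>length \<gamma>. pairing W y v (take s \<gamma>) * ?h (drop s \<gamma>)) * word_entry Z i j \<gamma>
          = (\<Sum>s\<le>length \<gamma>. \<Sum>k<?n. ?f k (take s \<gamma>) * ?g k (drop s \<gamma>))"
        unfolding sum_distrib_right by (intro sum.cong refl)
      then show "(\<Sum>k<?n. \<Sum>s\<le>length \<gamma>. ?f k (take s \<gamma>) * ?g k (drop s \<gamma>))
          = (\<Sum>s\<le>length \<gamma>. pairing W y v (take s \<gamma>) * ?h (drop s \<gamma>)) * word_entry Z i j \<gamma>"
        by (simp add: sum.swap[of _ "{..<?n}"])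
    qed
    finally show ?thesis .
  qed
  have second: "((\<lambda>\<gamma>. pairing W y (?HW *\<^sub>v v) \<gamma> * word_entry Z i j \<gamma>) has_sum
      (\<Sum>k<?n. (if k = j then 1 else 0) * (\<Sum>\<^sub>\<infinity>\<alpha>. pairing W y (?HW *\<^sub>v v) \<alpha> * word_entry Z i k \<alpha>))) UNIV"
    using ij
    by (simp add: if_distrib[of "\<lambda>t. t * _"] sum.delta pairing_summable_on geometric_level_bounded
        pairing_geometric W Z word_entry_geometric cong: if_cong)
  have "((\<lambda>\<gamma>. kernel_coeff \<nu> W y v \<gamma> * word_entry Z i j \<gamma>) has_sum (1/2) * (szego_kernel Z W ?Q *\<^sub>v y) $ i) UNIV"
  proof -
    have eq: "(\<lambda>\<gamma>. kernel_coeff \<nu> W y v \<gamma> * word_entry Z i j \<gamma>)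
      = (\<lambda>\<gamma>. (1/2) * ((\<Sum>s\<le>length \<gamma>. pairing W y v (take s \<gamma>) * ?h (drop s \<gamma>)) * word_entry Z i j \<gamma>
          + pairing W y (?HW *\<^sub>v v) \<gamma> * word_entry Z i j \<gamma>))"
      by (intro ext) (simp add: kernel_coeff_def distrib_right add_divide_distrib)
    have "(szego_kernel Z W ?Q *\<^sub>v y) $ i
      = (\<Sum>k<?n. ?HZ $$ (k, j) * (\<Sum>\<^sub>\<infinity>\<alpha>. pairing W y v \<alpha> * word_entry Z i k \<alpha>))
      + (\<Sum>k<?n. (if k = j then 1 else 0) * (\<Sum>\<^sub>\<infinity>\<alpha>. pairing W y (?HW *\<^sub>v v) \<alpha> * word_entry Z i k \<alpha>))"
      by (rule szego_kernel_rank_two[OF Z W Q _ y ij(1)]) (rule Qe)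
    then show ?thesis
      unfolding eq
      by (simp only:) (intro has_sum_cmult_right has_sum_add first second)
  qed
  then have "power_series (kernel_coeff \<nu> W y v) Z $$ (i, j) = (1/2) * (szego_kernel Z W ?Q *\<^sub>v y) $ i"
    by (rule power_series_entryI[OF ij])
  moreover have "(herglotz_kernel \<nu> Z W ?P *\<^sub>v y) $ i = (1/2) * (szego_kernel Z W ?Q *\<^sub>v y) $ i"
  proof -
    have "szego_kernel Z W ?Q \<in> carrier_mat ?n ?m" by (simp add: szego_kernel_def)
    then show ?thesis
      using ij y by (simp add: herglotz_kernel_def scalar_prod_def sum_distrib_left mult.assoc)
  qed
  ultimately have "(herglotz_kernel \<nu> Z W ?P *\<^sub>v y) $ i = power_series (kernel_coeff \<nu> W y v) Z $$ (i, j)"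
    by (simp only:)
  then show "Matrix.mat ?n ?n (\<lambda>(i, j). (herglotz_kernel \<nu> Z W (rank_one (unit_vec ?n j) v) *\<^sub>v y) $ i) $$ (i, j)
      = power_series (kernel_coeff \<nu> W y v) Z $$ (i, j)"
    using ij by simp
qed (simp_all add: power_series_def)

section \<open>Orthogonality of words and the Herglotz coefficients\<close>

definition word_sum :: "('d list \<Rightarrow> complex) \<Rightarrow> 'd list set \<Rightarrow> 'd list op" where
  "word_sum c S = (\<Sum>\<alpha>\<in>S. cscale_op (c \<alpha>) (word_op \<alpha>))"

lemma word_sum_disk_algebra: "word_sum c S \<in> disk_algebra"
  unfolding word_sum_def
  by (induction S rule: infinite_finite_induct)
    (auto intro: zero_disk_algebra disk_algebra_intros word_op_disk_algebra)

text \<open>Of two words of the same length, neither is a proper prefix of the other.\<close>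

lemma same_length_word_op:
  assumes "length \<alpha> = length \<beta>"
  shows "adj (word_op \<alpha>) o\<^sub>L word_op \<beta> = (if \<alpha> = \<beta> then id_blinfun else 0)"
  by (cases rule: adj_word_op_cases[of \<beta> \<alpha>]) (use assms in auto)

lemma measure_word_sum_left:
  assumes \<nu>: "positive_nc_measure \<nu>" and b: "b \<in> disk_algebra"
  shows "\<nu> (adj (word_sum c S) o\<^sub>L b) = (\<Sum>\<alpha>\<in>S. cnj (c \<alpha>) * \<nu> (adj (word_op \<alpha>) o\<^sub>L b))"
proof (induction S rule: infinite_finite_induct)
  case (insert \<alpha> S)
  have "word_sum c (insert \<alpha> S) = cscale_op (c \<alpha>) (word_op \<alpha>) + word_sum c S"
    using insert by (simp add: word_sum_def)
  then show ?case
    using insert b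
    by (simp add: measure_form_add_left[OF \<nu>] measure_form_cscale_left[OF \<nu>] word_sum_disk_algebra
        word_op_disk_algebra disk_algebra_intros)
qed (simp_all add: word_sum_def measure_zero[OF \<nu>])

lemma measure_word_sum_right:
  assumes \<nu>: "positive_nc_measure \<nu>" and b: "b \<in> disk_algebra"
  shows "\<nu> (adj b o\<^sub>L word_sum c S) = (\<Sum>\<alpha>\<in>S. c \<alpha> * \<nu> (adj b o\<^sub>L word_op \<alpha>))"
proof (induction S rule: infinite_finite_induct)
  case (insert \<alpha> S)
  have "word_sum c (insert \<alpha> S) = cscale_op (c \<alpha>) (word_op \<alpha>) + word_sum c S"
    using insert by (simp add: word_sum_def)
  then show ?case
    using insert b
    by (simp add: measure_form_add_right[OF \<nu>] measure_form_cscale_right[OF \<nu>] word_sum_disk_algebra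
        word_op_disk_algebra disk_algebra_intros)
qed (simp_all add: word_sum_def measure_zero[OF \<nu>])

lemma measure_word_sum_level:
  assumes \<nu>: "positive_nc_measure (\<nu> :: 'd::finite list op \<Rightarrow> complex)"
  shows "\<nu> (adj (word_sum c (words n)) o\<^sub>L word_sum c (words n)) = of_real (level_sq c n) * \<nu> id_blinfun"
proof -
  have "\<nu> (adj (word_op \<alpha>) o\<^sub>L word_sum c (words n)) = c \<alpha> * \<nu> id_blinfun" if "\<alpha> \<in> words n" for \<alpha> :: "'d list"
  proof -
    have "\<nu> (adj (word_op \<alpha>) o\<^sub>L word_sum c (words n))
        = (\<Sum>\<beta>\<in>words n. if \<alpha> = \<beta> then c \<beta> * \<nu> id_blinfun else 0)"
      unfolding measure_word_sum_right[OF \<nu> word_op_disk_algebra]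
      using that by (intro sum.cong refl) (simp add: words_def same_length_word_op measure_zero[OF \<nu>])
    then show ?thesis using that by (simp add: sum.delta)
  qed
  then have "\<nu> (adj (word_sum c (words n)) o\<^sub>L word_sum c (words n))
      = (\<Sum>\<alpha>\<in>words n. cnj (c \<alpha>) * (c \<alpha> * \<nu> id_blinfun))"
    unfolding measure_word_sum_left[OF \<nu> word_sum_disk_algebra] by (intro sum.cong refl) simp
  also have "\<dots> = of_real (level_sq c n) * \<nu> id_blinfun"
    unfolding level_sq_def of_real_sum sum_distrib_right complex_norm_square by (simp add: mult_ac)
  finally show ?thesis .
qed

text \<open>The words of a fixed length are isometries with orthogonal ranges, so positivity of the
  functional on the square of \<open>p - t\<close>, with \<open>p\<close> the combination of these words with coefficients
  \<open>cnj (\<nu> (L\<^sup>\<alpha>))\<close>, bounds the sum of the \<open>\<bar>\<nu> (L\<^sup>\<alpha>)\<bar>\<^sup>2\<close> over the level.\<close>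

lemma level_sq_measure_le:
  assumes \<nu>: "positive_nc_measure (\<nu> :: 'd::finite list op \<Rightarrow> complex)"
  shows "level_sq (\<lambda>\<alpha>. cnj (\<nu> (word_op \<alpha>))) n \<le> (Re (\<nu> id_blinfun))\<^sup>2"
proof -
  define c where "c = (\<lambda>\<alpha> :: 'd list. cnj (\<nu> (word_op \<alpha>)))"
  define p where "p = word_sum c (words n)"
  define S where "S = level_sq c n"
  define l where "l = Re (\<nu> id_blinfun)"
  have p: "p \<in> disk_algebra" by (simp add: p_def word_sum_disk_algebra)
  have id: "(id_blinfun :: 'd list op) \<in> disk_algebra" by (rule disk_algebra_intros)
  have l: "0 \<le> l" and l': "\<nu> id_blinfun = of_real l"
    using measure_id_nonneg[OF \<nu>] by (simp_all add: l_def less_eq_complex_def complex_eq_iff)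
  have idc: "id_blinfun o\<^sub>L T = T" for T :: "'d list op" by (rule blinfun_eqI) simp
  have pp: "\<nu> (adj p o\<^sub>L p) = of_real (S * l)"
    unfolding p_def measure_word_sum_level[OF \<nu>] by (simp add: S_def l')
  have ip: "\<nu> (adj id_blinfun o\<^sub>L p) = of_real S"
    unfolding p_def measure_word_sum_right[OF \<nu> id] S_def level_sq_def of_real_sum complex_norm_square
    by (simp add: c_def idc mult.commute)
  have pi: "\<nu> (adj p o\<^sub>L id_blinfun) = of_real S"
  proof -
    have "adj p o\<^sub>L id_blinfun = adj p" by (rule blinfun_eqI) simp
    then show ?thesis using ip measure_adj[OF \<nu> p] by (simp add: idc)
  qed
  have ii: "\<nu> (adj id_blinfun o\<^sub>L id_blinfun) = of_real l" by (simp add: idc l')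
  have quad: "0 \<le> S * l - 2 * t * S + t\<^sup>2 * l" for t :: real
  proof -
    let ?q = "p + cscale_op (of_real (- t)) id_blinfun"
    have "0 \<le> \<nu> (adj ?q o\<^sub>L ?q)"
      by (intro measure_form_nonneg[OF \<nu>] disk_algebra_intros p)
    also have "\<nu> (adj ?q o\<^sub>L ?q) = of_real (S * l - 2 * t * S + t\<^sup>2 * l)"
      using p id disk_algebra_intros(5)[OF id]
      by (simp add: measure_form_add_left[OF \<nu>] measure_form_add_right[OF \<nu>] disk_algebra_intros(3)
          measure_form_cscale_left[OF \<nu>] measure_form_cscale_right[OF \<nu>] pp ip pi ii
          algebra_simps power2_eq_square del: adj_id)
    finally show ?thesis by (simp add: less_eq_complex_def)
  qed
  have S0: "0 \<le> S" by (simp add: S_def)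
  have "S \<le> l\<^sup>2"
  proof (cases "l = 0")
    case True
    then show ?thesis using quad[of 1] S0 by simp
  next
    case False
    then have lp: "0 < l" using l by simp
    have "0 \<le> l * (S * l - 2 * (S / l) * S + (S / l)\<^sup>2 * l)"
      using quad[of "S / l"] lp by (intro mult_nonneg_nonneg) auto
    also have "\<dots> = S * (l\<^sup>2 - S)"
      using False by (simp add: power2_eq_square field_simps)
    finally have "0 \<le> S * (l\<^sup>2 - S)" .
    then show ?thesis using S0 by (cases "S = 0") (auto simp: zero_le_mult_iff)
  qed
  then show ?thesis by (simp add: S_def c_def l_def)
qed

lemma herglotz_coeff_level_bounded:
  assumes \<nu>: "positive_nc_measure (\<nu> :: 'd::finite list op \<Rightarrow> complex)"
  shows "level_bounded (herglotz_coeff \<nu>)"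
proof -
  have "level_sq (herglotz_coeff \<nu>) n \<le> 4 * (Re (\<nu> id_blinfun))\<^sup>2" for n
  proof -
    have le: "(cmod (herglotz_coeff \<nu> \<alpha>))\<^sup>2 \<le> 4 * (cmod (cnj (\<nu> (word_op \<alpha>))))\<^sup>2" for \<alpha>
      by (simp add: herglotz_coeff_def norm_mult power_mult_distrib)
    have "level_sq (herglotz_coeff \<nu>) n \<le> 4 * level_sq (\<lambda>\<alpha>. cnj (\<nu> (word_op \<alpha>))) n"
      unfolding level_sq_def sum_distrib_left by (intro sum_mono le)
    then show ?thesis using level_sq_measure_le[OF \<nu>, of n] by linarith
  qed
  then show ?thesis unfolding level_bounded_def by blast
qed

section \<open>The Herglotz space as a space of Cauchy transforms\<close>

text \<open>The functional \<open>\<nu>\<close> stands for \<open>\<mu> + m\<close>; the vacuum state \<open>m\<close> enters through the domination of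
  its form by that of \<open>\<nu>\<close>.\<close>

locale herglotz_space = nc_rkhs "herglotz_kernel \<nu>" H ip
  for \<nu> :: "'d::finite list op \<Rightarrow> complex" and H ip +
  assumes measure: "positive_nc_measure \<nu>"
begin

lemmas herglotz_coeff_bounded = herglotz_coeff_level_bounded[OF measure]

text \<open>The factor compensates the weights \<open>1/2\<close> in the corner entry of the nilpotent point.\<close>

definition word_fun :: "'d list \<Rightarrow> 'd nc_fun" where
  "word_fun \<alpha> = nf_scale (2 ^ length \<alpha>) (kernel_fun (herglotz_kernel \<nu>) (nil_point \<alpha>)
     (unit_vec (Suc (length \<alpha>)) 0) (unit_vec (Suc (length \<alpha>)) (length \<alpha>)))"

lemma word_fun_mem: "word_fun \<alpha> \<in> H"
  unfolding word_fun_def by (intro scale_mem kernel_fun_mem nil_point_in_ball) simp_all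

lemma ip_word_fun:
  assumes f: "f \<in> H"
  shows "ip (word_fun \<alpha>) f = word_coeff f \<alpha>"
proof -
  let ?n = "Suc (length \<alpha>)"
  let ?k = "kernel_fun (herglotz_kernel \<nu>) (nil_point \<alpha>) (unit_vec ?n 0) (unit_vec ?n (length \<alpha>))"
  have k: "?k \<in> H" by (intro kernel_fun_mem nil_point_in_ball) simp_all
  have fc: "f (nil_point \<alpha>) \<in> carrier_mat ?n ?n"
    using carrier[OF f nil_point_in_ball[of \<alpha>]] by simp
  have "ip ?k f = (f (nil_point \<alpha>) *\<^sub>v unit_vec ?n (length \<alpha>)) \<bullet>c unit_vec ?n 0"
    by (intro reproducing nil_point_in_ball f) simp_all
  also have "\<dots> = f (nil_point \<alpha>) $$ (0, length \<alpha>)"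
    by (rule entry_eq_cscalar_prod[OF fc]) simp_all
  finally show ?thesis
    by (simp add: word_fun_def ip_scale_left k f word_coeff_def)
qed

lemma coeff_add: "f \<in> H \<Longrightarrow> g \<in> H \<Longrightarrow> word_coeff (nf_add f g) \<alpha> = word_coeff f \<alpha> + word_coeff g \<alpha>"
  and coeff_scale: "f \<in> H \<Longrightarrow> word_coeff (nf_scale c f) \<alpha> = c * word_coeff f \<alpha>"
  and coeff_diff: "f \<in> H \<Longrightarrow> g \<in> H \<Longrightarrow> word_coeff (nf_diff f g) \<alpha> = word_coeff f \<alpha> - word_coeff g \<alpha>"
  using word_fun_mem by (simp_all add: ip_word_fun[symmetric] ip_simps)

lemma coeff_kernel_fun:
  "Z \<in> nc_ball \<Longrightarrow> y \<in> carrier_vec (level Z) \<Longrightarrow> v \<in> carrier_vec (level Z) \<Longrightarrow>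
   word_coeff (kernel_fun (herglotz_kernel \<nu>) Z y v) = kernel_coeff \<nu> Z y v"
  by (simp add: kernel_fun_power_series[OF _ herglotz_coeff_bounded] word_coeff_power_series)

text \<open>At a nilpotent point the convolution in the coefficients of the kernel function collapses: one of
  its terms survives if \<open>\<beta>\<close> is a prefix of \<open>\<alpha>\<close>, the other if \<open>\<alpha>\<close> is a prefix of \<open>\<beta>\<close>, and what remains is
  the Herglotz coefficient at the rest of the word. So \<open>word_fun \<alpha>\<close> is the Cauchy transform of \<open>L\<^sup>\<alpha>\<close>.\<close>

lemma ip_word_fun_word_fun:
  "ip (word_fun \<alpha>) (word_fun \<beta>) = \<nu> (adj (word_op \<alpha>) o\<^sub>L word_op \<beta>)"
proof -
  let ?m = "length \<beta>" and ?W = "nil_point \<beta>"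
  let ?h = "herglotz_coeff \<nu>"
  \<comment> \<open>All sums over words collapse: at this point only subwords of \<open>\<beta>\<close> have nonzero entries.\<close>
  have pair: "pairing ?W (unit_vec (Suc ?m) 0) x \<gamma>
      = (\<Sum>l<Suc ?m. cnj (word_entry ?W 0 l \<gamma> * x $ l))" for x \<gamma>
  proof -
    have "pairing ?W (unit_vec (Suc ?m) 0) x \<gamma>
        = (\<Sum>j<Suc ?m. if j = 0 then (\<Sum>l<Suc ?m. cnj (word_entry ?W 0 l \<gamma> * x $ l)) else 0)"
      unfolding pairing_def level_nil_point by (intro sum.cong refl) simp
    then show ?thesis by (simp add: sum.delta del: sum.lessThan_Suc)
  qed
  have pair1: "pairing ?W (unit_vec (Suc ?m) 0) (unit_vec (Suc ?m) ?m) \<gamma>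
      = (if \<gamma> = \<beta> then (1/2) ^ ?m else 0)" for \<gamma>
  proof -
    have "pairing ?W (unit_vec (Suc ?m) 0) (unit_vec (Suc ?m) ?m) \<gamma>
        = (\<Sum>l<Suc ?m. if l = ?m then cnj (word_entry ?W 0 ?m \<gamma>) else 0)"
      unfolding pair by (intro sum.cong refl) simp
    then show ?thesis by (simp add: sum.delta nil_point_corner del: sum.lessThan_Suc)
  qed
  have h_entry: "herglotz_fun \<nu> ?W $$ (k, ?m) = (1/2) ^ (?m - k) * ?h (drop k \<beta>)" if k: "k \<le> ?m" for k
    unfolding herglotz_fun_power_series[OF nil_point_in_ball herglotz_coeff_bounded]
  proof (rule power_series_entryI)
    show "((\<lambda>\<gamma>. ?h \<gamma> * word_entry ?W k ?m \<gamma>) has_sum (1/2) ^ (?m - k) * ?h (drop k \<beta>)) UNIV"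
      by (rule has_sum_finite_neutralI[where B = "{drop k \<beta>}"])
        (use k in \<open>auto simp: nil_point_entry split: if_splits\<close>)
  qed (use k in simp_all)
  have pair2: "pairing ?W (unit_vec (Suc ?m) 0) (herglotz_fun \<nu> ?W *\<^sub>v unit_vec (Suc ?m) ?m) \<alpha>
      = (if take (length \<alpha>) \<beta> = \<alpha> then (1/2) ^ ?m * cnj (?h (drop (length \<alpha>) \<beta>)) else 0)"
  proof -
    let ?t = "if take (length \<alpha>) \<beta> = \<alpha> then (1/2) ^ ?m * cnj (?h (drop (length \<alpha>) \<beta>)) else 0"
    have Hc: "herglotz_fun \<nu> ?W \<in> carrier_mat (Suc ?m) (Suc ?m)"
      using herglotz_fun_carrier[of \<nu> ?W] by simp
    have "(herglotz_fun \<nu> ?W *\<^sub>v unit_vec (Suc ?m) ?m) $ l = herglotz_fun \<nu> ?W $$ (l, ?m)"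
      if "l < Suc ?m" for l
      using that carrier_matD[OF Hc] by (simp add: scalar_prod_right_unit)
    then have "cnj (word_entry ?W 0 l \<alpha> * (herglotz_fun \<nu> ?W *\<^sub>v unit_vec (Suc ?m) ?m) $ l)
        = (if l = length \<alpha> then ?t else 0)" if "l < Suc ?m" for l
      using that
      by (auto simp: nil_point_entry h_entry power_add[symmetric] mult.assoc[symmetric] less_Suc_eq_le)
    then have "pairing ?W (unit_vec (Suc ?m) 0) (herglotz_fun \<nu> ?W *\<^sub>v unit_vec (Suc ?m) ?m) \<alpha>
        = (\<Sum>l<Suc ?m. if l = length \<alpha> then ?t else 0)"
      unfolding pair by (intro sum.cong refl) simp
    also have "\<dots> = ?t"
      by (auto simp: sum.delta simp del: sum.lessThan_Suc)
    finally show ?thesis .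
  qed
  have conv: "(\<Sum>s\<le>length \<alpha>. pairing ?W (unit_vec (Suc ?m) 0) (unit_vec (Suc ?m) ?m) (take s \<alpha>) * ?h (drop s \<alpha>))
      = (if take ?m \<alpha> = \<beta> then (1/2) ^ ?m * ?h (drop ?m \<alpha>) else 0)"
  proof -
    have "(\<Sum>s\<le>length \<alpha>. pairing ?W (unit_vec (Suc ?m) 0) (unit_vec (Suc ?m) ?m) (take s \<alpha>) * ?h (drop s \<alpha>))
        = (\<Sum>s\<le>length \<alpha>. if s = ?m then (if take ?m \<alpha> = \<beta> then (1/2) ^ ?m * ?h (drop ?m \<alpha>) else 0) else 0)"
      unfolding pair1 by (intro sum.cong refl) auto
    also have "\<dots> = (if take ?m \<alpha> = \<beta> then (1/2) ^ ?m * ?h (drop ?m \<alpha>) else 0)"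
      by (auto simp: sum.delta)
    finally show ?thesis .
  qed
  have "ip (word_fun \<alpha>) (word_fun \<beta>) = word_coeff (word_fun \<beta>) \<alpha>"
    by (rule ip_word_fun[OF word_fun_mem])
  also have "\<dots> = 2 ^ ?m * kernel_coeff \<nu> ?W (unit_vec (Suc ?m) 0) (unit_vec (Suc ?m) ?m) \<alpha>"
    unfolding word_fun_def
    by (subst coeff_scale) (simp_all add: kernel_fun_mem nil_point_in_ball coeff_kernel_fun)
  also have "\<dots> = ((if take ?m \<alpha> = \<beta> then ?h (drop ?m \<alpha>) else 0)
      + (if take (length \<alpha>) \<beta> = \<alpha> then cnj (?h (drop (length \<alpha>) \<beta>)) else 0)) / 2"
    unfolding kernel_coeff_def conv pair2
    by (simp add: power_one_over distrib_left)
  also have "\<dots> = \<nu> (adj (word_op \<alpha>) o\<^sub>L word_op \<beta>)"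
  proof (cases rule: adj_word_op_cases[of \<beta> \<alpha>])
    case (left \<delta>)
    show ?thesis
    proof (cases "\<delta> = []")
      case True
      then show ?thesis
        using left measure_id_nonneg[OF measure]
        by (simp add: herglotz_coeff_def less_eq_complex_def complex_eq_iff)
    next
      case False
      then have "take ?m \<alpha> \<noteq> \<beta>" using left by auto
      then show ?thesis using left False by (simp add: herglotz_coeff_def)
    qed
  next
    case (right \<delta>)
    show ?thesis
    proof (cases "\<delta> = []")
      case True
      then show ?thesis
        using right measure_id_nonneg[OF measure]
        by (simp add: herglotz_coeff_def less_eq_complex_def complex_eq_iff)
    next
      case False
      then have "take (length \<alpha>) \<beta> \<noteq> \<alpha>" using right by auto
      then show ?thesis
        using right False by (simp add: herglotz_coeff_def measure_adj[OF measure] word_op_disk_algebra)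
    qed
  next
    case incomparable
    then have "take ?m \<alpha> \<noteq> \<beta>" "take (length \<alpha>) \<beta> \<noteq> \<alpha>"
      by (metis append_take_drop_id)+
    then show ?thesis using incomparable by (simp add: measure_zero[OF measure])
  qed
  finally show ?thesis .
qed

text \<open>The Cauchy transform on polynomials. As a relation generated by the words it avoids fixing a
  representation of a polynomial by coefficients, and its properties follow by induction.\<close>

inductive rep :: "'d list op \<Rightarrow> 'd nc_fun \<Rightarrow> bool" where
  word: "rep (word_op \<alpha>) (word_fun \<alpha>)"
| add: "rep p f \<Longrightarrow> rep q g \<Longrightarrow> rep (p + q) (nf_add f g)"
| scale: "rep p f \<Longrightarrow> rep (cscale_op c p) (nf_scale c f)"

lemma rep_mem:
  assumes "rep p f"
  shows "p \<in> nc_polynomials" "p \<in> disk_algebra" "f \<in> H"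
proof -
  have "p \<in> nc_polynomials \<and> f \<in> H"
    using assms by induction (auto intro: nc_polynomials.intros word_fun_mem add_mem scale_mem)
  then show "p \<in> nc_polynomials" "p \<in> disk_algebra" "f \<in> H"
    by (auto intro: nc_polynomials_disk_algebra)
qed

lemma ex_rep: "p \<in> nc_polynomials \<Longrightarrow> \<exists>f. rep p f"
  by (induction rule: nc_polynomials.induct) (blast intro: rep.intros)+

lemma rep_diff: "rep p f \<Longrightarrow> rep q g \<Longrightarrow> rep (p - q) (nf_diff f g)"
  using rep.add[OF _ rep.scale[of q g "-1"], of p f]
  by (simp add: minus_cscale_op[symmetric] nf_diff_def)

lemma rep_zero: "rep 0 nf_zero"
  using rep.scale[OF rep.word[of "[]"], of 0] nf_scale_zero[OF word_fun_mem] by simp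

lemma ip_rep:
  assumes "rep p f" "rep q g"
  shows "ip f g = \<nu> (adj p o\<^sub>L q)"
  using assms(1)
proof induction
  case (word \<alpha>)
  show ?case using assms(2)
  proof induction
    case (add q g q' g')
    then show ?case
      by (simp add: ip_add_right word_fun_mem rep_mem measure_form_add_right[OF measure] word_op_disk_algebra)
  next
    case (scale q g c)
    then show ?case
      by (simp add: ip_scale_right word_fun_mem rep_mem measure_form_cscale_right[OF measure] word_op_disk_algebra)
  qed (rule ip_word_fun_word_fun)
next
  case (add p f p' f')
  then show ?case
    using rep_mem[OF assms(2)]
    by (simp add: ip_add_left rep_mem measure_form_add_left[OF measure])
next
  case (scale p f c)
  then show ?case
    using rep_mem[OF assms(2)]
    by (simp add: ip_scale_left rep_mem measure_form_cscale_left[OF measure])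
qed

lemma nrm_sq_rep: "rep p f \<Longrightarrow> (nrm f)\<^sup>2 = Re (\<nu> (adj p o\<^sub>L p))"
  by (simp add: nrm_sq rep_mem ip_rep)

text \<open>The duality behind the theorem: \<open>g\<close> plays the part of \<open>E\<^sup>* h\<close> for the inclusion \<open>E\<close> of the polynomials
  into the Fock space. On words both sides are the coefficient \<open>h\<^sub>\<alpha>\<close>.\<close>

lemma ip_rep_coord:
  assumes "rep p f" and g: "g \<in> H" and h: "\<And>\<alpha>. word_coeff g \<alpha> = coord h \<alpha>"
  shows "ip f g = cinner (blinfun_apply p vacuum) h"
  using assms(1)
proof induction
  case (word \<alpha>)
  then show ?case by (simp add: ip_word_fun g h word_op_ket cinner_ket_left)
next
  case (add p f q f')
  then show ?case by (simp add: ip_add_left rep_mem g blinfun.add_left cinner_add_left)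
next
  case (scale p f c)
  then show ?case by (simp add: ip_scale_left rep_mem g blinfun_apply_cscale_op cinner_cscale_left)
qed

lemma rep_word_sum:
  assumes "finite S"
  shows "\<exists>g. rep (word_sum c S) g \<and> (\<forall>f\<in>H. ip g f = (\<Sum>\<alpha>\<in>S. cnj (c \<alpha>) * word_coeff f \<alpha>))"
  using assms
proof (induction S rule: finite_induct)
  case empty
  show ?case using rep_zero ip_zero_left by (intro exI[of _ nf_zero]) (simp add: word_sum_def)
next
  case (insert \<alpha> S)
  then obtain g where g: "rep (word_sum c S) g" "\<And>f. f \<in> H \<Longrightarrow> ip g f = (\<Sum>\<alpha>\<in>S. cnj (c \<alpha>) * word_coeff f \<alpha>)"
    by blast
  have eq: "word_sum c (insert \<alpha> S) = cscale_op (c \<alpha>) (word_op \<alpha>) + word_sum c S"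
    using insert by (simp add: word_sum_def)
  show ?case
    unfolding eq using insert g rep_mem[OF g(1)]
    by (intro exI[of _ "nf_add (nf_scale (c \<alpha>) (word_fun \<alpha>)) g"] conjI rep.add rep.scale rep.word)
      (simp_all add: ip_add_left ip_scale_left scale_mem word_fun_mem ip_word_fun)
qed

text \<open>Bessel's inequality: the transforms of the words of one length are orthogonal with squared norm
  \<open>\<nu>(1)\<close>, and \<open>f\<close> is paired with their combination \<open>g\<close> with the coefficients of \<open>f\<close> itself.\<close>

lemma coeff_bessel:
  assumes f: "f \<in> H"
  shows "level_sq (word_coeff f) n \<le> Re (\<nu> id_blinfun) * (nrm f)\<^sup>2"
proof -
  let ?S = "level_sq (word_coeff f) n" and ?l = "Re (\<nu> id_blinfun)"
  obtain g where g: "rep (word_sum (word_coeff f) (words n)) g"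
    "\<And>f'. f' \<in> H \<Longrightarrow> ip g f' = (\<Sum>\<alpha>\<in>words n. cnj (word_coeff f \<alpha>) * word_coeff f' \<alpha>)"
    using rep_word_sum[of "words n" "word_coeff f"] by auto
  have gf: "ip g f = of_real ?S"
    unfolding g(2)[OF f] level_sq_def of_real_sum complex_norm_square by (simp add: mult.commute)
  have gg: "(nrm g)\<^sup>2 = ?S * ?l"
    using nrm_sq_rep[OF g(1)] by (simp add: measure_word_sum_level[OF measure])
  have "?S = cmod (ip g f)" by (simp add: gf)
  also have "\<dots> \<le> nrm g * nrm f" by (intro norm_ip_le rep_mem[OF g(1)] f)
  finally have "?S\<^sup>2 \<le> (nrm g * nrm f)\<^sup>2" by (rule power_mono) simp
  then have "?S\<^sup>2 \<le> ?S * ?l * (nrm f)\<^sup>2"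
    by (simp only: power_mult_distrib gg)
  then have "?S * ?S \<le> ?S * (?l * (nrm f)\<^sup>2)"
    by (simp add: power2_eq_square mult_ac)
  moreover have "0 \<le> ?l * (nrm f)\<^sup>2"
    using measure_id_nonneg[OF measure] by (simp add: less_eq_complex_def)
  ultimately show ?thesis
    using level_sq_nonneg[of "word_coeff f" n] by (cases "?S = 0") (auto simp: mult_le_cancel_left)
qed

lemma coeff_level_sq_le:
  "f \<in> H \<Longrightarrow> level_sq (word_coeff f) n \<le> (sqrt (Re (\<nu> id_blinfun)) * nrm f)\<^sup>2"
  using coeff_bessel[of f n] measure_id_nonneg[OF measure]
  by (simp add: power_mult_distrib less_eq_complex_def)

lemma coeff_level_bounded: "f \<in> H \<Longrightarrow> level_bounded (word_coeff f)"
  unfolding level_bounded_def using coeff_bessel by blast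

lemma power_series_in_nc_function:
  assumes f: "f \<in> H"
  shows "f = restrict (power_series (word_coeff f)) nc_ball
    \<longleftrightarrow> (\<forall>Z\<in>nc_ball. f Z = power_series (word_coeff f) Z)"
proof
  assume *: "\<forall>Z\<in>nc_ball. f Z = power_series (word_coeff f) Z"
  have "f \<in> extensional nc_ball" using f nc_function unfolding nc_function_def by blast
  then show "f = restrict (power_series (word_coeff f)) nc_ball"
    by (rule extensionalityI) (use * in auto)
qed (metis restrict_apply')

text \<open>Both sides of the expansion are, entry by entry, bounded functionals of \<open>f\<close>: the left one by
  the reproducing property and the right one by Bessel's inequality on each level and the
  geometric decay of the words of a point. They agree on the kernel functions, which span a dense
  subspace.\<close>

lemma power_series_expansion:
  assumes f: "f \<in> H"
  shows "f = restrict (power_series (word_coeff f)) nc_ball"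
proof -
  define D where "D = {g \<in> H. \<forall>Z\<in>nc_ball. g Z = power_series (word_coeff g) Z}"
  have DH: "\<And>g. g \<in> D \<Longrightarrow> g \<in> H" by (simp add: D_def)
  have D_add: "nf_add g h \<in> D" if g: "g \<in> D" and h: "h \<in> D" for g h
  proof -
    have gh: "g \<in> H" "h \<in> H" using g h DH by auto
    have "word_coeff (nf_add g h) = (\<lambda>\<alpha>. word_coeff g \<alpha> + word_coeff h \<alpha>)"
      by (rule ext) (simp add: coeff_add gh)
    then have "nf_add g h Z = power_series (word_coeff (nf_add g h)) Z" if "Z \<in> nc_ball" for Z
      using that g h
      by (simp add: power_series_linear coeff_level_bounded gh nf_add_def D_def)
    then show ?thesis using gh by (simp add: D_def add_mem)
  qed
  have D_scale: "nf_scale c g \<in> D" if g: "g \<in> D" for c g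
  proof -
    have gH: "g \<in> H" using g DH by auto
    have "word_coeff (nf_scale c g) = (\<lambda>\<alpha>. c * word_coeff g \<alpha>)"
      by (rule ext) (simp add: coeff_scale gH)
    then have "nf_scale c g Z = power_series (word_coeff (nf_scale c g)) Z" if "Z \<in> nc_ball" for Z
      using that g
      by (simp add: power_series_linear[of Z "word_coeff g" "word_coeff g"] coeff_level_bounded gH nf_scale_def D_def)
    then show ?thesis using gH by (simp add: D_def scale_mem)
  qed
  have D_kernel: "kernel_fun (herglotz_kernel \<nu>) Z y v \<in> D"
    if Z: "Z \<in> nc_ball" and y: "y \<in> carrier_vec (level Z)" and v: "v \<in> carrier_vec (level Z)" for Z y v
    using kernel_fun_mem[OF Z y v] coeff_kernel_fun[OF Z y v]
    by (simp add: D_def kernel_fun_power_series[OF Z herglotz_coeff_bounded y v])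
  have "word_fun [] \<in> D"
    unfolding word_fun_def by (intro D_scale D_kernel nil_point_in_ball) simp_all
  then have "nf_scale 0 (word_fun []) \<in> D" by (rule D_scale)
  then have "nf_zero \<in> D" by (simp add: nf_scale_zero word_fun_mem)
  then have sub: "is_subspace D"
    unfolding is_subspace_def by (auto intro: DH D_add D_scale)
  have triv: "g = nf_zero" if "g \<in> H" "\<And>h. h \<in> D \<Longrightarrow> ip h g = 0" for g
    by (rule eq_zero_if_orthogonal_kernels[OF that(1)]) (intro that(2) D_kernel)
  obtain X where X: "\<And>n. X n \<in> D" "(\<lambda>n. nrm (nf_diff (X n) f)) \<longlonglongrightarrow> 0"
    using dense_if_orthogonal_trivial[OF sub triv f] by blast
  note XH = DH[OF X(1)]
  have "f Z = power_series (word_coeff f) Z" if Z: "Z \<in> nc_ball" for Z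
  proof (rule eq_matI)
    have fZ: "f Z \<in> carrier_mat (level Z) (level Z)" by (rule carrier[OF f Z])
    show "dim_row (f Z) = dim_row (power_series (word_coeff f) Z)"
      "dim_col (f Z) = dim_col (power_series (word_coeff f) Z)"
      using fZ by (simp_all add: power_series_def)
    fix i j assume "i < dim_row (power_series (word_coeff f) Z)" "j < dim_col (power_series (word_coeff f) Z)"
    then have ij: "i < level Z" "j < level Z" by (simp_all add: power_series_def)
    let ?k = "kernel_fun (herglotz_kernel \<nu>) Z (unit_vec (level Z) i) (unit_vec (level Z) j)"
    have k: "?k \<in> H" by (intro kernel_fun_mem Z) simp_all
    have entry: "g Z $$ (i, j) = ip ?k g" if g: "g \<in> H" for g
      using reproducing[OF Z _ _ g, of "unit_vec (level Z) i" "unit_vec (level Z) j"]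
        entry_eq_cscalar_prod[OF carrier[OF g Z] ij] by simp
    have lim1: "(\<lambda>n. X n Z $$ (i, j)) \<longlonglongrightarrow> f Z $$ (i, j)"
      unfolding entry[OF XH] entry[OF f] by (intro tendsto_ip XH f k X(2))
    obtain M where M: "0 \<le> M" "\<And>c C. (\<And>n. level_sq c n \<le> C\<^sup>2) \<Longrightarrow> 0 \<le> C \<Longrightarrow>
       (\<lambda>\<alpha>. cmod (c \<alpha> * word_entry Z i j \<alpha>)) summable_on UNIV
       \<and> cmod (\<Sum>\<^sub>\<infinity>\<alpha>. c \<alpha> * word_entry Z i j \<alpha>) \<le> M * C"
      using pairing_summable[OF word_entry_geometric[OF Z ij]] by blast
    let ?l = "sqrt (Re (\<nu> id_blinfun))"
    have l: "0 \<le> ?l" using measure_id_nonneg[OF measure] by (simp add: less_eq_complex_def)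
    have bound: "cmod (X n Z $$ (i, j) - power_series (word_coeff f) Z $$ (i, j))
        \<le> M * (?l * nrm (nf_diff (X n) f))" for n
    proof -
      have "((\<lambda>\<alpha>. word_coeff (X n) \<alpha> * word_entry Z i j \<alpha> + (-1) * (word_coeff f \<alpha> * word_entry Z i j \<alpha>)) has_sum
          power_series (word_coeff (X n)) Z $$ (i, j) + (-1) * power_series (word_coeff f) Z $$ (i, j)) UNIV"
        by (intro has_sum_add has_sum_cmult_right power_series_has_sum Z ij coeff_level_bounded XH f)
      also have "(\<lambda>\<alpha>. word_coeff (X n) \<alpha> * word_entry Z i j \<alpha> + (-1) * (word_coeff f \<alpha> * word_entry Z i j \<alpha>))
          = (\<lambda>\<alpha>. word_coeff (nf_diff (X n) f) \<alpha> * word_entry Z i j \<alpha>)"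
        by (rule ext) (simp add: coeff_diff XH f left_diff_distrib)
      finally have "(\<Sum>\<^sub>\<infinity>\<alpha>. word_coeff (nf_diff (X n) f) \<alpha> * word_entry Z i j \<alpha>)
          = power_series (word_coeff (X n)) Z $$ (i, j) + (-1) * power_series (word_coeff f) Z $$ (i, j)"
        by (rule infsumI)
      moreover have "cmod (\<Sum>\<^sub>\<infinity>\<alpha>. word_coeff (nf_diff (X n) f) \<alpha> * word_entry Z i j \<alpha>)
          \<le> M * (?l * nrm (nf_diff (X n) f))"
        using M(2)[of "word_coeff (nf_diff (X n) f)" "?l * nrm (nf_diff (X n) f)"]
          l coeff_level_sq_le[OF diff_mem[OF XH f]] nrm_nonneg[OF diff_mem[OF XH f]] by simp
      moreover have "X n Z = power_series (word_coeff (X n)) Z" using X(1)[of n] Z by (simp add: D_def)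
      ultimately show ?thesis by simp
    qed
    have "(\<lambda>n. M * (?l * nrm (nf_diff (X n) f))) \<longlonglongrightarrow> M * (?l * 0)"
      by (intro tendsto_intros X(2))
    then have "(\<lambda>n. M * (?l * nrm (nf_diff (X n) f))) \<longlonglongrightarrow> 0" by simp
    then have "(\<lambda>n. X n Z $$ (i, j) - power_series (word_coeff f) Z $$ (i, j)) \<longlonglongrightarrow> 0"
      by (rule Lim_null_comparison[OF always_eventually, rotated]) (intro allI bound)
    then have "(\<lambda>n. X n Z $$ (i, j)) \<longlonglongrightarrow> power_series (word_coeff f) Z $$ (i, j)"
      by (simp add: LIM_zero_iff)
    then show "f Z $$ (i, j) = power_series (word_coeff f) Z $$ (i, j)"
      using lim1 LIMSEQ_unique by blast
  qed
  then show ?thesis using power_series_in_nc_function[OF f] by blast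
qed

lemma eq_zero_if_coeff_zero:
  assumes f: "f \<in> H" and "\<And>\<alpha>. word_coeff f \<alpha> = 0"
  shows "f = nf_zero"
proof -
  have "word_coeff f = word_coeff nf_zero"
    using assms ip_word_fun[OF zero_mem] ip_zero_right[OF word_fun_mem] by auto
  then show ?thesis using power_series_expansion[OF f] power_series_expansion[OF zero_mem] by simp
qed

lemma mem_nc_hardyI: "f \<in> H \<Longrightarrow> (\<And>\<alpha>. word_coeff f \<alpha> = coord h \<alpha>) \<Longrightarrow> f \<in> nc_hardy"
  unfolding nc_hardy_def using power_series_expansion[of f] coord_summable[of h] by auto

lemma mem_nc_hardyD:
  assumes "f \<in> nc_hardy"
  obtains h where "\<And>\<alpha>. word_coeff f \<alpha> = coord h \<alpha>"
proof -
  obtain c where c: "f = restrict (power_series c) nc_ball" "(\<lambda>\<alpha>. (cmod (c \<alpha>))\<^sup>2) summable_on UNIV"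
    using assms unfolding nc_hardy_def by blast
  have "word_coeff f \<alpha> = coord (Abs_ell2 c) \<alpha>" for \<alpha>
    using c by (simp add: word_coeff_power_series Abs_ell2_inverse)
  then show ?thesis by (rule that)
qed

lemma hardy_subspace: "is_subspace (H \<inter> nc_hardy)"
proof -
  have z: "(nf_zero :: 'd nc_fun) \<in> nc_hardy"
    by (rule mem_nc_hardyI[OF zero_mem, where h = 0])
      (simp add: ip_word_fun[OF zero_mem, symmetric] ip_zero_right word_fun_mem)
  have a: "nf_add f g \<in> nc_hardy" if fg: "f \<in> H" "g \<in> H" "f \<in> nc_hardy" "g \<in> nc_hardy" for f g
  proof -
    obtain h where h: "\<And>\<alpha>. word_coeff f \<alpha> = coord h \<alpha>" using mem_nc_hardyD[OF fg(3)] by blast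
    obtain h' where h': "\<And>\<alpha>. word_coeff g \<alpha> = coord h' \<alpha>" using mem_nc_hardyD[OF fg(4)] by blast
    show ?thesis
      by (rule mem_nc_hardyI[of _ "h + h'"]) (use fg h h' in \<open>simp_all add: add_mem coeff_add\<close>)
  qed
  have s: "nf_scale c f \<in> nc_hardy" if f: "f \<in> H" "f \<in> nc_hardy" for c f
  proof -
    obtain h where h: "\<And>\<alpha>. word_coeff f \<alpha> = coord h \<alpha>" using mem_nc_hardyD[OF f(2)] by blast
    show ?thesis
      by (rule mem_nc_hardyI[of _ "cscale c h"]) (use f h in \<open>simp_all add: scale_mem coeff_scale\<close>)
  qed
  show ?thesis
    unfolding is_subspace_def by (simp add: z a s zero_mem add_mem scale_mem)
qed

lemma rep_subspace: "is_subspace {f. \<exists>p. rep p f}"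
  unfolding is_subspace_def
proof (intro conjI ballI allI subsetI)
  fix f g c assume "f \<in> {f. \<exists>p. rep p f}"
  then obtain p where p: "rep p f" by auto
  show "f \<in> H" by (rule rep_mem[OF p])
  show "nf_scale c f \<in> {f. \<exists>p. rep p f}" using rep.scale[OF p] by auto
  assume "g \<in> {f. \<exists>p. rep p f}"
  then obtain q where q: "rep q g" by auto
  show "nf_add f g \<in> {f. \<exists>p. rep p f}" using rep.add[OF p q] by auto
qed (use rep_zero in auto)

lemma rep_dense:
  assumes f: "f \<in> H"
  obtains p X where "\<And>n. rep (p n) (X n)" "(\<lambda>n. nrm (nf_diff (X n) f)) \<longlonglongrightarrow> 0"
proof -
  have triv: "g = nf_zero" if g: "g \<in> H" and orth: "\<And>h. h \<in> {f. \<exists>p. rep p f} \<Longrightarrow> ip h g = 0" for g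
  proof (rule eq_zero_if_coeff_zero[OF g])
    fix \<alpha>
    have "word_fun \<alpha> \<in> {f. \<exists>p. rep p f}" using rep.word by blast
    then have "ip (word_fun \<alpha>) g = 0" by (rule orth)
    then show "word_coeff g \<alpha> = 0" by (simp add: ip_word_fun[OF g])
  qed
  show ?thesis
  proof (rule dense_if_orthogonal_trivial[OF rep_subspace triv f])
    fix X assume X: "\<And>n. X n \<in> {f. \<exists>p. rep p f}" "(\<lambda>n. nrm (nf_diff (X n) f)) \<longlonglongrightarrow> 0"
    have "\<forall>n. \<exists>p. rep p (X n)" using X(1) by simp
    then obtain p where "\<forall>n. rep (p n) (X n)" by (rule choice[THEN exE])
    then show ?thesis using that[of p X] X(2) by simp
  qed
qed

end

context herglotz_space
begin

text \<open>If the form of the measure dominates that of the vacuum state, then the inclusion of the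
  polynomials into the Fock space is a contraction for the measure, and its adjoint sends every
  \<open>h\<close> to an element of the space whose coefficients are those of \<open>h\<close>.\<close>

lemma ex_word_coeff_eq:
  assumes dom: "\<And>p. p \<in> disk_algebra \<Longrightarrow> (norm (blinfun_apply p vacuum))\<^sup>2 \<le> Re (\<nu> (adj p o\<^sub>L p))"
  obtains g where "g \<in> H" "\<And>\<alpha>. word_coeff g \<alpha> = coord h \<alpha>"
proof -
  let ?V = "{f. \<exists>p. rep p f}"
  define \<phi> where "\<phi> f = cinner (blinfun_apply (SOME p. rep p f) vacuum) h" for f
  have le: "norm (blinfun_apply p vacuum) \<le> nrm f" if "rep p f" for p f
    by (rule power2_le_imp_le) (use dom[OF rep_mem(2)] nrm_sq_rep rep_mem(3) that in auto)
  have \<phi>: "\<phi> f = cinner (blinfun_apply p vacuum) h" if pf: "rep p f" for p f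
  proof -
    let ?q = "SOME p. rep p f"
    have q: "rep ?q f" using pf by (rule someI)
    have f: "f \<in> H" by (rule rep_mem[OF pf])
    have "(nrm (nf_diff f f))\<^sup>2 = 0" using f by (simp add: nrm_sq ip_simps)
    then have "blinfun_apply (?q - p) vacuum = 0" using le[OF rep_diff[OF q pf]] by simp
    then show ?thesis by (simp add: \<phi>_def blinfun.diff_left)
  qed
  have 1: "\<phi> (nf_add f g) = \<phi> f + \<phi> g" if fg: "f \<in> ?V" "g \<in> ?V" for f g
  proof -
    obtain p q where pq: "rep p f" "rep q g" using fg by auto
    show ?thesis
      by (simp add: \<phi>[OF rep.add[OF pq]] \<phi>[OF pq(1)] \<phi>[OF pq(2)] blinfun.add_left cinner_add_left)
  qed
  have 2: "\<phi> (nf_scale c f) = cnj c * \<phi> f" if f: "f \<in> ?V" for c f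
  proof -
    obtain p where p: "rep p f" using f by auto
    show ?thesis
      by (simp add: \<phi>[OF rep.scale[OF p]] \<phi>[OF p] blinfun_apply_cscale_op cinner_cscale_left)
  qed
  have 3: "cmod (\<phi> f) \<le> norm h * nrm f" if f: "f \<in> ?V" for f
  proof -
    obtain p where p: "rep p f" using f by auto
    have "cmod (\<phi> f) \<le> norm (blinfun_apply p vacuum) * norm h"
      unfolding \<phi>[OF p] by (rule norm_cinner_le)
    also have "\<dots> \<le> nrm f * norm h" by (intro mult_right_mono le p) simp
    finally show ?thesis by (simp add: mult.commute)
  qed
  show ?thesis
  proof (rule riesz_subspace[OF rep_subspace 1 2 3])
    fix g X assume g: "g \<in> H" "\<And>f. f \<in> ?V \<Longrightarrow> ip f g = \<phi> f"
    have "word_coeff g \<alpha> = coord h \<alpha>" for \<alpha>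
      using g(2)[of "word_fun \<alpha>"] rep.word[of \<alpha>] \<phi>[OF rep.word[of \<alpha>]]
      by (auto simp: ip_word_fun[OF g(1)] word_op_ket cinner_ket_left)
    then show ?thesis using that[OF g(1)] by simp
  qed
qed

end

section \<open>Absolute continuity and density\<close>

lemma norm_nonneg_complex: "0 \<le> (z :: complex) \<Longrightarrow> cmod z = Re z"
  by (simp add: less_eq_complex_def cmod_eq_Re)

text \<open>A weakly null Cauchy sequence is null: expand \<open>\<parallel>u\<^sub>n\<parallel>\<^sup>2\<close> around a fixed late member \<open>u\<^sub>N\<close>, where the cross
  term tends to zero and the remaining square is small.\<close>

lemma tendsto_sq_weak:
  fixes u :: "nat \<Rightarrow> 'a ell2"
  assumes cauchy: "\<And>e. e > 0 \<Longrightarrow> \<exists>N. \<forall>n\<ge>N. \<forall>k\<ge>N. (norm (u n - u k))\<^sup>2 < e"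
    and weak: "\<And>h. (\<lambda>n. cinner (u n) h) \<longlonglongrightarrow> 0"
  shows "u \<longlonglongrightarrow> 0"
proof -
  have "(\<lambda>n. (norm (u n))\<^sup>2) \<longlonglongrightarrow> 0"
  proof (rule LIMSEQ_I)
    fix e :: real assume e: "e > 0"
    obtain N where N: "\<And>n k. n \<ge> N \<Longrightarrow> k \<ge> N \<Longrightarrow> (norm (u n - u k))\<^sup>2 < e / 2"
      using cauchy[of "e / 2"] e by auto
    have lim: "(\<lambda>n. 2 * Re (cinner (u n) (u N))) \<longlonglongrightarrow> 2 * Re 0"
      by (intro tendsto_intros weak)
    have "\<forall>\<^sub>F n in sequentially. 2 * Re (cinner (u n) (u N)) < e / 2"
      by (rule order_tendstoD(2)[OF lim]) (use e in simp)
    then obtain N' where N': "\<And>n. n \<ge> N' \<Longrightarrow> 2 * Re (cinner (u n) (u N)) < e / 2"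
      unfolding eventually_sequentially by blast
    show "\<exists>N. \<forall>n\<ge>N. norm ((norm (u n))\<^sup>2 - 0) < e"
    proof (intro exI[of _ "max N N'"] allI impI)
      fix n assume n: "max N N' \<le> n"
      have "(norm (u n))\<^sup>2 = (norm (u n - u N))\<^sup>2 + 2 * Re (cinner (u n) (u N)) - (norm (u N))\<^sup>2"
        by (simp add: power2_norm_eq_inner inner_diff_left inner_diff_right inner_commute
            flip: inner_ell2_def)
      also have "\<dots> \<le> (norm (u n - u N))\<^sup>2 + 2 * Re (cinner (u n) (u N))" by simp
      also have "\<dots> < e / 2 + e / 2" using N[of n N] N'[of n] n by (intro add_strict_mono) auto
      finally show "norm ((norm (u n))\<^sup>2 - 0) < e" by simp
    qed
  qed
  then have "(\<lambda>n. sqrt ((norm (u n))\<^sup>2)) \<longlonglongrightarrow> sqrt 0" by (intro tendsto_intros)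
  then show ?thesis by (simp add: tendsto_norm_zero_iff)
qed

theorem corollary5p4:
  fixes \<mu> :: "'d::finite list op \<Rightarrow> complex"
    and H :: "'d nc_fun set"
    and ip :: "'d nc_fun \<Rightarrow> 'd nc_fun \<Rightarrow> complex"
  assumes "positive_nc_measure \<mu>"
    and "nc_rkhs (herglotz_kernel (\<lambda>T. \<mu> T + nc_lebesgue T)) H ip"
  shows "absolutely_continuous_nc \<mu> \<longleftrightarrow> dense_in_norm ip (H \<inter> nc_hardy) H"
proof -
  note \<mu> = assms(1)
  interpret herglotz_space "\<lambda>T. \<mu> T + nc_lebesgue T" H ip
    by (intro herglotz_space.intro herglotz_space_axioms.intro assms positive_nc_measure_add_lebesgue)
  let ?D = "H \<inter> nc_hardy"
  have form: "Re (\<mu> (adj p o\<^sub>L p) + nc_lebesgue (adj p o\<^sub>L p))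
      = Re (\<mu> (adj p o\<^sub>L p)) + (norm (blinfun_apply p vacuum))\<^sup>2" if "p \<in> disk_algebra" for p
    by (simp add: nc_lebesgue_form[OF that] cinner_self_norm del: of_real_power)
  have pos: "0 \<le> Re (\<mu> (adj p o\<^sub>L p))" "cmod (\<mu> (adj p o\<^sub>L p)) = Re (\<mu> (adj p o\<^sub>L p))"
    if "p \<in> disk_algebra" for p
    using measure_form_nonneg[OF \<mu> that] by (simp_all add: norm_nonneg_complex less_eq_complex_def)
  have nrm_rep: "(nrm f)\<^sup>2 = Re (\<mu> (adj p o\<^sub>L p)) + (norm (blinfun_apply p vacuum))\<^sup>2"
    if "rep p f" for p f
    using nrm_sq_rep[OF that] form[OF rep_mem(2)[OF that]] by simp
  show ?thesis
  proof
    assume ac: "absolutely_continuous_nc \<mu>"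
    have triv: "x = nf_zero" if x: "x \<in> H" and orth: "\<And>g. g \<in> ?D \<Longrightarrow> ip g x = 0" for x
    proof -
      obtain p X where X: "\<And>n. rep (p n) (X n)" and lim: "(\<lambda>n. nrm (nf_diff (X n) x)) \<longlonglongrightarrow> 0"
        using rep_dense[OF x] by blast
      note XH = rep_mem(3)[OF X] and pA = rep_mem(2)[OF X]
      define u where "u n = blinfun_apply (p n) vacuum" for n
      have diff: "(nrm (nf_diff (X n) (X k)))\<^sup>2
          = Re (\<mu> (adj (p n - p k) o\<^sub>L (p n - p k))) + (norm (u n - u k))\<^sup>2" for n k
        using nrm_rep[OF rep_diff[OF X X], of n k] by (simp add: u_def blinfun.diff_left)
      have pA': "p n - p k \<in> disk_algebra" for n k by (intro disk_algebra_diff pA)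
      have cauchy: "\<exists>N. \<forall>n\<ge>N. \<forall>k\<ge>N. (nrm (nf_diff (X n) (X k)))\<^sup>2 < e" if "e > 0" for e
        by (rule cauchy_if_convergent[OF XH x lim that])
      \<comment> \<open>The vector \<open>h\<close> corresponds to an element of the intersection, to which \<open>x\<close> is orthogonal.\<close>
      have weak: "(\<lambda>n. cinner (u n) h) \<longlonglongrightarrow> 0" for h
      proof (rule ex_word_coeff_eq[of h])
        show "(norm (blinfun_apply p vacuum))\<^sup>2 \<le> Re (\<mu> (adj p o\<^sub>L p) + nc_lebesgue (adj p o\<^sub>L p))"
          if "p \<in> disk_algebra" for p
          using form[OF that] pos(1)[OF that] by simp
        fix g assume g: "g \<in> H" "\<And>\<alpha>. word_coeff g \<alpha> = coord h \<alpha>"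
        have "g \<in> nc_hardy" by (rule mem_nc_hardyI[OF g])
        then have "ip g x = 0" using g(1) orth by simp
        then have "ip x g = 0" using ip_commute[OF g(1) x] by simp
        moreover have "(\<lambda>n. ip (X n) g) \<longlonglongrightarrow> ip x g" by (intro tendsto_ip XH x g(1) lim)
        moreover have "ip (X n) g = cinner (u n) h" for n
          unfolding u_def by (rule ip_rep_coord[OF X g])
        ultimately show "(\<lambda>n. cinner (u n) h) \<longlonglongrightarrow> 0" by simp
      qed
      have u: "u \<longlonglongrightarrow> 0"
      proof (rule tendsto_sq_weak[OF _ weak])
        fix e :: real assume "e > 0"
        then obtain N where N: "\<And>n k. n \<ge> N \<Longrightarrow> k \<ge> N \<Longrightarrow> (nrm (nf_diff (X n) (X k)))\<^sup>2 < e"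
          using cauchy by blast
        have "(norm (u n - u k))\<^sup>2 < e" if "n \<ge> N" "k \<ge> N" for n k
          using N[OF that] diff[of n k] pos(1)[OF pA', of n k] by linarith
        then show "\<exists>N. \<forall>n\<ge>N. \<forall>k\<ge>N. (norm (u n - u k))\<^sup>2 < e" by blast
      qed
      have "((\<lambda>(n, k). nc_form \<mu> (p n - p k) (p n - p k)) \<longlongrightarrow> 0) (sequentially \<times>\<^sub>F sequentially)"
      proof (rule tendsto_prod_sequentiallyI)
        fix e :: real assume "e > 0"
        then obtain N where N: "\<And>n k. n \<ge> N \<Longrightarrow> k \<ge> N \<Longrightarrow> (nrm (nf_diff (X n) (X k)))\<^sup>2 < e"
          using cauchy by blast
        have "cmod (nc_form \<mu> (p n - p k) (p n - p k)) < e" if "n \<ge> N" "k \<ge> N" for n k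
          using N[OF that] diff[of n k] pos(2)[OF pA', of n k] zero_le_power2[of "norm (u n - u k)"]
          unfolding nc_form_def by linarith
        then show "\<exists>N. \<forall>n\<ge>N. \<forall>k\<ge>N. cmod (nc_form \<mu> (p n - p k) (p n - p k)) < e" by blast
      qed
      then have "(\<lambda>n. nc_form \<mu> (p n) (p n)) \<longlonglongrightarrow> 0"
        using ac pA u unfolding absolutely_continuous_nc_def u_def by blast
      then have "(\<lambda>n. Re (nc_form \<mu> (p n) (p n)) + (norm (u n))\<^sup>2) \<longlonglongrightarrow> Re 0 + (norm (0 :: 'd list ell2))\<^sup>2"
        by (intro tendsto_intros u)
      then have "(\<lambda>n. (nrm (X n))\<^sup>2) \<longlonglongrightarrow> 0"
        using nrm_rep[OF X] by (simp add: nc_form_def u_def)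
      then have "(nrm x)\<^sup>2 = 0"
        using tendsto_nrm_sq[OF XH x lim] LIMSEQ_unique by blast
      then show ?thesis using nrm_eq_0[OF x] by simp
    qed
    show "dense_in_norm ip ?D H"
      unfolding dense_in_norm_def
    proof (intro conjI ballI allI impI)
      fix f and e :: real assume f: "f \<in> H" and e: "e > 0"
      show "\<exists>g\<in>?D. nrm (nf_diff f g) < e"
      proof (rule dense_if_orthogonal_trivial[OF hardy_subspace triv f])
        fix X assume X: "\<And>n. X n \<in> ?D" "(\<lambda>n. nrm (nf_diff (X n) f)) \<longlonglongrightarrow> 0"
        obtain n where "nrm (nf_diff (X n) f) < e"
          using order_tendstoD(2)[OF X(2) e] eventually_happens'[OF sequentially_bot] by blast
        then show ?thesis using X(1)[of n] nrm_diff_commute[OF _ f, of "X n"] by auto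
      qed
    qed simp
  next
    assume dense: "dense_in_norm ip ?D H"
    show "absolutely_continuous_nc \<mu>"
      unfolding absolutely_continuous_nc_def
    proof (intro allI impI)
      fix a :: "nat \<Rightarrow> 'd list op"
      assume aA: "\<forall>n. a n \<in> disk_algebra" and a0: "(\<lambda>n. blinfun_apply (a n) vacuum) \<longlonglongrightarrow> 0"
        and ac: "((\<lambda>(n, k). nc_form \<mu> (a n - a k) (a n - a k)) \<longlongrightarrow> 0) (sequentially \<times>\<^sub>F sequentially)"
      define r where "r n = inverse (real (Suc n))" for n
      have r: "r \<longlonglongrightarrow> 0" unfolding r_def by (rule LIMSEQ_inverse_real_of_nat)
      have r_pos: "0 < r n" for n by (simp add: r_def)
      \<comment> \<open>Elements of the algebra are replaced by polynomials \<open>p n\<close>, whose errors \<open>d n\<close> are negligible in both forms.\<close>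
      have "\<forall>n. \<exists>q. q \<in> nc_polynomials \<and> dist q (a n) < r n"
      proof
        fix n
        have "a n \<in> closure nc_polynomials" using aA disk_algebra_subset_closure by blast
        then show "\<exists>q. q \<in> nc_polynomials \<and> dist q (a n) < r n"
          using r_pos[of n] unfolding closure_approachable by blast
      qed
      then obtain p where p: "\<And>n. p n \<in> nc_polynomials" "\<And>n. dist (p n) (a n) < r n"
        using choice[of "\<lambda>n q. q \<in> nc_polynomials \<and> dist q (a n) < r n"] by blast
      have "\<forall>n. \<exists>f. rep (p n) f" using ex_rep p(1) by blast
      then obtain X where X: "\<And>n. rep (p n) (X n)" using choice[of "\<lambda>n. rep (p n)"] by blast
      note XH = rep_mem(3)[OF X] and pA = rep_mem(2)[OF X]
      have aA: "a n \<in> disk_algebra" for n using aA by blast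
      define d where "d n = a n - p n" for n
      define l where "l = Re (\<mu> id_blinfun)"
      have dA: "d n \<in> disk_algebra" for n unfolding d_def by (intro disk_algebra_diff aA pA)
      have dr: "norm (d n) \<le> r n" for n using p(2)[of n] by (simp add: d_def dist_norm norm_minus_commute)
      have l: "0 \<le> l" using measure_id_nonneg[OF \<mu>] by (simp add: l_def less_eq_complex_def)
      have form_le: "Re (\<mu> (adj b o\<^sub>L b)) \<le> (norm b)\<^sup>2 * l" if "b \<in> disk_algebra" for b
        using measure_form_le[OF \<mu> that] by (simp add: less_eq_complex_def l_def)
      define u where "u n = blinfun_apply (p n) vacuum" for n
      have "(\<lambda>n. blinfun_apply (d n) vacuum) \<longlonglongrightarrow> 0"
      proof (rule Lim_null_comparison)
        show "\<forall>\<^sub>F n in sequentially. norm (blinfun_apply (d n) vacuum) \<le> r n * norm (vacuum :: 'd list ell2)"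
        proof (intro always_eventually allI)
          fix n
          have "norm (blinfun_apply (d n) vacuum) \<le> norm (d n) * norm (vacuum :: 'd list ell2)"
            by (rule norm_blinfun)
          also have "\<dots> \<le> r n * norm (vacuum :: 'd list ell2)" by (intro mult_right_mono dr) simp
          finally show "norm (blinfun_apply (d n) vacuum) \<le> r n * norm (vacuum :: 'd list ell2)" .
        qed
        show "(\<lambda>n. r n * norm (vacuum :: 'd list ell2)) \<longlonglongrightarrow> 0"
          using tendsto_mult_right[OF r, of "norm (vacuum :: 'd list ell2)"] by simp
      qed
      then have "(\<lambda>n. blinfun_apply (a n) vacuum - blinfun_apply (d n) vacuum) \<longlonglongrightarrow> 0 - 0"
        by (intro tendsto_diff a0)
      then have u: "u \<longlonglongrightarrow> 0" by (simp add: u_def[abs_def] d_def blinfun.diff_left)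
      let ?F = "sequentially \<times>\<^sub>F sequentially :: (nat \<times> nat) filter"
      \<comment> \<open>An upper bound for the squared distance in \<open>H\<close> of the transforms of \<open>p n\<close> and \<open>p k\<close>.\<close>
      define G where "G n k = 2 * Re (nc_form \<mu> (a n - a k) (a n - a k)) + 2 * ((r n + r k)\<^sup>2 * l)
          + (norm (u n - u k))\<^sup>2" for n k
      have nrm_le: "(nrm (nf_diff (X n) (X k)))\<^sup>2 \<le> G n k" for n k
      proof -
        have eq: "p n - p k = (a n - a k) + (d k - d n)" by (simp add: d_def)
        have "Re (\<mu> (adj (p n - p k) o\<^sub>L (p n - p k)))
            \<le> 2 * Re (nc_form \<mu> (a n - a k) (a n - a k)) + 2 * Re (\<mu> (adj (d k - d n) o\<^sub>L (d k - d n)))"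
          unfolding eq nc_form_def by (intro Re_measure_form_add_le[OF \<mu>] disk_algebra_diff aA dA)
        moreover have "Re (\<mu> (adj (d k - d n) o\<^sub>L (d k - d n))) \<le> (norm (d k - d n))\<^sup>2 * l"
          by (intro form_le disk_algebra_diff dA)
        moreover have "(norm (d k - d n))\<^sup>2 * l \<le> (r n + r k)\<^sup>2 * l"
        proof (intro mult_right_mono power_mono l)
          show "norm (d k - d n) \<le> r n + r k"
            using norm_triangle_ineq4[of "d k" "d n"] dr[of n] dr[of k] by linarith
        qed simp
        moreover have "(nrm (nf_diff (X n) (X k)))\<^sup>2
            = Re (\<mu> (adj (p n - p k) o\<^sub>L (p n - p k))) + (norm (u n - u k))\<^sup>2"
          using nrm_rep[OF rep_diff[OF X X], of n k] by (simp add: u_def blinfun.diff_left)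
        ultimately show ?thesis unfolding G_def by linarith
      qed
      have lims: "((\<lambda>x. r (fst x)) \<longlongrightarrow> 0) ?F" "((\<lambda>x. r (snd x)) \<longlongrightarrow> 0) ?F"
          "((\<lambda>x. u (fst x)) \<longlongrightarrow> 0) ?F" "((\<lambda>x. u (snd x)) \<longlongrightarrow> 0) ?F"
        by (rule filterlim_compose[OF r filterlim_fst] filterlim_compose[OF r filterlim_snd]
            filterlim_compose[OF u filterlim_fst] filterlim_compose[OF u filterlim_snd])+
      have ac': "((\<lambda>x. nc_form \<mu> (a (fst x) - a (snd x)) (a (fst x) - a (snd x))) \<longlongrightarrow> 0) ?F"
        using ac by (simp add: case_prod_unfold)
      have "((\<lambda>x. G (fst x) (snd x)) \<longlongrightarrow> 2 * Re 0 + 2 * ((0 + 0)\<^sup>2 * l) + (norm (0 - 0 :: 'd list ell2))\<^sup>2) ?F"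
        unfolding G_def by (intro tendsto_intros lims ac')
      then have G: "((\<lambda>(n, k). G n k) \<longlongrightarrow> 0) ?F" by (simp add: case_prod_unfold)
      obtain x where x: "x \<in> H" and lim: "(\<lambda>n. nrm (nf_diff (X n) x)) \<longlonglongrightarrow> 0"
      proof (rule complete_eps[OF XH])
        fix e :: real assume e: "e > 0"
        show "\<exists>N. \<forall>n\<ge>N. \<forall>k\<ge>N. (nrm (nf_diff (X n) (X k)))\<^sup>2 < e"
        proof (rule tendsto_prod_sequentiallyD[OF G e])
          fix N assume N: "\<And>n k. n \<ge> N \<Longrightarrow> k \<ge> N \<Longrightarrow> norm (G n k) < e"
          have "(nrm (nf_diff (X n) (X k)))\<^sup>2 < e" if "n \<ge> N" "k \<ge> N" for n k
            using N[OF that] nrm_le[of n k] by simp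
          then show ?thesis by blast
        qed
      qed (rule that)
      \<comment> \<open>The limit \<open>x\<close> pairs with the intersection as the vectors \<open>u n\<close> do with its coefficients, and they tend to zero.\<close>
      have orth: "ip x g = 0" if g: "g \<in> ?D" for g
      proof -
        have gH: "g \<in> H" and gh: "g \<in> nc_hardy" using g by auto
        show ?thesis
        proof (rule mem_nc_hardyD[OF gh])
          fix h assume h: "\<And>\<alpha>. word_coeff g \<alpha> = coord h \<alpha>"
          have eq: "ip (X n) g = cinner (u n) h" for n
            unfolding u_def by (rule ip_rep_coord[OF X gH h])
          have "(\<lambda>n. cinner (u n) h) \<longlonglongrightarrow> cinner 0 h" by (intro tendsto_cinner u tendsto_const)
          moreover have "(\<lambda>n. cinner (u n) h) \<longlonglongrightarrow> ip x g"
            using tendsto_ip(1)[OF XH x gH lim] unfolding eq .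
          ultimately show ?thesis using LIMSEQ_unique by fastforce
        qed
      qed
      have x0: "nrm x = 0"
      proof (rule ccontr)
        assume "nrm x \<noteq> 0"
        then have xp: "0 < nrm x" using nrm_nonneg[OF x] by simp
        then obtain g where g: "g \<in> ?D" "nrm (nf_diff x g) < nrm x"
          using dense x unfolding dense_in_norm_def by blast
        have gH: "g \<in> H" using g by simp
        have "ip x (nf_diff x g) = of_real ((nrm x)\<^sup>2)"
          using x gH orth[OF g(1)] by (simp add: ip_diff_right ip_self)
        then have "(nrm x)\<^sup>2 = cmod (ip x (nf_diff x g))" by (simp add: norm_power)
        also have "\<dots> \<le> nrm x * nrm (nf_diff x g)" by (intro norm_ip_le x diff_mem gH)
        also have "\<dots> < nrm x * nrm x" using g(2) xp by simp
        finally show False by (simp add: power2_eq_square)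
      qed
      have Xn: "(\<lambda>n. (nrm (X n))\<^sup>2) \<longlonglongrightarrow> 0" using tendsto_nrm_sq[OF XH x lim] x0 by simp
      have bound: "norm (nc_form \<mu> (a n) (a n)) \<le> 2 * (nrm (X n))\<^sup>2 + 2 * ((r n)\<^sup>2 * l)" for n
      proof -
        have eq: "a n = p n + d n" by (simp add: d_def)
        have "norm (nc_form \<mu> (a n) (a n)) = Re (\<mu> (adj (p n + d n) o\<^sub>L (p n + d n)))"
          unfolding nc_form_def using pos(2)[OF aA[of n]] eq by simp
        also have "\<dots> \<le> 2 * Re (\<mu> (adj (p n) o\<^sub>L p n)) + 2 * Re (\<mu> (adj (d n) o\<^sub>L d n))"
          by (intro Re_measure_form_add_le[OF \<mu>] pA dA)
        also have "Re (\<mu> (adj (p n) o\<^sub>L p n)) \<le> (nrm (X n))\<^sup>2" using nrm_rep[OF X[of n]] by simp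
        also have "Re (\<mu> (adj (d n) o\<^sub>L d n)) \<le> (norm (d n))\<^sup>2 * l" by (rule form_le[OF dA])
        also have "(norm (d n))\<^sup>2 * l \<le> (r n)\<^sup>2 * l"
          by (intro mult_right_mono power_mono dr l) simp
        finally show ?thesis by simp
      qed
      have "(\<lambda>n. 2 * (nrm (X n))\<^sup>2 + 2 * ((r n)\<^sup>2 * l)) \<longlonglongrightarrow> 2 * 0 + 2 * (0\<^sup>2 * l)"
        by (intro tendsto_intros Xn r)
      then have "(\<lambda>n. 2 * (nrm (X n))\<^sup>2 + 2 * ((r n)\<^sup>2 * l)) \<longlonglongrightarrow> 0" by simp
      then show "(\<lambda>n. nc_form \<mu> (a n) (a n)) \<longlonglongrightarrow> 0"
        by (rule Lim_null_comparison[OF always_eventually, rotated]) (intro allI bound)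
    qed
  qed
qed

end
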